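(* In each of the two cases (L) and (H): let $\Delta\ge 84\,C_\varphi$ and $\kappa\ge1$, and let $\widehat f_w=\sum_{k=1}^{M_n}w_k\widehat f_k$ be the aggregated estimator using either the Bayesian weights $w=\widetilde w$ or the model selection weights $w=\widehat w$. Suppose the density $f\in L^2(A)$ satisfies $\|f\|_\infty<\infty$, $\mathbb{E}_f(|X_1|^{2\alpha})<\infty$ and $b_k(f)>0$ for all $k\in\mathbb{N}$. Assume in addition that there is $n_f\in\mathbb{N}$ such that $$M_n^{1/2}\ge (k_n^\circ)^{1/2}\ge\frac{1\vee400\|f\|_\infty}{C_\varphi v_f}\,|\log R_n^\circ(f)|\qquad\text{for all } n\ge n_f.$$ Then there is a constant $C_f$ depending only on $f$ such that for all $n\in\mathbb{N}$ (with $M_n$ well defined and $M_n\ge1$) $$\mathbb{E}^n_f\|\widehat f_w-f\|_A^2\le C_f\,R_n^\circ(f).$$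
   Context: Two cases are considered. Case (L): $A=(0,\infty)$, $\varphi_j=\ell_j$ are the Laguerre functions $\ell_j(x)=\sqrt2\,L_j(2x)e^{-x}\mathbf 1_{(0,\infty)}(x)$, $L_j(x)=\sum_{k=0}^j(-1)^k\binom jk\frac{x^k}{k!}$; $\alpha=-1/2$, $d=1$, $M_n=\lfloor n^2(600\log n)^{-4}\rfloor$. Case (H): $A=\mathbb{R}$, $\varphi_j=h_j$ are the Hermite functions $h_j(x)=(2^jj!\sqrt\pi)^{-1/2}H_j(x)e^{-x^2/2}$, $H_j(x)=(-1)^je^{x^2}\frac{d^j}{dx^j}e^{-x^2}$; $\alpha=2/3$, $d=10/12$, $M_n=n^2$. In each case $(\varphi_j)_{j\ge0}$ is an orthonormal basis of $L^2(A)$ with usual inner product $\langle\cdot,\cdot\rangle_A$ and norm $\|\cdot\|_A$; $\|\cdot\|_\infty$ is the sup norm; $a\vee b=\max(a,b)$. $X_1,\dots,X_n$ are i.i.d. with probability density $f\in L^2(A)$ supported in $A$; $\mathbb{E}_f$, $\mathbb{E}_f^n$ denote expectation under the marginal and joint law. Put $a_j(f)=\langle f,\varphi_j\rangle_A$ and define $b_k(f)\in[0,1]$ by $\|f\|_A^2b_k^2(f)=\sum_{j\ge k}|a_j(f)|^2$. Put $v_f=\mathbb{E}_f(|X_1|^{\alpha})+1$, $\widehat v=1+\frac1n\sum_{i=1}^n|X_i|^\alpha$, $R_n^k(f)=b_k^2(f)\vee n^{-1}k^{1/2}$, $R_n^\circ(f)=\min_{k\in\mathbb{N}}R_n^k(f)$,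 and let $k_n^\circ$ be the smallest $k\in\mathbb{N}$ with $R_n^k(f)=R_n^\circ(f)$. $C_\varphi\ge1$ is a fixed numerical constant such that for all $k\in\mathbb{N}$ (and all densities $f$): $\|\sum_{j=0}^{k-1}\varphi_j^2\|_\infty\le C_\varphi k^{d}$ and $\sum_{j=0}^{k-1}\mathbb{E}_f(\varphi_j^2(X_1))\le C_\varphi v_fk^{1/2}$. Orthogonal series estimators: $\widehat f_k=\sum_{j=0}^{k-1}\widehat a_j\varphi_j$, $\widehat a_j=\frac1n\sum_{i=1}^n\varphi_j(X_i)$. Penalties: $\widehat{\mathrm{pen}}_k=\Delta\,\widehat v\,k^{1/2}n^{-1}$. Bayesian weights: $$\widetilde w_k=\frac{\exp(-\kappa n\{-\|\widehat f_k\|_A^2+\widehat{\mathrm{pen}}_k\})}{\sum_{l=1}^{M_n}\exp(-\kappa n\{-\|\widehat f_l\|_A^2+\widehat{\mathrm{pen}}_l\})},\quad 1\le k\le M_n.$$ Model selection weights: $\widehat w_k=\mathbf 1\{k=\widehat k\}$, where $\widehat k$ is the smallest minimiser of $k\mapsto-\|\widehat f_k\|_A^2+\widehat{\mathrm{pen}}_k$ over $\{1,\dots,M_n\}$. $\Delta$ and $\kappa$ are fixed numerical constants (not depending on $f$ or $n$). *)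

theory Defs
  imports "HOL-Probability.Probability"
begin

datatype setting = Laguerre | Hermite

definition laguerre_poly :: "nat \<Rightarrow> real \<Rightarrow> real" where
  "laguerre_poly j x = (\<Sum>k\<le>j. (- 1) ^ k * real (j choose k) * x ^ k / fact k)"

definition laguerre_fun :: "nat \<Rightarrow> real \<Rightarrow> real" where
  "laguerre_fun j x = sqrt 2 * laguerre_poly j (2 * x) * exp (- x) * indicator {0<..} x"

definition hermite_poly :: "nat \<Rightarrow> real \<Rightarrow> real" where
  "hermite_poly j x = (- 1) ^ j * exp (x\<^sup>2) * (deriv ^^ j) (\<lambda>y. exp (- y\<^sup>2)) x"

definition hermite_fun :: "nat \<Rightarrow> real \<Rightarrow> real" where
  "hermite_fun j x =
     (2 ^ j * fact j * sqrt pi) powr (- (1 / 2)) * hermite_poly j x * exp (- x\<^sup>2 / 2)"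

fun domain_of :: "setting \<Rightarrow> real set" where
  "domain_of Laguerre = {0<..}"
| "domain_of Hermite = UNIV"

fun basis_fun :: "setting \<Rightarrow> nat \<Rightarrow> real \<Rightarrow> real" where
  "basis_fun Laguerre = laguerre_fun"
| "basis_fun Hermite = hermite_fun"

fun alpha_of :: "setting \<Rightarrow> real" where
  "alpha_of Laguerre = - 1 / 2"
| "alpha_of Hermite = 2 / 3"

fun d_of :: "setting \<Rightarrow> real" where
  "d_of Laguerre = 1"
| "d_of Hermite = 10 / 12"

text \<open>In the Laguerre case \<open>n = 1\<close> makes the denominator vanish, so that the value is the
  junk value \<open>0\<close>; it is excluded wherever \<open>max_dim s n \<ge> 1\<close> is required.\<close>

fun max_dim :: "setting \<Rightarrow> nat \<Rightarrow> nat" where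
  "max_dim Laguerre n = nat \<lfloor>real n ^ 2 / (600 * ln (real n)) ^ 4\<rfloor>"
| "max_dim Hermite n = n ^ 2"

definition inner_on :: "real set \<Rightarrow> (real \<Rightarrow> real) \<Rightarrow> (real \<Rightarrow> real) \<Rightarrow> real" where
  "inner_on A g h = (LINT x:A|lborel. g x * h x)"

definition norm_on :: "real set \<Rightarrow> (real \<Rightarrow> real) \<Rightarrow> real" where
  "norm_on A g = sqrt (inner_on A g g)"

definition sup_norm :: "(real \<Rightarrow> real) \<Rightarrow> ereal" where
  "sup_norm g = (SUP x. ereal \<bar>g x\<bar>)"

definition L2_density :: "real set \<Rightarrow> (real \<Rightarrow> real) \<Rightarrow> bool" where
  "L2_density A f \<longleftrightarrow>
     f \<in> borel_measurable borel \<and> (\<forall>x. 0 \<le> f x) \<and> (\<forall>x. x \<notin> A \<longrightarrow> f x = 0) \<and>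
     (\<integral>\<^sup>+ x. ennreal (f x) \<partial>lborel) = 1 \<and>
     set_integrable lborel A (\<lambda>x. (f x)\<^sup>2)"

definition law :: "(real \<Rightarrow> real) \<Rightarrow> real measure" where
  "law f = density lborel (\<lambda>x. ennreal (f x))"

text \<open>Joint law of an i.i.d. sample: the observation \<open>X\<^sub>i\<close> is the coordinate \<open>X i\<close> of the
  sample point \<open>X\<close>, for \<open>i = 1, \<dots>, n\<close>.\<close>

definition sample_law :: "(real \<Rightarrow> real) \<Rightarrow> nat \<Rightarrow> (nat \<Rightarrow> real) measure" where
  "sample_law f n = Pi\<^sub>M {1..n} (\<lambda>_. law f)"

definition coeff_of :: "setting \<Rightarrow> (real \<Rightarrow> real) \<Rightarrow> nat \<Rightarrow> real" where
  "coeff_of s f j = inner_on (domain_of s) f (basis_fun s j)"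

text \<open>The nonnegative solution of
  \<open>\<parallel>f\<parallel>\<^sup>2 b\<^sub>k\<^sup>2 = \<Sum>\<^bsub>j \<ge> k\<^esub> \<bar>a\<^sub>j(f)\<bar>\<^sup>2\<close>; the norm of a density is positive.\<close>

definition bias :: "setting \<Rightarrow> (real \<Rightarrow> real) \<Rightarrow> nat \<Rightarrow> real" where
  "bias s f k = sqrt ((\<Sum>j. \<bar>coeff_of s f (j + k)\<bar>\<^sup>2) / (norm_on (domain_of s) f)\<^sup>2)"

definition v_of :: "setting \<Rightarrow> (real \<Rightarrow> real) \<Rightarrow> real" where
  "v_of s f = (\<integral>x. \<bar>x\<bar> powr alpha_of s \<partial>law f) + 1"

definition rate :: "setting \<Rightarrow> (real \<Rightarrow> real) \<Rightarrow> nat \<Rightarrow> nat \<Rightarrow> real" where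
  "rate s f n k = max ((bias s f k)\<^sup>2) (sqrt (real k) / real n)"

text \<open>Here and below, dimensions range over the positive integers. For \<open>n \<ge> 1\<close> the infimum
  is attained, since \<open>rate s f n k\<close> tends to infinity with \<open>k\<close>.\<close>

definition oracle_rate :: "setting \<Rightarrow> (real \<Rightarrow> real) \<Rightarrow> nat \<Rightarrow> real" where
  "oracle_rate s f n = (INF k\<in>{1..}. rate s f n k)"

definition oracle_dim :: "setting \<Rightarrow> (real \<Rightarrow> real) \<Rightarrow> nat \<Rightarrow> nat" where
  "oracle_dim s f n = (LEAST k. 1 \<le> k \<and> rate s f n k = oracle_rate s f n)"

text \<open>The constant \<open>C\<^sub>\<phi>\<close>. The second bound is void for densities with
  \<open>E\<^sub>f(\<bar>X\<^sub>1\<bar>\<^sup>\<alpha>) = \<infinity>\<close>, whence the integrability premise.\<close>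

definition basis_constant :: "setting \<Rightarrow> real \<Rightarrow> bool" where
  "basis_constant s C \<longleftrightarrow> 1 \<le> C \<and>
     (\<forall>k\<ge>1. sup_norm (\<lambda>x. \<Sum>j<k. (basis_fun s j x)\<^sup>2) \<le> ereal (C * real k powr d_of s)) \<and>
     (\<forall>f. L2_density (domain_of s) f \<longrightarrow> integrable (law f) (\<lambda>x. \<bar>x\<bar> powr alpha_of s) \<longrightarrow>
        (\<forall>k\<ge>1. (\<Sum>j<k. \<integral>x. (basis_fun s j x)\<^sup>2 \<partial>law f) \<le> C * v_of s f * sqrt (real k)))"

definition coeff_hat :: "setting \<Rightarrow> nat \<Rightarrow> (nat \<Rightarrow> real) \<Rightarrow> nat \<Rightarrow> real" where
  "coeff_hat s n X j = (\<Sum>i=1..n. basis_fun s j (X i)) / real n"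

definition f_hat :: "setting \<Rightarrow> nat \<Rightarrow> (nat \<Rightarrow> real) \<Rightarrow> nat \<Rightarrow> real \<Rightarrow> real" where
  "f_hat s n X k x = (\<Sum>j<k. coeff_hat s n X j * basis_fun s j x)"

definition v_hat :: "setting \<Rightarrow> nat \<Rightarrow> (nat \<Rightarrow> real) \<Rightarrow> real" where
  "v_hat s n X = 1 + (\<Sum>i=1..n. \<bar>X i\<bar> powr alpha_of s) / real n"

definition pen_hat :: "setting \<Rightarrow> real \<Rightarrow> nat \<Rightarrow> (nat \<Rightarrow> real) \<Rightarrow> nat \<Rightarrow> real" where
  "pen_hat s \<Delta> n X k = \<Delta> * v_hat s n X * sqrt (real k) / real n"

definition contrast :: "setting \<Rightarrow> real \<Rightarrow> nat \<Rightarrow> (nat \<Rightarrow> real) \<Rightarrow> nat \<Rightarrow> real" where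
  "contrast s \<Delta> n X k = - (norm_on (domain_of s) (f_hat s n X k))\<^sup>2 + pen_hat s \<Delta> n X k"

definition bayes_weight ::
    "setting \<Rightarrow> real \<Rightarrow> real \<Rightarrow> nat \<Rightarrow> (nat \<Rightarrow> real) \<Rightarrow> nat \<Rightarrow> real" where
  "bayes_weight s \<Delta> \<kappa> n X k =
     exp (- \<kappa> * real n * contrast s \<Delta> n X k) /
     (\<Sum>l=1..max_dim s n. exp (- \<kappa> * real n * contrast s \<Delta> n X l))"

definition k_hat :: "setting \<Rightarrow> real \<Rightarrow> nat \<Rightarrow> (nat \<Rightarrow> real) \<Rightarrow> nat" where
  "k_hat s \<Delta> n X =
     (LEAST k. k \<in> {1..max_dim s n} \<and>
        (\<forall>l\<in>{1..max_dim s n}. contrast s \<Delta> n X k \<le> contrast s \<Delta> n X l))"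

definition selection_weight ::
    "setting \<Rightarrow> real \<Rightarrow> nat \<Rightarrow> (nat \<Rightarrow> real) \<Rightarrow> nat \<Rightarrow> real" where
  "selection_weight s \<Delta> n X k = (if k = k_hat s \<Delta> n X then 1 else 0)"

definition aggregate ::
    "setting \<Rightarrow> nat \<Rightarrow> ((nat \<Rightarrow> real) \<Rightarrow> nat \<Rightarrow> real) \<Rightarrow> (nat \<Rightarrow> real) \<Rightarrow> real \<Rightarrow> real" where
  "aggregate s n w X x = (\<Sum>k=1..max_dim s n. w X k * f_hat s n X k x)"

text \<open>The risk takes values in \<open>[0,\<infinity>]\<close>, so that a bound on it entails finiteness.\<close>

definition risk ::
    "setting \<Rightarrow> (real \<Rightarrow> real) \<Rightarrow> nat \<Rightarrow> ((nat \<Rightarrow> real) \<Rightarrow> nat \<Rightarrow> real) \<Rightarrow> ennreal" where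
  "risk s f n w =
     (\<integral>\<^sup>+ X. ennreal ((norm_on (domain_of s) (\<lambda>x. aggregate s n w X x - f x))\<^sup>2)
        \<partial>sample_law f n)"

end

theory Submission
  imports Defs "HOL-Computational_Algebra.Polynomial" "HOL-Real_Asymp.Real_Asymp"
begin

text \<open>By convexity the loss is at most \<open>\<Sum>\<^sub>k w\<^sub>k (V\<^sub>k + B\<^sub>k)\<close>, where, with
  the empirical coefficients \<open>\<alpha>\<^sub>j\<close>, \<open>V\<^sub>k = \<Sum>\<^bsub>j < k\<^esub> (\<alpha>\<^sub>j - a\<^sub>j)\<^sup>2\<close> and,
  by Parseval's identity, \<open>B\<^sub>k = \<Sum>\<^bsub>j \<ge> k\<^esub> a\<^sub>j\<^sup>2\<close>. Both weightings make \<open>w\<^sub>k\<close> exponentially small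
  in the excess of the contrast at \<open>k\<close> over the contrast at the oracle dimension. Below the oracle
  dimension this excess is at least half the bias \<open>B\<^sub>k\<close> up to terms of oracle size; above it, the
  excess is governed by the penalty as long as \<open>V\<^sub>k \<le> 16 C v \<surd>k / n\<close> and the estimate of \<open>v\<close> is at
  least \<open>v / 2\<close>. The second event fails with probability \<open>O(1/n)\<close> by Chebyshev's inequality.

  For the first event, \<open>n\<^sup>2 V\<^sub>k\<close> is the squared norm of a sum of i.i.d. centered vectors, and no
  Talagrand inequality is needed: the conditional variance of an increment of this squared norm is
  controlled by the sup norm of \<open>f\<close> times the current squared norm, so the squared norm, stopped when
  it leaves a ball, has exponential moments. The oracle assumption
  \<open>\<surd>k\<^sub>0 \<ge> 400 \<parallel>f\<parallel>\<^sub>\<infinity> \<bar>log R\<bar> / (C v)\<close> then makes the failure probabilities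
  summable with total \<open>O(R)\<close>, even after
  multiplication with the deterministic bounds on the \<open>V\<^sub>k\<close>.

  Completeness of the two bases follows from the fact that an exponentially integrable function all
  of whose moments vanish is zero, which is read off its Fourier transform.\<close>

section \<open>Square integrable functions and orthonormal systems\<close>

text \<open>The obstacle is an oracle dimension \<open>k0\<close> that grows slowly. The tail bound
  for \<open>V k\<close> has a part of order \<open>exp (- c * sqrt k)\<close>, and for
  \<open>k\<close> near \<open>k0\<close> only the assumed lower bound on \<open>sqrt k0\<close>
  makes it as small as the rate \<open>R\<close>. Its exponent is therefore split into equal halves:
  since 400 * 9 / 64 exceeds 1, one half is worth a factor \<open>R\<close>, and the other makes the
  sum over \<open>k\<close> converge. The second part of the tail bound depends on \<open>n\<close>;
  the cap on the dimensions keeps it eventually below 1 / n^5, which suffices against at most n^2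
  dimensions with losses of order at most n^2. The constants come from the contrast. Above
  \<open>k0\<close> the noise enters twice, so the threshold 16 takes 32 units of
  \<open>h * sqrt k\<close> from the penalty; 5 more absorb the terms at \<open>k0\<close> and 5
  remain as gain, hence 42. Replacing \<open>v\<close> by an estimate known only to be at least
  \<open>v / 2\<close> doubles this to 84. The threshold 16 itself leaves the exponent
  \<open>1 + 4 + 2 - 16\<close>, in units of \<open>t * n * H\<close>.\<close>

definition in_L2 :: "'a measure \<Rightarrow> ('a \<Rightarrow> real) \<Rightarrow> bool" where
  "in_L2 M g \<longleftrightarrow> g \<in> borel_measurable M \<and> integrable M (\<lambda>x. (g x)\<^sup>2)"

lemma in_L2_measurable [measurable_dest]:
  "in_L2 M g \<Longrightarrow> g \<in> borel_measurable M"
  by (simp add: in_L2_def)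

lemma in_L2_square: "in_L2 M g \<Longrightarrow> integrable M (\<lambda>x. (g x)\<^sup>2)"
  by (simp add: in_L2_def)

lemma in_L2_mult:
  assumes "in_L2 M g" "in_L2 M h"
  shows "integrable M (\<lambda>x. g x * h x)"
proof (rule Bochner_Integration.integrable_bound)
  show "integrable M (\<lambda>x. (g x)\<^sup>2 + (h x)\<^sup>2)"
    using assms by (simp add: in_L2_def)
  show "(\<lambda>x. g x * h x) \<in> borel_measurable M"
    using assms by (auto simp: in_L2_def)
  show "AE x in M. norm (g x * h x) \<le> norm ((g x)\<^sup>2 + (h x)\<^sup>2)"
  proof (rule AE_I2)
    fix x
    have "2 * \<bar>g x\<bar> * \<bar>h x\<bar> \<le> (g x)\<^sup>2 + (h x)\<^sup>2"
      using sum_squares_bound[of "\<bar>g x\<bar>" "\<bar>h x\<bar>"] by simp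
    moreover have "0 \<le> \<bar>g x\<bar> * \<bar>h x\<bar>" by simp
    ultimately have "\<bar>g x * h x\<bar> \<le> (g x)\<^sup>2 + (h x)\<^sup>2" unfolding abs_mult by linarith
    then show "norm (g x * h x) \<le> norm ((g x)\<^sup>2 + (h x)\<^sup>2)" by simp
  qed
qed

lemma in_L2_scale:
  "in_L2 M g \<Longrightarrow> in_L2 M (\<lambda>x. c * g x)"
  by (auto simp: in_L2_def power_mult_distrib)

lemma in_L2_add:
  assumes "in_L2 M g" "in_L2 M h"
  shows "in_L2 M (\<lambda>x. g x + h x)"
  using assms in_L2_mult[OF assms]
  by (auto simp: in_L2_def power2_sum mult.assoc)

lemma in_L2_diff:
  assumes "in_L2 M g" "in_L2 M h"
  shows "in_L2 M (\<lambda>x. g x - h x)"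
  using assms in_L2_mult[OF assms]
  by (auto simp: in_L2_def power2_diff mult.assoc)

lemma in_L2_zero: "in_L2 M (\<lambda>x. 0)"
  by (simp add: in_L2_def)

lemma in_L2_sum:
  assumes "\<And>i. i \<in> I \<Longrightarrow> in_L2 M (g i)"
  shows "in_L2 M (\<lambda>x. \<Sum>i\<in>I. g i x)"
  using assms
  by (induction I rule: infinite_finite_induct)
     (auto simp: in_L2_zero intro: in_L2_add)

lemma Cauchy_Schwarz_integral:
  assumes "in_L2 M g" "in_L2 M h"
  shows "(\<integral>x. g x * h x \<partial>M)\<^sup>2 \<le> (\<integral>x. (g x)\<^sup>2 \<partial>M) * (\<integral>x. (h x)\<^sup>2 \<partial>M)"
proof -
  let ?A = "\<integral>x. (g x)\<^sup>2 \<partial>M" and ?B = "\<integral>x. g x * h x \<partial>M" and ?D = "\<integral>x. (h x)\<^sup>2 \<partial>M"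
  note [simp] = assms[THEN in_L2_square] in_L2_mult[OF assms]
  have *: "0 \<le> ?A - 2 * t * ?B + t\<^sup>2 * ?D" for t
  proof -
    have "0 \<le> (\<integral>x. (g x - t * h x)\<^sup>2 \<partial>M)" by simp
    also have "\<dots> = (\<integral>x. (g x)\<^sup>2 - 2 * t * (g x * h x) + t\<^sup>2 * (h x)\<^sup>2 \<partial>M)"
      by (intro Bochner_Integration.integral_cong) (auto simp: power2_eq_square algebra_simps)
    also have "\<dots> = ?A - 2 * t * ?B + t\<^sup>2 * ?D"
      by simp
    finally show ?thesis .
  qed
  have "?D \<ge> 0" "?A \<ge> 0" by simp_all
  show ?thesis
  proof (cases "?D = 0")
    case True
    have "?B = 0"
    proof (rule ccontr)
      assume "?B \<noteq> 0"
      \<comment> \<open>With \<open>?D = 0\<close> the expression in \<open>*\<close> is affine in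
        \<open>t\<close>, and this \<open>t\<close> gives it the value -1.\<close>
      then show False using *[of "(?A + 1) / (2 * ?B)"] True by (simp add: field_simps)
    qed
    then show ?thesis by simp
  next
    case False
    then have "?D > 0" using \<open>?D \<ge> 0\<close> by linarith
    have "0 \<le> ?A - ?B\<^sup>2 / ?D"
      using *[of "?B / ?D"] \<open>?D > 0\<close> by (simp add: power2_eq_square field_simps)
    then show ?thesis using \<open>?D > 0\<close> by (simp add: field_simps)
  qed
qed

section \<open>Orthonormal systems: Bessel, Riesz-Fischer and Parseval\<close>

definition orthonormal :: "'a measure \<Rightarrow> (nat \<Rightarrow> 'a \<Rightarrow> real) \<Rightarrow> bool" where
  "orthonormal M \<phi> \<longleftrightarrow> (\<forall>j. in_L2 M (\<phi> j)) \<and>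
     (\<forall>i j. (\<integral>x. \<phi> i x * \<phi> j x \<partial>M) = of_bool (i = j))"

lemma orthonormal_in_L2_sum:
  "orthonormal M \<phi> \<Longrightarrow> in_L2 M (\<lambda>x. \<Sum>j\<in>J. c j * \<phi> j x)"
  by (intro in_L2_sum in_L2_scale) (simp add: orthonormal_def)

lemma orthonormal_integral_mult:
  assumes "orthonormal M \<phi>" "in_L2 M f"
  shows "(\<integral>x. (\<Sum>j\<in>J. c j * \<phi> j x) * f x \<partial>M) = (\<Sum>j\<in>J. c j * (\<integral>x. f x * \<phi> j x \<partial>M))"
proof -
  have *: "integrable M (\<lambda>x. c j * (f x * \<phi> j x))" for j
    using assms by (intro integrable_mult_right in_L2_mult) (auto simp: orthonormal_def)
  have "(\<integral>x. (\<Sum>j\<in>J. c j * \<phi> j x) * f x \<partial>M) = (\<integral>x. (\<Sum>j\<in>J. c j * (f x * \<phi> j x)) \<partial>M)"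
    by (intro Bochner_Integration.integral_cong refl)
       (simp add: sum_distrib_right mult.assoc mult.commute[of "f _"])
  also have "\<dots> = (\<Sum>j\<in>J. c j * (\<integral>x. f x * \<phi> j x \<partial>M))"
    by (subst Bochner_Integration.integral_sum[OF *]) simp
  finally show ?thesis .
qed

lemma orthonormal_norm_sum:
  assumes "orthonormal M \<phi>" "finite J"
  shows "(\<integral>x. (\<Sum>j\<in>J. c j * \<phi> j x)\<^sup>2 \<partial>M) = (\<Sum>j\<in>J. (c j)\<^sup>2)"
proof -
  have inner: "(\<integral>x. (\<Sum>j\<in>J. c j * \<phi> j x) * \<phi> i x \<partial>M) = c i" if "i \<in> J" for i
  proof -
    have \<phi>: "in_L2 M (\<phi> i)" and \<phi>\<phi>: "\<And>j. (\<integral>x. \<phi> i x * \<phi> j x \<partial>M) = of_bool (i = j)"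
      using assms(1) by (auto simp: orthonormal_def)
    show ?thesis
      unfolding orthonormal_integral_mult[OF assms(1) \<phi>] \<phi>\<phi>
      using that assms(2) by (simp add: of_bool_def if_distrib sum.delta cong: if_cong)
  qed
  have "(\<integral>x. (\<Sum>j\<in>J. c j * \<phi> j x)\<^sup>2 \<partial>M) =
      (\<Sum>j\<in>J. c j * (\<integral>x. (\<Sum>j\<in>J. c j * \<phi> j x) * \<phi> j x \<partial>M))"
    unfolding power2_eq_square
    by (rule orthonormal_integral_mult[OF assms(1) orthonormal_in_L2_sum[OF assms(1)]])
  then show ?thesis by (simp add: inner power2_eq_square)
qed

lemma orthonormal_norm_diff:
  assumes "orthonormal M \<phi>" "in_L2 M f" "finite J"
  shows "(\<integral>x. ((\<Sum>j\<in>J. c j * \<phi> j x) - f x)\<^sup>2 \<partial>M) =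
    (\<Sum>j\<in>J. (c j - (\<integral>x. f x * \<phi> j x \<partial>M))\<^sup>2) + (\<integral>x. (f x)\<^sup>2 \<partial>M)
      - (\<Sum>j\<in>J. (\<integral>x. f x * \<phi> j x \<partial>M)\<^sup>2)"
proof -
  note S = orthonormal_in_L2_sum[OF assms(1), of c J]
  have "(\<integral>x. ((\<Sum>j\<in>J. c j * \<phi> j x) - f x)\<^sup>2 \<partial>M) =
      (\<integral>x. (\<Sum>j\<in>J. c j * \<phi> j x)\<^sup>2 + (f x)\<^sup>2 - 2 * ((\<Sum>j\<in>J. c j * \<phi> j x) * f x) \<partial>M)"
    by (intro Bochner_Integration.integral_cong) (auto simp: power2_diff)
  also have "\<dots> = (\<Sum>j\<in>J. (c j)\<^sup>2) + (\<integral>x. (f x)\<^sup>2 \<partial>M)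
      - 2 * (\<Sum>j\<in>J. c j * (\<integral>x. f x * \<phi> j x \<partial>M))"
    using in_L2_square[OF S] in_L2_square[OF assms(2)]
      in_L2_mult[OF S assms(2)]
    by (simp add: orthonormal_norm_sum[OF assms(1,3)] orthonormal_integral_mult[OF assms(1,2)])
  finally show ?thesis
    by (simp add: power2_diff sum.distrib sum_subtractf sum_distrib_left mult.assoc)
qed

text \<open>On an infinite measure space, increments that are small in L2 need not be integrable.
  Multiplied by a positive \<open>\<rho>\<close> in L2 they are, with summable integrals, so the
  weighted series converges almost everywhere and \<open>\<rho>\<close> can be divided out
  pointwise.\<close>

lemma AE_convergent_of_weighted_summable:
  fixes u :: "nat \<Rightarrow> 'a \<Rightarrow> real"
  assumes u: "\<And>i. in_L2 M (u i)"
    and \<rho>: "in_L2 M \<rho>" "\<And>x. x \<in> space M \<Longrightarrow> 0 < \<rho> x"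
    and bound: "\<And>i. (\<integral>x. (u (Suc i) x - u i x)\<^sup>2 \<partial>M) \<le> c * (1 / 4) ^ i"
  shows "AE x in M. convergent (\<lambda>i. u i x)"
proof -
  define D where "D i x = u (Suc i) x - u i x" for i x
  have D: "in_L2 M (D i)" for i
    unfolding D_def by (intro in_L2_diff u)
  have [measurable]: "D i \<in> borel_measurable M" "\<rho> \<in> borel_measurable M" for i
    using D[of i] \<rho>(1) by (simp_all add: in_L2_def)
  have DW: "in_L2 M (\<lambda>x. \<bar>D i x\<bar>)" "in_L2 M (\<lambda>x. \<bar>\<rho> x\<bar>)" for i
    using D[of i] \<rho>(1) by (auto simp: in_L2_def)
  define K where "K = c / 2 + (\<integral>x. (\<rho> x)\<^sup>2 \<partial>M) / 2"
  have le: "(\<integral>x. \<bar>D i x\<bar> * \<bar>\<rho> x\<bar> \<partial>M) \<le> K * (1 / 2) ^ i" for i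
  proof -
    have "(\<integral>x. \<bar>D i x\<bar> * \<bar>\<rho> x\<bar> \<partial>M) \<le>
        (\<integral>x. 2 ^ i / 2 * (D i x)\<^sup>2 + (1 / 2) ^ i / 2 * (\<rho> x)\<^sup>2 \<partial>M)"
    proof (rule integral_mono)
      show "integrable M (\<lambda>x. \<bar>D i x\<bar> * \<bar>\<rho> x\<bar>)" by (rule in_L2_mult[OF DW])
      show "integrable M (\<lambda>x. 2 ^ i / 2 * (D i x)\<^sup>2 + (1 / 2) ^ i / 2 * (\<rho> x)\<^sup>2)"
        using D[of i] \<rho>(1) by (simp add: in_L2_def)
      fix x
      \<comment> \<open>Young's inequality with weight \<open>2 ^ i\<close>: it balances the bound
        \<open>c * (1 / 4) ^ i\<close> against the fixed integral of the square of
        \<open>\<rho>\<close>, so that both parts are of order \<open>(1 / 2) ^ i\<close>.\<close>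
      have "0 \<le> (2 ^ i * \<bar>D i x\<bar> - \<bar>\<rho> x\<bar>)\<^sup>2 / (2 * 2 ^ i)" by simp
      also have "\<dots> = 2 ^ i / 2 * (D i x)\<^sup>2 + (1 / 2) ^ i / 2 * (\<rho> x)\<^sup>2 - \<bar>D i x\<bar> * \<bar>\<rho> x\<bar>"
        by (simp add: power2_diff power_mult_distrib power_divide field_simps)
           (simp add: power2_eq_square algebra_simps)
      finally show "\<bar>D i x\<bar> * \<bar>\<rho> x\<bar> \<le> 2 ^ i / 2 * (D i x)\<^sup>2 + (1 / 2) ^ i / 2 * (\<rho> x)\<^sup>2"
        by simp
    qed
    also have "\<dots> = 2 ^ i / 2 * (\<integral>x. (D i x)\<^sup>2 \<partial>M) + (1 / 2) ^ i / 2 * (\<integral>x. (\<rho> x)\<^sup>2 \<partial>M)"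
      using D[of i] \<rho>(1) by (simp add: in_L2_def)
    also have "\<dots> \<le> 2 ^ i / 2 * (c * (1 / 4) ^ i) + (1 / 2) ^ i / 2 * (\<integral>x. (\<rho> x)\<^sup>2 \<partial>M)"
      using bound[of i] by (intro add_right_mono mult_left_mono) (auto simp: D_def)
    also have "\<dots> = K * (1 / 2) ^ i"
    proof -
      have "(4::real) ^ i = 2 ^ i * 2 ^ i" by (simp flip: power_mult_distrib)
      then show ?thesis by (simp add: K_def power_divide field_simps)
    qed
    finally show ?thesis .
  qed
  have "(\<integral>\<^sup>+x. (\<Sum>i. ennreal (\<bar>D i x\<bar> * \<bar>\<rho> x\<bar>)) \<partial>M) = (\<Sum>i. \<integral>\<^sup>+x. ennreal (\<bar>D i x\<bar> * \<bar>\<rho> x\<bar>) \<partial>M)"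
    by (intro nn_integral_suminf) simp
  also have "\<dots> \<le> (\<Sum>i. ennreal (K * (1 / 2) ^ i))"
  proof (rule suminf_le)
    fix i
    have "(\<integral>\<^sup>+x. ennreal (\<bar>D i x\<bar> * \<bar>\<rho> x\<bar>) \<partial>M) = ennreal (\<integral>x. \<bar>D i x\<bar> * \<bar>\<rho> x\<bar> \<partial>M)"
      by (rule nn_integral_eq_integral[OF in_L2_mult[OF DW]]) simp
    also have "\<dots> \<le> ennreal (K * (1 / 2) ^ i)" by (rule ennreal_leI[OF le])
    finally show "(\<integral>\<^sup>+x. ennreal (\<bar>D i x\<bar> * \<bar>\<rho> x\<bar>) \<partial>M) \<le> ennreal (K * (1 / 2) ^ i)" .
  qed (rule summableI)+
  also have "\<dots> < \<infinity>"
  proof -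
    have "0 \<le> (\<integral>x. \<bar>D 0 x\<bar> * \<bar>\<rho> x\<bar> \<partial>M)" by simp
    also have "\<dots> \<le> K" using le[of 0] by simp
    finally have "0 \<le> K" .
    have "summable (\<lambda>i. K * (1 / 2) ^ i)" by (intro summable_mult summable_geometric) simp
    then have "(\<Sum>i. ennreal (K * (1 / 2) ^ i)) = ennreal (\<Sum>i. K * (1 / 2) ^ i)"
      using \<open>0 \<le> K\<close> by (intro suminf_ennreal2) simp_all
    then show ?thesis by simp
  qed
  finally have fin: "(\<integral>\<^sup>+x. (\<Sum>i. ennreal (\<bar>D i x\<bar> * \<bar>\<rho> x\<bar>)) \<partial>M) < \<infinity>" .
  have "AE x in M. (\<Sum>i. ennreal (\<bar>D i x\<bar> * \<bar>\<rho> x\<bar>)) \<noteq> \<infinity>"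
  proof (rule nn_integral_PInf_AE)
    show "(\<lambda>x. \<Sum>i. ennreal (\<bar>D i x\<bar> * \<bar>\<rho> x\<bar>)) \<in> borel_measurable M" by measurable
    show "(\<integral>\<^sup>+x. (\<Sum>i. ennreal (\<bar>D i x\<bar> * \<bar>\<rho> x\<bar>)) \<partial>M) \<noteq> \<infinity>"
      using fin by (rule less_imp_neq)
  qed
  then show ?thesis
  proof (rule AE_mp, intro AE_I2 impI)
    fix x assume x: "x \<in> space M" and fin: "(\<Sum>i. ennreal (\<bar>D i x\<bar> * \<bar>\<rho> x\<bar>)) \<noteq> \<infinity>"
    have "summable (\<lambda>i. \<bar>D i x\<bar> * \<bar>\<rho> x\<bar>)"
      using fin by (intro summable_suminf_not_top) auto
    then have "summable (\<lambda>i. (\<bar>D i x\<bar> * \<bar>\<rho> x\<bar>) * (1 / \<rho> x))" by (rule summable_mult2)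
    then have "summable (\<lambda>i. \<bar>D i x\<bar>)" using \<rho>(2)[OF x] by simp
    then have "summable (\<lambda>i. D i x)" by (rule summable_rabs_cancel)
    then have "convergent (\<lambda>n. (\<Sum>i<n. D i x))" by (simp add: summable_iff_convergent)
    then have "convergent (\<lambda>n. u n x - u 0 x)"
      using sum_lessThan_telescope[of "\<lambda>i. u i x"] by (simp add: D_def)
    then show "convergent (\<lambda>i. u i x)" by (simp add: convergent_diff_const_right_iff)
  qed
qed

text \<open>Riesz-Fischer in concrete form: a subsequence of the partial sums of the expansion
  converges almost everywhere and in L2 to some \<open>g\<close> with the same coefficients as
  \<open>f\<close>. Totality identifies \<open>g\<close> with \<open>f\<close>, so Bessel's
  inequality is an equality. The weight \<open>\<rho>\<close> is what gives the pointwise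
  limit.\<close>

lemma parseval_of_total:
  assumes on: "orthonormal M \<phi>"
    and \<rho>: "in_L2 M \<rho>" "\<And>x. x \<in> space M \<Longrightarrow> 0 < \<rho> x"
    and total: "\<And>h. in_L2 M h \<Longrightarrow> (\<And>j. (\<integral>x. h x * \<phi> j x \<partial>M) = 0) \<Longrightarrow> AE x in M. h x = 0"
    and f: "in_L2 M f"
  shows "(\<lambda>j. (\<integral>x. f x * \<phi> j x \<partial>M)\<^sup>2) sums (\<integral>x. (f x)\<^sup>2 \<partial>M)"
proof -
  have \<phi>: "in_L2 M (\<phi> j)" for j using on by (simp add: orthonormal_def)
  define a where "a j = (\<integral>x. f x * \<phi> j x \<partial>M)" for j
  define S where "S K x = (\<Sum>j<K. a j * \<phi> j x)" for K :: nat and x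
  have S: "in_L2 M (S K)" for K
    unfolding S_def by (rule orthonormal_in_L2_sum[OF on])
  have dist: "(\<integral>x. (S K x - f x)\<^sup>2 \<partial>M) = (\<integral>x. (f x)\<^sup>2 \<partial>M) - (\<Sum>j<K. (a j)\<^sup>2)" for K
    unfolding S_def using orthonormal_norm_diff[OF on f, of "{..<K}" a] by (simp add: a_def)
  have bessel: "(\<Sum>j<K. (a j)\<^sup>2) \<le> (\<integral>x. (f x)\<^sup>2 \<partial>M)" for K
  proof -
    have "0 \<le> (\<integral>x. (S K x - f x)\<^sup>2 \<partial>M)" by simp
    then show ?thesis using dist[of K] by simp
  qed
  have summ: "summable (\<lambda>j. (a j)\<^sup>2)"
    using bessel by (intro bounded_imp_summable[where B = "\<integral>x. (f x)\<^sup>2 \<partial>M"])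
      (auto simp: lessThan_Suc_atMost[symmetric] simp del: sum.lessThan_Suc)
  define \<tau> where "\<tau> K = (\<Sum>j. (a (j + K))\<^sup>2)" for K
  have "\<tau> \<longlonglongrightarrow> 0" unfolding \<tau>_def by (rule suminf_exist_split2[OF summ])
  have tail: "(\<Sum>j\<in>{K..<L}. (a j)\<^sup>2) \<le> \<tau> K" for K L
  proof (cases "K \<le> L")
    case True
    have "(\<Sum>j\<in>{K..<L}. (a j)\<^sup>2) = (\<Sum>j<L - K. (a (j + K))\<^sup>2)"
      using True by (intro sum.reindex_bij_witness[of _ "\<lambda>j. j + K" "\<lambda>j. j - K"]) auto
    also have "\<dots> \<le> \<tau> K"
      unfolding \<tau>_def using summable_ignore_initial_segment[OF summ, of K] by (intro sum_le_suminf) auto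
    finally show ?thesis .
  qed (use summable_ignore_initial_segment[OF summ, of K] in \<open>auto simp: \<tau>_def intro!: suminf_nonneg\<close>)
  have cauchy: "(\<integral>x. (S L x - S K x)\<^sup>2 \<partial>M) \<le> \<tau> K + \<tau> L" for K L
  proof -
    have \<tau>0: "0 \<le> \<tau> K" for K using tail[of K K] by simp
    have *: "(\<integral>x. (S L x - S K x)\<^sup>2 \<partial>M) \<le> \<tau> K" if "K \<le> L" for K L
    proof -
      have "{..<L} - {..<K} = {K..<L}" by auto
      then have "S L x - S K x = (\<Sum>j\<in>{K..<L}. a j * \<phi> j x)" for x
        using sum_diff[of "{..<L}" "{..<K}" "\<lambda>j. a j * \<phi> j x"] that
        by (auto simp: S_def)
      then show ?thesis
        using orthonormal_norm_sum[OF on, of "{K..<L}" a] tail[of K L] by simp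
    qed
    show ?thesis
      using *[of K L] *[of L K] \<tau>0[of K] \<tau>0[of L] by (cases "K \<le> L") (auto simp: power2_commute)
  qed
  have "\<exists>K\<ge>i. \<tau> K \<le> (1 / 4) ^ i" for i
  proof -
    have "\<forall>\<^sub>F K in sequentially. \<tau> K < (1 / 4) ^ i"
      using \<open>\<tau> \<longlonglongrightarrow> 0\<close> by (rule order_tendstoD) simp
    then have "\<forall>\<^sub>F K in sequentially. \<tau> K < (1 / 4) ^ i \<and> K \<ge> i"
      using eventually_ge_at_top[of i] by eventually_elim simp
    then show ?thesis using eventually_happens[of _ sequentially] by fastforce
  qed
  \<comment> \<open>The tails along the subsequence are geometric, and \<open>K i \<ge> i\<close>
    ensures that \<open>\<phi> j\<close> occurs in \<open>S (K i)\<close> as soon as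
    \<open>i > j\<close>.\<close>
  then obtain K where K: "\<And>i. K i \<ge> i" "\<And>i. \<tau> (K i) \<le> (1 / 4) ^ i" by metis
  define g where "g x = lim (\<lambda>i. S (K i) x)" for x
  have [measurable]: "S K \<in> borel_measurable M" for K using S by (simp add: in_L2_def)
  have g_meas [measurable]: "g \<in> borel_measurable M"
    unfolding g_def by (rule borel_measurable_lim_metric) simp
  have "AE x in M. convergent (\<lambda>i. S (K i) x)"
  proof (rule AE_convergent_of_weighted_summable[OF S \<rho>, where c = 2])
    fix i
    have "(1 / 4 :: real) ^ Suc i \<le> (1 / 4) ^ i" by (rule power_decreasing) auto
    then show "(\<integral>x. (S (K (Suc i)) x - S (K i) x)\<^sup>2 \<partial>M) \<le> 2 * (1 / 4) ^ i"
      using cauchy[of "K (Suc i)" "K i"] K(2)[of i] K(2)[of "Suc i"] by linarith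
  qed
  then have lim: "AE x in M. (\<lambda>i. S (K i) x) \<longlonglongrightarrow> g x"
    by eventually_elim (simp add: g_def convergent_LIMSEQ_iff)
  \<comment> \<open>Fatou's lemma in the second index turns the Cauchy property into L2 convergence
    to the pointwise limit.\<close>
  have near: "(\<integral>\<^sup>+x. ennreal ((g x - S (K i) x)\<^sup>2) \<partial>M) \<le> ennreal ((1 / 4) ^ i)" for i
  proof -
    have eq: "AE x in M. ennreal ((g x - S (K i) x)\<^sup>2) =
        liminf (\<lambda>l. ennreal ((S (K l) x - S (K i) x)\<^sup>2))"
      using lim
    proof eventually_elim
      case (elim x)
      then have "(\<lambda>l. ennreal ((S (K l) x - S (K i) x)\<^sup>2)) \<longlonglongrightarrow> ennreal ((g x - S (K i) x)\<^sup>2)"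
        by (intro tendsto_intros)
      then show ?case by (intro lim_imp_Liminf[symmetric]) simp_all
    qed
    have "(\<integral>\<^sup>+x. ennreal ((g x - S (K i) x)\<^sup>2) \<partial>M) =
        (\<integral>\<^sup>+x. liminf (\<lambda>l. ennreal ((S (K l) x - S (K i) x)\<^sup>2)) \<partial>M)"
      by (rule nn_integral_cong_AE[OF eq])
    also have "\<dots> \<le> liminf (\<lambda>l. \<integral>\<^sup>+x. ennreal ((S (K l) x - S (K i) x)\<^sup>2) \<partial>M)"
      by (rule nn_integral_liminf) simp
    also have "\<dots> \<le> liminf (\<lambda>l. ennreal ((1 / 4) ^ i + (1 / 4) ^ l))"
    proof (rule Liminf_mono, rule always_eventually, rule allI)
      fix l
      have "(\<integral>\<^sup>+x. ennreal ((S (K l) x - S (K i) x)\<^sup>2) \<partial>M) =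
          ennreal (\<integral>x. (S (K l) x - S (K i) x)\<^sup>2 \<partial>M)"
        by (intro nn_integral_eq_integral in_L2_square in_L2_diff S) auto
      also have "\<dots> \<le> ennreal ((1 / 4) ^ i + (1 / 4) ^ l)"
        using cauchy[of "K l" "K i"] K(2)[of i] K(2)[of l] by (intro ennreal_leI) linarith
      finally show "(\<integral>\<^sup>+x. ennreal ((S (K l) x - S (K i) x)\<^sup>2) \<partial>M) \<le>
        ennreal ((1 / 4) ^ i + (1 / 4) ^ l)" .
    qed
    also have "liminf (\<lambda>l. ennreal ((1 / 4) ^ i + (1 / 4) ^ l)) = ennreal ((1 / 4) ^ i + 0)"
      by (intro lim_imp_Liminf tendsto_intros LIMSEQ_power_zero) auto
    finally show ?thesis by simp
  qed
  have gS: "in_L2 M (\<lambda>x. g x - S (K i) x)" for i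
  proof -
    have "(\<integral>\<^sup>+x. ennreal ((g x - S (K i) x)\<^sup>2) \<partial>M) < \<infinity>"
      using near[of i] by (rule order_le_less_trans) simp
    then show ?thesis by (auto simp: in_L2_def intro!: integrableI_nonneg)
  qed
  have near': "(\<integral>x. (g x - S (K i) x)\<^sup>2 \<partial>M) \<le> (1 / 4) ^ i" for i
    using near[of i] nn_integral_eq_integral[OF in_L2_square[OF gS[of i]]] by simp
  have g: "in_L2 M g"
    using in_L2_add[OF gS[of 0] S[of "K 0"]] by simp
  have "(\<integral>x. (f x - g x) * \<phi> j x \<partial>M) = 0" for j
  proof -
    have le: "(\<integral>x. (f x - g x) * \<phi> j x \<partial>M)\<^sup>2 \<le> (1 / 4) ^ i" if "i > j" for i
    proof -
      have "(\<integral>x. S (K i) x * \<phi> j x \<partial>M) = (\<Sum>l<K i. a l * of_bool (j = l))"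
        using orthonormal_integral_mult[OF on \<phi>, of a "{..<K i}" j] on
        by (simp add: S_def orthonormal_def)
      also have "\<dots> = a j" using K(1)[of i] that by (simp add: of_bool_def if_distrib cong: if_cong)
      finally have Sj: "(\<integral>x. S (K i) x * \<phi> j x \<partial>M) = a j" .
      have "(\<integral>x. (f x - g x) * \<phi> j x \<partial>M) =
          (\<integral>x. f x * \<phi> j x - S (K i) x * \<phi> j x - (g x - S (K i) x) * \<phi> j x \<partial>M)"
        by (intro Bochner_Integration.integral_cong) (auto simp: algebra_simps)
      also have "\<dots> = - (\<integral>x. (g x - S (K i) x) * \<phi> j x \<partial>M)"
        using in_L2_mult[OF f \<phi>] in_L2_mult[OF S \<phi>]
          in_L2_mult[OF gS \<phi>] by (simp add: Sj a_def[symmetric])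
      finally have "(\<integral>x. (f x - g x) * \<phi> j x \<partial>M)\<^sup>2 = (\<integral>x. (g x - S (K i) x) * \<phi> j x \<partial>M)\<^sup>2"
        by simp
      also have "\<dots> \<le> (\<integral>x. (g x - S (K i) x)\<^sup>2 \<partial>M) * (\<integral>x. (\<phi> j x)\<^sup>2 \<partial>M)"
        by (rule Cauchy_Schwarz_integral[OF gS \<phi>])
      also have "(\<integral>x. (\<phi> j x)\<^sup>2 \<partial>M) = 1" using on by (simp add: orthonormal_def power2_eq_square)
      finally show ?thesis using near'[of i] by simp
    qed
    have "(\<lambda>i. (1 / 4 :: real) ^ i) \<longlonglongrightarrow> 0" by (rule LIMSEQ_power_zero) simp
    then have "(\<integral>x. (f x - g x) * \<phi> j x \<partial>M)\<^sup>2 \<le> 0"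
      by (rule LIMSEQ_le_const) (use le in \<open>auto intro!: exI[of _ "Suc j"]\<close>)
    then show ?thesis by simp
  qed
  then have fg: "AE x in M. f x - g x = 0"
    by (rule total[OF in_L2_diff[OF f g]])
  have upper: "(\<integral>x. (f x)\<^sup>2 \<partial>M) \<le> (\<Sum>j. (a j)\<^sup>2) + (1 / 4) ^ i" for i
  proof -
    have "(\<integral>x. (S (K i) x - f x)\<^sup>2 \<partial>M) = (\<integral>x. (g x - S (K i) x)\<^sup>2 \<partial>M)"
      using fg in_L2_measurable[OF f] by (intro integral_cong_AE) (auto simp: power2_commute elim!: AE_mp)
    then have "(\<integral>x. (f x)\<^sup>2 \<partial>M) - (\<Sum>j<K i. (a j)\<^sup>2) \<le> (1 / 4) ^ i"
      using dist[of "K i"] near'[of i] by simp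
    moreover have "(\<Sum>j<K i. (a j)\<^sup>2) \<le> (\<Sum>j. (a j)\<^sup>2)"
      by (intro sum_le_suminf summ) auto
    ultimately show ?thesis by simp
  qed
  have "(\<lambda>i. (\<Sum>j. (a j)\<^sup>2) + (1 / 4) ^ i) \<longlonglongrightarrow> (\<Sum>j. (a j)\<^sup>2) + 0"
    by (intro tendsto_intros LIMSEQ_power_zero) auto
  then have "(\<integral>x. (f x)\<^sup>2 \<partial>M) \<le> (\<Sum>j. (a j)\<^sup>2) + 0"
    by (rule LIMSEQ_le_const) (use upper in auto)
  moreover have "(\<Sum>j. (a j)\<^sup>2) \<le> (\<integral>x. (f x)\<^sup>2 \<partial>M)"
    by (rule suminf_le_const[OF summ bessel])
  ultimately have "(\<Sum>j. (a j)\<^sup>2) = (\<integral>x. (f x)\<^sup>2 \<partial>M)" by simp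
  then show ?thesis using summable_sums[OF summ] by (simp add: a_def)
qed

section \<open>Functions with vanishing moments\<close>

lemma power_le_exp:
  fixes y :: real
  assumes "0 \<le> y"
  shows "y ^ n \<le> fact n * exp y"
proof -
  have "(\<Sum>k\<in>{n}. y ^ k /\<^sub>R fact k) \<le> exp y"
    unfolding exp_def using assms by (intro sum_le_suminf summable_exp_generic) auto
  then show ?thesis by (simp add: field_simps)
qed

lemma partial_exp_sum_le:
  fixes y :: real
  assumes "0 \<le> y"
  shows "(\<Sum>k<m. y ^ k / fact k) \<le> exp y"
proof -
  have "(\<Sum>k<m. y ^ k /\<^sub>R fact k) \<le> exp y"
    unfolding exp_def using assms by (intro sum_le_suminf summable_exp_generic) auto
  then show ?thesis by (simp add: field_simps)
qed

text \<open>Half of the exponential weight absorbs the power of \<open>x\<close>; the other half is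
  kept to dominate an exponential series.\<close>

lemma integrable_power_exp_half:
  fixes h :: "real \<Rightarrow> real"
  assumes [measurable]: "h \<in> borel_measurable borel" and "0 < \<epsilon>"
    and int: "integrable lborel (\<lambda>x. h x * exp (\<epsilon> * \<bar>x\<bar>))"
  shows "integrable lborel (\<lambda>x. \<bar>h x\<bar> * \<bar>x\<bar> ^ n * exp (\<epsilon> / 2 * \<bar>x\<bar>))"
proof (rule Bochner_Integration.integrable_bound)
  show "integrable lborel (\<lambda>x. fact n * (2 / \<epsilon>) ^ n * (h x * exp (\<epsilon> * \<bar>x\<bar>)))"
    using int by simp
  show "AE x in lborel. norm (\<bar>h x\<bar> * \<bar>x\<bar> ^ n * exp (\<epsilon> / 2 * \<bar>x\<bar>))
      \<le> norm (fact n * (2 / \<epsilon>) ^ n * (h x * exp (\<epsilon> * \<bar>x\<bar>)))"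
  proof (rule AE_I2)
    fix x :: real
    have "(\<epsilon> / 2 * \<bar>x\<bar>) ^ n \<le> fact n * exp (\<epsilon> / 2 * \<bar>x\<bar>)"
      using \<open>0 < \<epsilon>\<close> by (intro power_le_exp) simp
    then have "\<bar>x\<bar> ^ n \<le> fact n * (2 / \<epsilon>) ^ n * exp (\<epsilon> / 2 * \<bar>x\<bar>)"
      using \<open>0 < \<epsilon>\<close> by (simp add: power_mult_distrib power_divide field_simps)
    then have "\<bar>h x\<bar> * \<bar>x\<bar> ^ n * exp (\<epsilon> / 2 * \<bar>x\<bar>)
        \<le> \<bar>h x\<bar> * (fact n * (2 / \<epsilon>) ^ n * exp (\<epsilon> / 2 * \<bar>x\<bar>)) * exp (\<epsilon> / 2 * \<bar>x\<bar>)"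
      by (intro mult_right_mono mult_left_mono) auto
    also have "\<dots> = fact n * (2 / \<epsilon>) ^ n * (\<bar>h x\<bar> * exp (\<epsilon> * \<bar>x\<bar>))"
      by (simp add: mult_exp_exp mult_ac)
    finally show "norm (\<bar>h x\<bar> * \<bar>x\<bar> ^ n * exp (\<epsilon> / 2 * \<bar>x\<bar>))
        \<le> norm (fact n * (2 / \<epsilon>) ^ n * (h x * exp (\<epsilon> * \<bar>x\<bar>)))"
      using \<open>0 < \<epsilon>\<close> by (simp add: abs_mult)
  qed
qed measurable

text \<open>The power series of \<open>iexp (\<delta> * x)\<close> is integrated term by term, and
  every term is a moment at frequency \<open>s\<close>. The bound on \<open>\<delta>\<close> makes
  \<open>exp (\<epsilon> / 2 * \<bar>x\<bar>)\<close> dominate all partial sums. The conclusion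
  again covers every moment, so the step can be iterated.\<close>

lemma fourier_moments_shift:
  fixes h :: "real \<Rightarrow> real"
  assumes [measurable]: "h \<in> borel_measurable borel" and "0 < \<epsilon>"
    and int: "integrable lborel (\<lambda>x. h x * exp (\<epsilon> * \<bar>x\<bar>))"
    and zero: "\<And>n. (\<integral>x. complex_of_real (h x * x ^ n) * iexp (s * x) \<partial>lborel) = 0"
    and \<delta>: "\<bar>\<delta>\<bar> \<le> \<epsilon> / 2"
  shows "(\<integral>x. complex_of_real (h x * x ^ n) * iexp ((s + \<delta>) * x) \<partial>lborel) = 0"
proof -
  let ?F = "\<lambda>k x. (\<i> * complex_of_real \<delta>) ^ k / fact k
    * (complex_of_real (h x * x ^ (n + k)) * iexp (s * x))"
  let ?w = "\<lambda>x. \<bar>h x\<bar> * \<bar>x\<bar> ^ n * exp (\<epsilon> / 2 * \<bar>x\<bar>)"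
  have base: "integrable lborel (\<lambda>x. complex_of_real (h x * x ^ m) * iexp (s * x))" for m
  proof (rule Bochner_Integration.integrable_bound[OF integrable_power_exp_half[OF assms(1-3), of m]])
    show "AE x in lborel. norm (complex_of_real (h x * x ^ m) * iexp (s * x))
        \<le> norm (\<bar>h x\<bar> * \<bar>x\<bar> ^ m * exp (\<epsilon> / 2 * \<bar>x\<bar>))"
    proof (rule AE_I2)
      fix x
      have "\<bar>h x\<bar> * \<bar>x\<bar> ^ m * 1 \<le> \<bar>h x\<bar> * \<bar>x\<bar> ^ m * exp (\<epsilon> / 2 * \<bar>x\<bar>)"
        using \<open>0 < \<epsilon>\<close> by (intro mult_left_mono) auto
      then show "norm (complex_of_real (h x * x ^ m) * iexp (s * x))
        \<le> norm (\<bar>h x\<bar> * \<bar>x\<bar> ^ m * exp (\<epsilon> / 2 * \<bar>x\<bar>))"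
        by (simp add: norm_mult norm_power power_abs abs_mult)
    qed
  qed measurable
  have F_int: "integrable lborel (?F k)" for k
    by (intro integrable_mult_right base)
  have F_sum: "(\<Sum>k<m. ?F k x) = complex_of_real (h x * x ^ n) * iexp (s * x)
      * (\<Sum>k<m. (\<i> * complex_of_real (\<delta> * x)) ^ k / fact k)" for m x
    by (simp add: sum_distrib_left power_add power_mult_distrib mult_ac)
  have lim: "(\<lambda>m. \<integral>x. (\<Sum>k<m. ?F k x) \<partial>lborel) \<longlonglongrightarrow>
      (\<integral>x. complex_of_real (h x * x ^ n) * iexp ((s + \<delta>) * x) \<partial>lborel)"
  proof (rule integral_dominated_convergence[where w = ?w])
    show "integrable lborel ?w" by (rule integrable_power_exp_half[OF assms(1-3)])
    show "AE x in lborel. (\<lambda>m. \<Sum>k<m. ?F k x) \<longlonglongrightarrow>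
        complex_of_real (h x * x ^ n) * iexp ((s + \<delta>) * x)"
    proof (rule AE_I2)
      fix x
      have "(\<lambda>k. (\<i> * complex_of_real (\<delta> * x)) ^ k /\<^sub>R fact k) sums exp (\<i> * complex_of_real (\<delta> * x))"
        by (rule exp_converges)
      then have "(\<lambda>m. \<Sum>k<m. (\<i> * complex_of_real (\<delta> * x)) ^ k / fact k)
          \<longlonglongrightarrow> exp (\<i> * complex_of_real (\<delta> * x))"
        by (simp add: sums_def scaleR_conv_of_real field_simps)
      then have "(\<lambda>m. \<Sum>k<m. ?F k x) \<longlonglongrightarrow>
          complex_of_real (h x * x ^ n) * iexp (s * x) * exp (\<i> * complex_of_real (\<delta> * x))"
        unfolding F_sum by (intro tendsto_intros)
      also have "complex_of_real (h x * x ^ n) * iexp (s * x) * exp (\<i> * complex_of_real (\<delta> * x)) =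
          complex_of_real (h x * x ^ n) * iexp ((s + \<delta>) * x)"
        by (simp add: mult.assoc mult_exp_exp algebra_simps)
      finally show "(\<lambda>m. \<Sum>k<m. ?F k x) \<longlonglongrightarrow>
        complex_of_real (h x * x ^ n) * iexp ((s + \<delta>) * x)" .
    qed
    fix m
    show "AE x in lborel. norm (\<Sum>k<m. ?F k x) \<le> ?w x"
    proof (rule AE_I2)
      fix x
      have "norm (\<Sum>k<m. (\<i> * complex_of_real (\<delta> * x)) ^ k / fact k)
          \<le> (\<Sum>k<m. \<bar>\<delta> * x\<bar> ^ k / fact k)"
        by (rule order_trans[OF norm_sum])
           (simp add: norm_divide norm_power norm_mult abs_mult)
      also have "\<dots> \<le> exp \<bar>\<delta> * x\<bar>" by (rule partial_exp_sum_le) simp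
      also have "\<dots> \<le> exp (\<epsilon> / 2 * \<bar>x\<bar>)"
        using mult_right_mono[OF \<delta>, of "\<bar>x\<bar>"] by (simp add: abs_mult)
      finally have "\<bar>h x\<bar> * \<bar>x\<bar> ^ n * norm (\<Sum>k<m. (\<i> * complex_of_real (\<delta> * x)) ^ k / fact k) \<le> ?w x"
        by (intro mult_left_mono) auto
      then show "norm (\<Sum>k<m. ?F k x) \<le> ?w x"
        unfolding F_sum by (simp add: norm_mult norm_power power_abs abs_mult)
    qed
  qed measurable
  have "(\<integral>x. (\<Sum>k<m. ?F k x) \<partial>lborel) = 0" for m
  proof -
    have "(\<integral>x. (\<Sum>k<m. ?F k x) \<partial>lborel) = (\<Sum>k<m. \<integral>x. ?F k x \<partial>lborel)"
      by (rule Bochner_Integration.integral_sum[OF F_int])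
    also have "\<dots> = 0"
      unfolding integral_mult_right_zero zero by simp
    finally show ?thesis .
  qed
  then have "(\<lambda>m. \<integral>x. (\<Sum>k<m. ?F k x) \<partial>lborel) = (\<lambda>m. 0)" by (intro ext)
  then show ?thesis using lim by (simp only: LIMSEQ_const_iff)
qed

lemma fourier_zero_of_moments_zero:
  fixes h :: "real \<Rightarrow> real"
  assumes "h \<in> borel_measurable borel" "0 < \<epsilon>"
    and "integrable lborel (\<lambda>x. h x * exp (\<epsilon> * \<bar>x\<bar>))"
    and zero: "\<And>n. (\<integral>x. h x * x ^ n \<partial>lborel) = 0"
  shows "(\<integral>x. complex_of_real (h x) * iexp (t * x) \<partial>lborel) = 0"
proof -
  \<comment> \<open>The frequency \<open>t\<close> is reached from 0 in \<open>N\<close> equal steps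
    of length at most \<open>\<epsilon> / 2\<close>. This takes the place of analytic continuation
    of the Fourier transform in a strip.\<close>
  obtain N :: nat where N: "2 * \<bar>t\<bar> / \<epsilon> < real N" using reals_Archimedean2 by blast
  have "0 < N" using N \<open>0 < \<epsilon>\<close> by (cases N) (auto simp: field_simps zero_less_mult_iff mult_less_0_iff)
  define \<delta> where "\<delta> = t / real N"
  have \<delta>: "\<bar>\<delta>\<bar> \<le> \<epsilon> / 2"
    using N \<open>0 < N\<close> \<open>0 < \<epsilon>\<close> by (simp add: \<delta>_def field_simps abs_divide)
  have "\<forall>n. (\<integral>x. complex_of_real (h x * x ^ n) * iexp ((real m * \<delta>) * x) \<partial>lborel) = 0" for m
  proof (induction m)
    case 0
    show ?case
    proof
      fix n
      have "(\<integral>x. complex_of_real (h x * x ^ n) \<partial>lborel) = complex_of_real (\<integral>x. h x * x ^ n \<partial>lborel)"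
        by (rule integral_complex_of_real)
      then show "(\<integral>x. complex_of_real (h x * x ^ n) * iexp ((real 0 * \<delta>) * x) \<partial>lborel) = 0"
        by (simp add: zero)
    qed
  next
    case (Suc m)
    have eq: "real m * \<delta> + \<delta> = real (Suc m) * \<delta>" by (simp add: algebra_simps)
    show ?case
      using fourier_moments_shift[OF assms(1-3) Suc[rule_format] \<delta>] unfolding eq by blast
  qed
  from this[of N, rule_format, of 0] show ?thesis
    using \<open>0 < N\<close> by (simp add: \<delta>_def)
qed

text \<open>The positive and negative parts of \<open>h\<close> have the same mass, by the moment of
  order 0, and the same Fourier transform. Normalised, they are two probability densities with one
  characteristic function, so Levy's uniqueness theorem makes them equal.\<close>

lemma AE_zero_of_moments_zero:
  fixes h :: "real \<Rightarrow> real"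
  assumes [measurable]: "h \<in> borel_measurable borel" and \<epsilon>: "0 < \<epsilon>"
    and int: "integrable lborel (\<lambda>x. h x * exp (\<epsilon> * \<bar>x\<bar>))"
    and zero: "\<And>n. (\<integral>x. h x * x ^ n \<partial>lborel) = 0"
  shows "AE x in lborel. h x = 0"
proof -
  define p where "p b x = max 0 (if b then h x else - h x)" for b x
  have [measurable]: "p b \<in> borel_measurable borel" for b unfolding p_def by (cases b) simp_all
  have p0: "0 \<le> p b x" for b x by (simp add: p_def)
  have h_eq: "h x = p True x - p False x" for x by (simp add: p_def)
  have hint: "integrable lborel h"
  proof (rule Bochner_Integration.integrable_bound[OF int])
    show "AE x in lborel. norm (h x) \<le> norm (h x * exp (\<epsilon> * \<bar>x\<bar>))"
    proof (rule AE_I2)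
      fix x
      have "\<bar>h x\<bar> * 1 \<le> \<bar>h x\<bar> * exp (\<epsilon> * \<bar>x\<bar>)" using \<epsilon> by (intro mult_left_mono) auto
      then show "norm (h x) \<le> norm (h x * exp (\<epsilon> * \<bar>x\<bar>))" by (simp add: abs_mult)
    qed
  qed simp
  have pint: "integrable lborel (p b)" for b
    by (rule Bochner_Integration.integrable_bound[OF hint]) (auto simp: p_def)
  have pint': "integrable lborel (\<lambda>x. complex_of_real (p b x) * iexp (t * x))" for b t
    by (rule Bochner_Integration.integrable_bound[OF pint[of b]]) (auto simp: norm_mult)
  have fourier: "(\<integral>x. complex_of_real (p True x) * iexp (t * x) \<partial>lborel) =
      (\<integral>x. complex_of_real (p False x) * iexp (t * x) \<partial>lborel)" for t
  proof -
    have "(\<integral>x. complex_of_real (p True x) * iexp (t * x) \<partial>lborel)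
        - (\<integral>x. complex_of_real (p False x) * iexp (t * x) \<partial>lborel) =
        (\<integral>x. complex_of_real (h x) * iexp (t * x) \<partial>lborel)"
      unfolding Bochner_Integration.integral_diff[OF pint' pint', symmetric]
      by (simp add: h_eq algebra_simps)
    then show ?thesis using fourier_zero_of_moments_zero[OF assms(1) \<epsilon> int zero] by simp
  qed
  define m where "m = (\<integral>x. p True x \<partial>lborel)"
  have m: "(\<integral>x. p b x \<partial>lborel) = m" for b
  proof -
    have "(\<integral>x. p True x \<partial>lborel) - (\<integral>x. p False x \<partial>lborel) = (\<integral>x. h x \<partial>lborel)"
      unfolding Bochner_Integration.integral_diff[OF pint pint, symmetric] by (simp add: h_eq)
    then show ?thesis using zero[of 0] by (cases b) (simp_all add: m_def)
  qed
  have "0 \<le> m" unfolding m_def by (simp add: p0)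
  have "AE x in lborel. p True x = p False x"
  \<comment> \<open>Normalising requires positive mass; with mass 0 both parts vanish at
    once.\<close>
  proof (cases "m = 0")
    case True
    have "AE x in lborel. p b x = 0" for b
      using integral_nonneg_eq_0_iff_AE[OF pint[of b]] m[of b] True p0 by simp
    from this[of True] this[of False] show ?thesis by eventually_elim simp
  next
    case False
    then have "0 < m" using \<open>0 \<le> m\<close> by simp
    define P where "P b = density lborel (\<lambda>x. ennreal (p b x / m))" for b
    have emeasure: "(\<integral>\<^sup>+x. ennreal (p b x / m) \<partial>lborel) = 1" for b
      using nn_integral_eq_integral[of lborel "\<lambda>x. p b x / m"] pint[of b] m[of b] \<open>0 < m\<close> p0
      by simp
    have dist: "real_distribution (P b)" for b
    proof -
      have "prob_space (P b)"
        by (rule prob_spaceI) (simp add: P_def emeasure_density emeasure)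
      then show ?thesis
        by (simp add: real_distribution_def real_distribution_axioms_def P_def)
    qed
    have char_P: "char (P b) t = (\<integral>x. complex_of_real (p b x) * iexp (t * x) \<partial>lborel) / complex_of_real m" for b t
    proof -
      have "char (P b) t = (\<integral>x. (p b x / m) *\<^sub>R iexp (t * x) \<partial>lborel)"
        unfolding char_def P_def using p0 \<open>0 < m\<close> by (intro integral_density) auto
      also have "\<dots> = (\<integral>x. complex_of_real (p b x) * iexp (t * x) / complex_of_real m \<partial>lborel)"
        by (intro Bochner_Integration.integral_cong) (auto simp: scaleR_conv_of_real)
      finally show ?thesis by simp
    qed
    have "char (P True) = char (P False)" by (rule ext) (simp only: char_P fourier)
    then have "P True = P False" by (rule Levy_uniqueness[OF dist dist])
    then have "AE x in lborel. ennreal (p True x / m) = ennreal (p False x / m)"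
      unfolding P_def by (intro sigma_finite_measure.density_unique[OF sigma_finite_lborel]) auto
    then show ?thesis
      by eventually_elim (use \<open>0 < m\<close> p0 in \<open>simp add: divide_nonneg_pos\<close>)
  qed
  then show ?thesis by eventually_elim (simp add: h_eq)
qed

section \<open>Laguerre and Hermite functions\<close>

text \<open>Up to sign this is the \<open>j\<close>-th finite difference of
  \<open>m choose r\<close> in \<open>m\<close>; by Pascal's rule each difference lowers
  \<open>r\<close> by one.\<close>

lemma alternating_binomial_sum:
  "(\<Sum>k\<le>j. (- 1) ^ k * real (j choose k) * real ((m + k) choose r)) =
    (if j \<le> r then (- 1) ^ j * real (m choose (r - j)) else 0)"
proof (induction j arbitrary: m)
  case (Suc j)
  let ?g = "\<lambda>k. (- 1) ^ k * real ((m + k) choose r)"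
  have "(\<Sum>k\<le>Suc j. (- 1) ^ k * real (Suc j choose k) * real ((m + k) choose r)) =
      real (m choose r) + (\<Sum>k\<le>j. ?g (Suc k) * real (Suc j choose Suc k))"
    by (subst sum.atMost_Suc_shift) (simp add: mult_ac)
  also have "(\<Sum>k\<le>j. ?g (Suc k) * real (Suc j choose Suc k)) =
      (\<Sum>k\<le>j. ?g (Suc k) * real (j choose Suc k)) + (\<Sum>k\<le>j. ?g (Suc k) * real (j choose k))"
    by (simp add: sum.distrib[symmetric] algebra_simps)
  also have "real (m choose r) + \<dots> =
      (\<Sum>k\<le>Suc j. ?g k * real (j choose k)) + (\<Sum>k\<le>j. ?g (Suc k) * real (j choose k))"
    by (subst sum.atMost_Suc_shift) simp
  also have "(\<Sum>k\<le>Suc j. ?g k * real (j choose k)) =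
      (\<Sum>k\<le>j. (- 1) ^ k * real (j choose k) * real ((m + k) choose r))"
    by (simp add: mult_ac)
  also have "(\<Sum>k\<le>j. ?g (Suc k) * real (j choose k)) =
      - (\<Sum>k\<le>j. (- 1) ^ k * real (j choose k) * real ((Suc m + k) choose r))"
    by (simp add: sum_negf[symmetric] mult_ac)
  also have "(\<Sum>k\<le>j. (- 1) ^ k * real (j choose k) * real ((m + k) choose r)) + \<dots> =
      (if Suc j \<le> r then (- 1) ^ Suc j * real (m choose (r - Suc j)) else 0)"
  proof (cases "Suc j \<le> r")
    case True
    then have "r - j = Suc (r - Suc j)" by simp
    then show ?thesis using True unfolding Suc by (simp add: algebra_simps)
  next
    case False
    then show ?thesis unfolding Suc by (cases "j = r") auto
  qed
  finally show ?case .
qed simp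

lemma gamma_moment:
  shows "integrable lborel (\<lambda>x. indicator {0<..} x * (x ^ n * exp (- x)) :: real)"
    and "(\<integral>x. indicator {0<..} x * (x ^ n * exp (- x)) \<partial>lborel) = (fact n :: real)"
proof -
  have "(\<integral>\<^sup>+x. ennreal (indicator {0<..} x * (x ^ n * exp (- x))) \<partial>lborel) =
      (\<integral>\<^sup>+x. ennreal (x ^ n * exp (- x)) * indicator {0..} x \<partial>lborel)"
  proof (rule nn_integral_cong_AE)
    show "AE x in lborel. ennreal (indicator {0<..} x * (x ^ n * exp (- x))) =
        ennreal (x ^ n * exp (- x)) * indicator {0..} x"
      using AE_lborel_singleton[of "0::real"]
      by eventually_elim (auto split: split_indicator)
  qed
  then have *: "(\<integral>\<^sup>+x. ennreal (indicator {0<..} x * (x ^ n * exp (- x))) \<partial>lborel) = ennreal (fact n)"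
    by (simp add: nn_intergal_power_times_exp_Ici)
  have nonneg: "AE x in lborel. 0 \<le> indicator {0<..} x * (x ^ n * exp (- x :: real))"
    by (auto split: split_indicator)
  show int: "integrable lborel (\<lambda>x. indicator {0<..} x * (x ^ n * exp (- x)) :: real)"
    by (rule integrableI_nonneg[OF _ nonneg]) (simp_all add: *)
  show "(\<integral>x. indicator {0<..} x * (x ^ n * exp (- x)) \<partial>lborel) = (fact n :: real)"
    using nn_integral_eq_integral[OF int nonneg] * integral_nonneg_AE[OF nonneg] by simp
qed

section \<open>Gaussian integrals and Hermite polynomials\<close>

lemma gaussian_power_integrable:
  fixes c :: real assumes "0 < c"
  shows "integrable lborel (\<lambda>x. x ^ n * exp (- (c * x\<^sup>2)))"
proof -
  \<comment> \<open>The standard deviation for which the normal density is proportional to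
    \<open>exp (- (c * x\<^sup>2))\<close>.\<close>
  define \<sigma> where "\<sigma> = 1 / sqrt (2 * c)"
  have \<sigma>: "\<sigma>\<^sup>2 = 1 / (2 * c)" using assms by (simp add: \<sigma>_def power_divide)
  have "integrable lborel (\<lambda>x. sqrt (2 * pi * \<sigma>\<^sup>2) * (normal_density 0 \<sigma> x * (x - 0) ^ n))"
    using assms by (intro integrable_mult_right integrable_normal_moment) (simp add: \<sigma>_def)
  also have "(\<lambda>x. sqrt (2 * pi * \<sigma>\<^sup>2) * (normal_density 0 \<sigma> x * (x - 0) ^ n)) = (\<lambda>x. x ^ n * exp (- (c * x\<^sup>2)))"
    unfolding normal_density_def \<sigma> using assms by (auto simp: field_simps)
  finally show ?thesis .
qed

lemma gaussian_poly_integrable: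
  fixes c :: real assumes "0 < c"
  shows "integrable lborel (\<lambda>x. poly p x * exp (- (c * x\<^sup>2)))"
proof -
  have "integrable lborel (\<lambda>x. \<Sum>i\<le>degree p. coeff p i * (x ^ i * exp (- (c * x\<^sup>2))))"
    by (intro Bochner_Integration.integrable_sum integrable_mult_right gaussian_power_integrable[OF assms])
  then show ?thesis by (simp add: poly_altdef sum_distrib_right mult.assoc)
qed

text \<open>For \<open>\<bar>x\<bar> \<ge> 1\<close> the power \<open>x ^ n\<close> is dominated by
  \<open>(x\<^sup>2) ^ n\<close>, and the substitution of \<open>x\<^sup>2\<close> reduces to the
  decay of \<open>y ^ n / exp y\<close>. It removes the boundary terms in the integration by
  parts.\<close>

lemma gaussian_poly_tendsto_0:
  fixes p :: "real poly"
  shows "((\<lambda>x. poly p x * exp (- x\<^sup>2)) \<longlongrightarrow> 0) at_infinity"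
proof -
  have pow: "((\<lambda>x::real. x ^ n * exp (- x\<^sup>2)) \<longlongrightarrow> 0) at_infinity" for n
  proof (rule tendsto_0_le[where K = 1])
    have "filterlim (\<lambda>x::real. norm x) at_top at_infinity" by (rule filterlim_norm_at_top)
    then have "filterlim (\<lambda>x::real. (norm x)\<^sup>2 ) at_top at_infinity"
      by (rule filterlim_pow_at_top[rotated]) simp
    then have f: "filterlim (\<lambda>x::real. x\<^sup>2 ) at_top at_infinity" by simp
    have "((\<lambda>y::real. y ^ n / exp y) \<longlongrightarrow> 0) at_top" by (rule tendsto_power_div_exp_0)
    from filterlim_compose[OF this f]
    have "((\<lambda>x::real. (x\<^sup>2) ^ n / exp (x\<^sup>2)) \<longlongrightarrow> 0) at_infinity" .
    then show "((\<lambda>x::real. (x\<^sup>2) ^ n * exp (- x\<^sup>2)) \<longlongrightarrow> 0) at_infinity"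
      by (simp add: exp_minus field_simps)
    have "\<forall>\<^sub>F x::real in at_infinity. 1 \<le> norm x"
      by (auto simp: eventually_at_infinity)
    then show "\<forall>\<^sub>F x::real in at_infinity. norm (x ^ n * exp (- x\<^sup>2)) \<le> norm ((x\<^sup>2) ^ n * exp (- x\<^sup>2)) * 1"
    proof eventually_elim
      case (elim x)
      have "\<bar>x\<bar> ^ n \<le> (\<bar>x\<bar> ^ n) ^ 2" using elim by (intro power_increasing[of 1 2, simplified]) (auto simp: one_le_power)
      also have "\<dots> = (\<bar>x\<bar>\<^sup>2) ^ n" by (simp only: power_mult[symmetric] mult.commute)
      also have "\<dots> = (x\<^sup>2) ^ n" by simp
      finally show ?case by (simp add: abs_mult power_abs)
    qed
  qed
  have "((\<lambda>x. \<Sum>i\<le>degree p. coeff p i * (x ^ i * exp (- x\<^sup>2))) \<longlongrightarrow> (\<Sum>i\<le>degree p. coeff p i * 0)) at_infinity"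
    by (intro tendsto_intros pow)
  then show ?thesis by (simp add: poly_altdef sum_distrib_right mult.assoc)
qed

definition gauss_int :: "real poly \<Rightarrow> real" where
  "gauss_int p = (\<integral>x. poly p x * exp (- x\<^sup>2) \<partial>lborel)"

lemma gauss_int_integrable: "integrable lborel (\<lambda>x. poly p x * exp (- x\<^sup>2))" for p :: "real poly"
  using gaussian_poly_integrable[of 1 p] by simp

lemma gauss_int_diff:
  "gauss_int (p - q) = gauss_int p - gauss_int q"
  using gauss_int_integrable[of p] gauss_int_integrable[of q]
  by (simp add: gauss_int_def left_diff_distrib)

lemma gauss_int_smult: "gauss_int (smult c p) = c * gauss_int p"
  by (simp add: gauss_int_def mult.assoc)

lemma gauss_int_1: "gauss_int 1 = sqrt pi"
proof -
  have "(\<integral>x. sqrt pi * normal_density 0 (1 / sqrt 2) x \<partial>lborel) = sqrt pi"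
    using integral_normal_density[of "1 / sqrt 2" 0] by simp
  then show ?thesis
    by (simp add: normal_density_def gauss_int_def power_divide)
qed

text \<open>The integrand is the derivative of \<open>poly q x * exp (- x\<^sup>2)\<close>, which
  vanishes at both ends.\<close>

lemma gauss_int_by_parts:
  "gauss_int (pderiv q - [:0, 2:] * q) = 0"
proof -
  let ?F = "\<lambda>x. poly q x * exp (- x\<^sup>2)" and ?f = "\<lambda>x. poly (pderiv q - [:0, 2:] * q) x * exp (- x\<^sup>2)"
  have "(LBINT x=-\<infinity>..\<infinity>. ?f x) = 0 - 0"
  proof (rule interval_integral_FTC_integrable)
    show "(?F has_vector_derivative ?f x) (at x)" for x
      unfolding has_real_derivative_iff_has_vector_derivative[symmetric]
      by (auto intro!: derivative_eq_intros simp: algebra_simps)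
    show "set_integrable lborel (einterval (- \<infinity>) \<infinity>) ?f"
      using gauss_int_integrable[of "pderiv q - [:0, 2:] * q"]
      by (simp add: set_integrable_def del: poly_diff poly_mult)
    show "((?F \<circ> real_of_ereal) \<longlongrightarrow> 0) (at_right (- \<infinity>))"
      using gaussian_poly_tendsto_0[of q] by (simp add: ereal_tendsto_simps tendsto_mono[OF at_bot_le_at_infinity])
    show "((?F \<circ> real_of_ereal) \<longlongrightarrow> 0) (at_left \<infinity>)"
      using gaussian_poly_tendsto_0[of q] by (simp add: ereal_tendsto_simps tendsto_mono[OF at_top_le_at_infinity])
  qed auto
  then show ?thesis
    by (simp add: gauss_int_def interval_lebesgue_integral_def set_lebesgue_integral_def)
qed

text \<open>The physicists' Hermite polynomials, by the recurrence that one differentiation of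
  \<open>poly (hermite_P j) x * exp (- x\<^sup>2)\<close> produces, up to sign.\<close>

primrec hermite_P :: "nat \<Rightarrow> real poly" where
  "hermite_P 0 = 1"
| "hermite_P (Suc j) = [:0, 2:] * hermite_P j - pderiv (hermite_P j)"

lemma pderiv_hermite_P:
  "pderiv (hermite_P (Suc j)) = smult (2 * real (Suc j)) (hermite_P j)"
proof (induction j)
  case (Suc j)
  have "pderiv (hermite_P (Suc (Suc j))) =
      pderiv ([:0, 2:] * hermite_P (Suc j)) - pderiv (pderiv (hermite_P (Suc j)))"
    by (simp only: hermite_P.simps(2)[of "Suc j"] pderiv_diff)
  also have "pderiv ([:0, 2:] * hermite_P (Suc j)) =
      [:0, 2:] * pderiv (hermite_P (Suc j)) + smult 2 (hermite_P (Suc j))"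
    by (simp add: pderiv_mult pderiv_pCons pderiv_smult del: hermite_P.simps)
  also have "\<dots> - pderiv (pderiv (hermite_P (Suc j))) =
      smult 2 (hermite_P (Suc j)) +
      smult (2 * real (Suc j)) ([:0, 2:] * hermite_P j - pderiv (hermite_P j))"
    unfolding Suc by (simp add: pderiv_smult smult_diff_right algebra_simps del: hermite_P.simps)
  also have "\<dots> = smult (2 * real (Suc (Suc j))) (hermite_P (Suc j))"
    unfolding hermite_P.simps(2)[of j, symmetric] smult_add_left[symmetric]
    by (simp add: algebra_simps)
  finally show ?case .
qed (simp add: pderiv_pCons)

text \<open>Raising the index is adjoint to differentiation with respect to the Gaussian
  weight.\<close>

lemma gauss_int_hermite_Suc:
  "gauss_int (p * hermite_P (Suc j)) =
    gauss_int (pderiv p * hermite_P j)"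
proof -
  have "pderiv p * hermite_P j - p * hermite_P (Suc j) =
      pderiv (p * hermite_P j) - [:0, 2:] * (p * hermite_P j)"
    by (simp add: pderiv_mult algebra_simps)
  then have "gauss_int (pderiv p * hermite_P j - p * hermite_P (Suc j)) = 0"
    by (simp only: gauss_int_by_parts)
  then show ?thesis by (simp add: gauss_int_diff del: hermite_P.simps)
qed

text \<open>Adjointness and the derivative rule lower both indices together. If one index reaches 0
  first, the derivative of the constant 1 makes the integral vanish; on the diagonal the factors
  \<open>2 * Suc j\<close> accumulate down to the Gaussian integral.\<close>

lemma hermite_P_orthogonal:
  "gauss_int (hermite_P i * hermite_P j) =
    (if i = j then 2 ^ j * fact j * sqrt pi else 0)"
proof (induction j arbitrary: i)
  case 0
  show ?case
  proof (cases i)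
    case (Suc i')
    then show ?thesis
      using gauss_int_hermite_Suc[of 1 i']
      by (simp add: gauss_int_def del: hermite_P.simps(2))
  qed (simp add: gauss_int_1)
next
  case (Suc j)
  show ?case
  proof (cases i)
    case 0
    then show ?thesis
      using gauss_int_hermite_Suc[of 1 j]
      by (simp add: gauss_int_def del: hermite_P.simps(2))
  next
    case (Suc i')
    have "gauss_int (hermite_P i * hermite_P (Suc j)) =
        2 * real (Suc i') * gauss_int (hermite_P i' * hermite_P j)"
      by (simp only: gauss_int_hermite_Suc Suc pderiv_hermite_P
        mult_smult_left gauss_int_smult)
    then show ?thesis unfolding Suc.IH by (simp add: Suc)
  qed
qed

lemma hermite_P_degree:
  "degree (hermite_P j) \<le> j \<and> coeff (hermite_P j) j = 2 ^ j"
proof (induction j)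
  case (Suc j)
  have d: "degree (pderiv (hermite_P j)) \<le> j"
    using Suc degree_pderiv[of "hermite_P j"] by linarith
  have "degree ([:0, 2:] * hermite_P j) \<le> Suc j"
    using Suc degree_mult_le[of "[:0, 2:]" "hermite_P j"] by simp
  then have "degree (hermite_P (Suc j)) \<le> Suc j"
    using d by (auto intro!: degree_diff_le)
  moreover have "coeff (hermite_P (Suc j)) (Suc j) = 2 ^ Suc j"
    using Suc d by (simp add: coeff_eq_0)
  ultimately show ?case by blast
qed simp

lemma iterated_deriv_gaussian:
  "(deriv ^^ j) (\<lambda>y. exp (- y\<^sup>2)) = (\<lambda>x. (- 1) ^ j * (poly (hermite_P j) x * exp (- x\<^sup>2)))"
proof (induction j)
  case (Suc j)
  have "deriv (\<lambda>x. (- 1) ^ j * (poly (hermite_P j) x * exp (- x\<^sup>2))) x =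
      (- 1) ^ Suc j * (poly (hermite_P (Suc j)) x * exp (- x\<^sup>2))" for x :: real
    by (rule DERIV_imp_deriv) (auto intro!: derivative_eq_intros simp: algebra_simps)
  then show ?case using Suc by auto
qed simp

section \<open>Orthonormality of the two bases on their domains\<close>

abbreviation dom_measure :: "setting \<Rightarrow> real measure" where
  "dom_measure s \<equiv> restrict_space lborel (domain_of s)"

lemma domain_borel [measurable, simp]: "domain_of s \<in> sets borel"
  by (cases s) auto

lemma laguerre_poly_measurable [measurable]: "laguerre_poly j \<in> borel_measurable borel"
  unfolding laguerre_poly_def by measurable

lemma hermite_fun_eq:
  "hermite_fun j x = (2 ^ j * fact j * sqrt pi) powr (- (1 / 2)) * (poly (hermite_P j) x * exp (- x\<^sup>2 / 2))"
proof -
  have "hermite_poly j x = poly (hermite_P j) x"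
    unfolding hermite_poly_def iterated_deriv_gaussian
    by (simp add: exp_minus power_mult_distrib[symmetric] field_simps)
  then show ?thesis by (simp add: hermite_fun_def)
qed

lemma basis_fun_measurable [measurable]: "basis_fun s j \<in> borel_measurable borel"
proof (cases s)
  case Hermite
  have "hermite_fun j = (\<lambda>x. (2 ^ j * fact j * sqrt pi) powr (- (1 / 2)) * (poly (hermite_P j) x * exp (- x\<^sup>2 / 2)))"
    by (rule ext) (rule hermite_fun_eq)
  moreover have "\<dots> \<in> borel_measurable borel"
    by (intro borel_measurable_continuous_onI continuous_intros) simp
  ultimately have "hermite_fun j \<in> borel_measurable borel" by (simp only:)
  then show ?thesis using Hermite by simp
next
  case Laguerre
  have "laguerre_fun j \<in> borel_measurable borel" unfolding laguerre_fun_def[abs_def] by measurable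
  then show ?thesis using Laguerre by simp
qed

lemma integral_domain:
  "(\<integral>x. g x \<partial>dom_measure s) = (\<integral>x. indicator (domain_of s) x * g x \<partial>lborel)" for g :: "real \<Rightarrow> real"
  by (subst integral_restrict_space) auto

lemma integrable_domain:
  "integrable (dom_measure s) g \<longleftrightarrow> integrable lborel (\<lambda>x. indicator (domain_of s) x * g x)" for g :: "real \<Rightarrow> real"
  by (subst integrable_restrict_space) auto

lemma borel_measurable_domain: "g \<in> borel_measurable borel \<Longrightarrow> g \<in> borel_measurable (dom_measure s)"
  by (rule measurable_restrict_space1) simp

text \<open>The quotient of \<open>fact (m + k)\<close> by \<open>fact k\<close> is
  \<open>fact m\<close> times a binomial coefficient, so the moment is a \<open>j\<close>-th
  difference and vanishes for \<open>m < j\<close>.\<close>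

lemma laguerre_moment:
  "has_bochner_integral lborel (\<lambda>x. indicator {0<..} x * (laguerre_poly j x * x ^ m * exp (- x)))
    (if j \<le> m then (- 1) ^ j * fact m * real (m choose j) else 0)"
proof -
  have "has_bochner_integral lborel
      (\<lambda>x. \<Sum>k\<le>j. ((- 1) ^ k * real (j choose k) / fact k) * (indicator {0<..} x * (x ^ (m + k) * exp (- x))))
      (\<Sum>k\<le>j. ((- 1) ^ k * real (j choose k) / fact k) * fact (m + k))"
    using gamma_moment by (intro has_bochner_integral_sum has_bochner_integral_mult_right)
      (auto simp: has_bochner_integral_iff)
  also have "(\<lambda>x. \<Sum>k\<le>j. ((- 1) ^ k * real (j choose k) / fact k) * (indicator {0<..} x * (x ^ (m + k) * exp (- x))))
      = (\<lambda>x. indicator {0<..} x * (laguerre_poly j x * x ^ m * exp (- x)))"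
    by (simp add: laguerre_poly_def sum_distrib_left sum_distrib_right power_add mult_ac)
  also have "(\<Sum>k\<le>j. ((- 1) ^ k * real (j choose k) / fact k) * fact (m + k)) =
      fact m * (\<Sum>k\<le>j. (- 1) ^ k * real (j choose k) * real ((m + k) choose m))"
    unfolding sum_distrib_left
  proof (rule sum.cong[OF refl])
    fix k
    have "(fact (m + k) :: real) = fact m * fact k * real ((m + k) choose m)"
      using binomial_fact_lemma[of m "m + k"] by (metis add_diff_cancel_left' le_add1 of_nat_fact of_nat_mult)
    then show "((- 1) ^ k * real (j choose k) / fact k) * fact (m + k) =
      fact m * ((- 1) ^ k * real (j choose k) * real ((m + k) choose m))"
      by simp
  qed
  also have "\<dots> = (if j \<le> m then (- 1) ^ j * fact m * real (m choose j) else 0)"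
    unfolding alternating_binomial_sum by (simp add: binomial_symmetric[symmetric])
  finally show ?thesis .
qed

text \<open>The polynomial of lower degree is expanded in monomials; only the monomial of degree
  \<open>j\<close> has a nonzero moment, and it occurs only if \<open>i = j\<close>.\<close>

lemma laguerre_orthogonal:
  assumes "i \<le> j"
  shows "has_bochner_integral lborel (\<lambda>x. indicator {0<..} x * (laguerre_poly i x * laguerre_poly j x * exp (- x)))
    (of_bool (i = j))"
proof -
  have "has_bochner_integral lborel
      (\<lambda>x. \<Sum>m\<le>i. ((- 1) ^ m * real (i choose m) / fact m) *
        (indicator {0<..} x * (laguerre_poly j x * x ^ m * exp (- x))))
      (\<Sum>m\<le>i. ((- 1) ^ m * real (i choose m) / fact m) *
        (if j \<le> m then (- 1) ^ j * fact m * real (m choose j) else 0))"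
    by (intro has_bochner_integral_sum has_bochner_integral_mult_right laguerre_moment)
  also have "(\<lambda>x. \<Sum>m\<le>i. ((- 1) ^ m * real (i choose m) / fact m) *
        (indicator {0<..} x * (laguerre_poly j x * x ^ m * exp (- x)))) =
      (\<lambda>x. indicator {0<..} x * (laguerre_poly i x * laguerre_poly j x * exp (- x)))"
    by (simp add: laguerre_poly_def[of i] sum_distrib_left sum_distrib_right mult_ac)
  also have "(\<Sum>m\<le>i. ((- 1) ^ m * real (i choose m) / fact m) *
        (if j \<le> m then (- 1) ^ j * fact m * real (m choose j) else 0)) = of_bool (i = j)"
  proof (cases "i = j")
    case True
    have "(\<Sum>m\<le>j. ((- 1) ^ m * real (j choose m) / fact m) *
        (if j \<le> m then (- 1) ^ j * fact m * real (m choose j) else 0)) =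
        (\<Sum>m\<in>{j}. ((- 1) ^ m * real (j choose m) / fact m) *
        (if j \<le> m then (- 1) ^ j * fact m * real (m choose j) else 0))"
      by (intro sum.mono_neutral_right) auto
    also have "\<dots> = 1" by (simp add: power_mult_distrib[symmetric])
    finally show ?thesis using True by simp
  next
    case False
    have "(\<Sum>m\<le>i. ((- 1) ^ m * real (i choose m) / fact m) *
        (if j \<le> m then (- 1) ^ j * fact m * real (m choose j) else 0)) = 0"
      by (rule sum.neutral) (use False assms in auto)
    then show ?thesis using False by simp
  qed
  finally show ?thesis .
qed

lemma laguerre_fun_orthonormal:
  "has_bochner_integral lborel (\<lambda>x. indicator {0<..} x * (laguerre_fun i x * laguerre_fun j x)) (of_bool (i = j))"
proof -
  let ?G = "\<lambda>x. indicator {0<..} x * (laguerre_poly i x * laguerre_poly j x * exp (- x)) :: real"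
  have G: "has_bochner_integral lborel ?G (of_bool (i = j))"
  proof (cases "i \<le> j")
    case True
    then show ?thesis by (rule laguerre_orthogonal)
  next
    case False
    then show ?thesis using laguerre_orthogonal[of j i]
      by (simp add: mult.commute[of "laguerre_poly i _"])
  qed
  \<comment> \<open>Substitution of \<open>2 * x\<close>; the two factors \<open>sqrt 2\<close>
    cancel the Jacobian.\<close>
  have "has_bochner_integral lborel (\<lambda>x. ?G (0 + 2 * x)) (of_bool (i = j) /\<^sub>R \<bar>2\<bar>)"
    by (rule lborel_has_bochner_integral_real_affine_iff[THEN iffD1, OF _ G]) simp
  then have "has_bochner_integral lborel (\<lambda>x. 2 * ?G (0 + 2 * x)) (2 * (of_bool (i = j) /\<^sub>R \<bar>2\<bar>))"
    by (rule has_bochner_integral_mult_right)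
  also have "(\<lambda>x. 2 * ?G (0 + 2 * x)) = (\<lambda>x. indicator {0<..} x * (laguerre_fun i x * laguerre_fun j x))"
  proof (rule ext)
    fix x :: real
    show "2 * ?G (0 + 2 * x) = indicator {0<..} x * (laguerre_fun i x * laguerre_fun j x)"
    proof (cases "0 < x")
      case True
      have "laguerre_fun i x * laguerre_fun j x = (sqrt 2 * sqrt 2) *
          (laguerre_poly i (2 * x) * laguerre_poly j (2 * x) * (exp (- x) * exp (- x)))"
      proof -
        have L: "laguerre_fun k x = sqrt 2 * laguerre_poly k (2 * x) * exp (- x)" for k
          using True by (simp add: laguerre_fun_def)
        have "(a * b * c) * (a * d * c) = (a * a) * (b * d * (c * c))" for a b c d :: real
          by algebra
        then show ?thesis unfolding L .
      qed
      also have "exp (- x) * exp (- x) = exp (- (2 * x))" by (simp add: mult_exp_exp)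
      finally have "laguerre_fun i x * laguerre_fun j x =
          2 * (laguerre_poly i (2 * x) * laguerre_poly j (2 * x) * exp (- (2 * x)))" by simp
      then show ?thesis using True by simp
    qed simp
  qed
  finally show ?thesis by simp
qed

lemma hermite_fun_orthonormal:
  "has_bochner_integral lborel (\<lambda>x. hermite_fun i x * hermite_fun j x) (of_bool (i = j))"
proof -
  define c where "c j = (2 ^ j * fact j * sqrt pi) powr (- (1 / 2))" for j
  have "has_bochner_integral lborel
      (\<lambda>x. c i * c j * (poly (hermite_P i * hermite_P j) x * exp (- x\<^sup>2)))
      (c i * c j * gauss_int (hermite_P i * hermite_P j))"
    unfolding gauss_int_def
    by (intro has_bochner_integral_mult_right has_bochner_integral_integrable gauss_int_integrable)
  also have "(\<lambda>x. c i * c j * (poly (hermite_P i * hermite_P j) x * exp (- x\<^sup>2))) =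
      (\<lambda>x. hermite_fun i x * hermite_fun j x)"
  proof
    fix x :: real
    have "exp (- x\<^sup>2) = exp (- x\<^sup>2 / 2) * exp (- x\<^sup>2 / 2)" by (simp add: mult_exp_exp)
    then show "c i * c j * (poly (hermite_P i * hermite_P j) x * exp (- x\<^sup>2)) =
        hermite_fun i x * hermite_fun j x"
      by (simp add: hermite_fun_eq c_def)
  qed
  also have "c i * c j * gauss_int (hermite_P i * hermite_P j) = of_bool (i = j)"
  proof -
    have "y powr (- (1 / 2)) * y powr (- (1 / 2)) * y = 1" if "0 < y" for y :: real
    proof -
      have "y powr (- (1 / 2)) * y powr (- (1 / 2)) = y powr (- 1)"
        unfolding powr_add[symmetric] by simp
      then show ?thesis using that by (simp add: powr_minus)
    qed
    then have "c j * c j * (2 ^ j * fact j * sqrt pi) = 1"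
      unfolding c_def by simp
    then show ?thesis unfolding hermite_P_orthogonal by auto
  qed
  finally show ?thesis .
qed

lemma basis_orthonormal: "orthonormal (dom_measure s) (basis_fun s)"
proof -
  have *: "has_bochner_integral lborel (\<lambda>x. indicator (domain_of s) x * (basis_fun s i x * basis_fun s j x)) (of_bool (i = j))" for i j
    using laguerre_fun_orthonormal hermite_fun_orthonormal by (cases s) simp_all
  have "integrable (dom_measure s) (\<lambda>x. (basis_fun s j x)\<^sup>2)" for j
    unfolding integrable_domain power2_eq_square by (rule integrable.intros[OF *])
  moreover have "(\<integral>x. basis_fun s i x * basis_fun s j x \<partial>dom_measure s) = of_bool (i = j)" for i j
    unfolding integral_domain by (rule has_bochner_integral_integral_eq[OF *])
  ultimately show ?thesis
    unfolding orthonormal_def in_L2_def by (blast intro: borel_measurable_domain basis_fun_measurable)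
qed

section \<open>Totality and Parseval's identity for both bases\<close>

lemma triangular_zero:
  fixes I :: "nat \<Rightarrow> real"
  assumes "\<And>j. (\<Sum>k\<le>j. c j k * I k) = 0" "\<And>j. c j j \<noteq> 0"
  shows "I n = 0"
proof (induction n rule: less_induct)
  case (less n)
  have "(\<Sum>k\<le>n. c n k * I k) = (\<Sum>k\<in>{n}. c n k * I k)"
    by (intro sum.mono_neutral_right) (auto simp: less le_less)
  then show ?case using assms(1)[of n] assms(2)[of n] by simp
qed

text \<open>The factor common to all basis functions of a setting, each of which is a polynomial
  times it on the domain. Being positive and in L2, it also serves as the weight in
  \<open>parseval_of_total\<close>.\<close>

fun basis_weight :: "setting \<Rightarrow> real \<Rightarrow> real" where
  "basis_weight Laguerre x = exp (- x)"
| "basis_weight Hermite x = exp (- x\<^sup>2 / 2)"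

lemma basis_weight_measurable [measurable]: "basis_weight s \<in> borel_measurable borel"
proof (cases s)
  case Laguerre
  have "basis_weight Laguerre = (\<lambda>x. exp (- x))" by (rule ext) simp
  then show ?thesis by (simp add: Laguerre)
next
  case Hermite
  have "basis_weight Hermite = (\<lambda>x. exp (- x\<^sup>2 / 2))" by (rule ext) simp
  then show ?thesis by (simp add: Hermite)
qed

text \<open>A nonzero diagonal expresses that the \<open>j\<close>-th polynomial has degree exactly
  \<open>j\<close>. Hence vanishing coefficients in the basis force vanishing moments, by forward
  substitution.\<close>

lemma basis_fun_triangular:
  obtains c where "\<And>j x. x \<in> domain_of s \<Longrightarrow> basis_fun s j x = (\<Sum>k\<le>j. c j k * (x ^ k * basis_weight s x))"
    and "\<And>j. c j j \<noteq> (0::real)"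
proof (cases s)
  case Laguerre
  show thesis
    by (rule that[of "\<lambda>j k. sqrt 2 * ((- 1) ^ k * real (j choose k) * 2 ^ k / fact k)"])
       (simp_all add: Laguerre laguerre_fun_def laguerre_poly_def sum_distrib_left sum_distrib_right
          power_mult_distrib mult_ac)
next
  case Hermite
  define c where "c j k = (2 ^ j * fact j * sqrt pi) powr (- (1 / 2)) * coeff (hermite_P j) k" for j k
  show thesis
  proof (rule that[of c])
    fix j x
    have "poly (hermite_P j) x = (\<Sum>k\<le>j. coeff (hermite_P j) k * x ^ k)"
      unfolding poly_altdef using hermite_P_degree[of j]
      by (intro sum.mono_neutral_left) (auto simp: coeff_eq_0)
    then show "basis_fun s j x = (\<Sum>k\<le>j. c j k * (x ^ k * basis_weight s x))"
      by (simp add: Hermite hermite_fun_eq c_def sum_distrib_left sum_distrib_right mult_ac)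
    show "c j j \<noteq> 0" using hermite_P_degree[of j] by (simp add: c_def)
  qed
qed

lemma basis_weight_in_L2:
  "in_L2 (dom_measure s) (\<lambda>x. x ^ n * basis_weight s x)"
  "in_L2 (dom_measure s) (\<lambda>x. basis_weight s x * exp (1 / 2 * \<bar>x\<bar>))"
proof -
  have "integrable lborel (\<lambda>x. indicator (domain_of s) x * (x ^ n * basis_weight s x)\<^sup>2)"
  proof (cases s)
    case Laguerre
    show ?thesis
    proof (rule Bochner_Integration.integrable_bound[OF gamma_moment(1)[of "2 * n"]])
      show "AE x in lborel. norm (indicator (domain_of s) x * (x ^ n * basis_weight s x)\<^sup>2)
          \<le> norm (indicator {0<..} x * (x ^ (2 * n) * exp (- x)))"
      proof (rule AE_I2)
        fix x :: real
        have "(x ^ n * exp (- x))\<^sup>2 = x ^ (2 * n) * exp (- (2 * x))"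
          by (simp add: power_mult_distrib power_even_eq exp_double[symmetric])
        moreover have "x ^ (2 * n) * exp (- (2 * x)) \<le> x ^ (2 * n) * exp (- x)" if "0 < x"
          using that by (intro mult_left_mono) auto
        ultimately show "norm (indicator (domain_of s) x * (x ^ n * basis_weight s x)\<^sup>2)
            \<le> norm (indicator {0<..} x * (x ^ (2 * n) * exp (- x)))"
          by (cases "0 < x") (simp_all add: Laguerre)
      qed
    qed measurable
  next
    case Hermite
    have "(x ^ n * exp (- x\<^sup>2 / 2))\<^sup>2 = x ^ (2 * n) * exp (- (1 * x\<^sup>2))" for x :: real
      by (simp add: power_mult_distrib power_even_eq exp_double[symmetric])
    then show ?thesis using gaussian_power_integrable[of 1 "2 * n"] by (simp add: Hermite)
  qed
  then show "in_L2 (dom_measure s) (\<lambda>x. x ^ n * basis_weight s x)"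
    by (auto simp: in_L2_def integrable_domain intro!: borel_measurable_domain)
  have "integrable lborel (\<lambda>x. indicator (domain_of s) x * (basis_weight s x * exp (1 / 2 * \<bar>x\<bar>))\<^sup>2)"
  proof (cases s)
    case Laguerre
    have "(\<lambda>x. indicator (domain_of s) x * (basis_weight s x * exp (1 / 2 * \<bar>x\<bar>))\<^sup>2) =
        (\<lambda>x. indicator {0<..} x * (x ^ 0 * exp (- x)))"
    proof
      fix x :: real
      have "(exp (- x) * exp (1 / 2 * x))\<^sup>2 = exp (- x)"
        by (simp only: mult_exp_exp exp_double[symmetric]) simp
      then show "indicator (domain_of s) x * (basis_weight s x * exp (1 / 2 * \<bar>x\<bar>))\<^sup>2 =
          indicator {0<..} x * (x ^ 0 * exp (- x))"
        by (cases "0 < x") (simp_all add: Laguerre)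
    qed
    then show ?thesis using gamma_moment(1)[of 0] by (simp only:)
  next
    case Hermite
    show ?thesis
    proof (rule Bochner_Integration.integrable_bound)
      show "integrable lborel (\<lambda>x. exp (1 / 2) * (x ^ 0 * exp (- (1 / 2 * x\<^sup>2))) :: real)"
        by (intro integrable_mult_right gaussian_power_integrable) simp
      show "AE x in lborel. norm (indicator (domain_of s) x * (basis_weight s x * exp (1 / 2 * \<bar>x\<bar>))\<^sup>2)
          \<le> norm (exp (1 / 2) * (x ^ 0 * exp (- (1 / 2 * x\<^sup>2))) :: real)"
      proof (rule AE_I2)
        fix x :: real
        \<comment> \<open>The linear term of the exponent is traded for half of the Gaussian
          decay.\<close>
        have "\<bar>x\<bar> \<le> 1 / 2 + 1 / 2 * x\<^sup>2"
          using sum_squares_bound[of 1 "\<bar>x\<bar>"] by simp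
        then show "norm (indicator (domain_of s) x * (basis_weight s x * exp (1 / 2 * \<bar>x\<bar>))\<^sup>2)
          \<le> norm (exp (1 / 2) * (x ^ 0 * exp (- (1 / 2 * x\<^sup>2))) :: real)"
          by (simp add: Hermite exp_double[symmetric] mult_exp_exp)
      qed
    qed measurable
  qed
  then show "in_L2 (dom_measure s) (\<lambda>x. basis_weight s x * exp (1 / 2 * \<bar>x\<bar>))"
    by (auto simp: in_L2_def integrable_domain intro!: borel_measurable_domain)
qed

text \<open>The function \<open>g\<close>, which is \<open>h\<close> times the weight and extended
  by 0, has vanishing moments. It is exponentially integrable because the weight leaves room for
  \<open>exp (1 / 2 * \<bar>x\<bar>)\<close> within L2.\<close>

lemma basis_total:
  assumes h: "in_L2 (dom_measure s) h"
    and zero: "\<And>j. (\<integral>x. h x * basis_fun s j x \<partial>dom_measure s) = 0"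
  shows "AE x in dom_measure s. h x = 0"
proof -
  define g where "g x = indicator (domain_of s) x * (h x * basis_weight s x)" for x
  obtain c where c: "\<And>j x. x \<in> domain_of s \<Longrightarrow> basis_fun s j x = (\<Sum>k\<le>j. c j k * (x ^ k * basis_weight s x))"
    and c0: "\<And>j. c j j \<noteq> (0::real)" by (rule basis_fun_triangular[of s]) (rule that)
  have hm: "(\<lambda>x. indicator (domain_of s) x * h x) \<in> borel_measurable borel"
    using in_L2_measurable[OF h]
    by (subst (asm) borel_measurable_restrict_space_iff) auto
  have [measurable]: "g \<in> borel_measurable borel"
  proof -
    have "(\<lambda>x. (indicator (domain_of s) x * h x) * basis_weight s x) \<in> borel_measurable borel"
      using hm by measurable
    then show ?thesis by (simp add: g_def[abs_def] mult.assoc)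
  qed
  have "(\<Sum>k\<le>j. c j k * (\<integral>x. h x * (x ^ k * basis_weight s x) \<partial>dom_measure s)) = 0" for j
  proof -
    have "(\<Sum>k\<le>j. c j k * (\<integral>x. h x * (x ^ k * basis_weight s x) \<partial>dom_measure s)) =
        (\<integral>x. (\<Sum>k\<le>j. c j k * (h x * (x ^ k * basis_weight s x))) \<partial>dom_measure s)"
      using in_L2_mult[OF h basis_weight_in_L2(1)]
      by (subst Bochner_Integration.integral_sum) auto
    also have "\<dots> = (\<integral>x. h x * basis_fun s j x \<partial>dom_measure s)"
      by (intro Bochner_Integration.integral_cong refl)
         (simp add: space_restrict_space c sum_distrib_left mult_ac)
    finally show ?thesis by (simp add: zero)
  qed
  then have "(\<integral>x. h x * (x ^ n * basis_weight s x) \<partial>dom_measure s) = 0" for n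
    using triangular_zero[of c "\<lambda>k. \<integral>x. h x * (x ^ k * basis_weight s x) \<partial>dom_measure s"] c0 by blast
  then have moments: "(\<integral>x. g x * x ^ n \<partial>lborel) = 0" for n
    by (simp add: integral_domain g_def mult_ac)
  have "integrable lborel (\<lambda>x. g x * exp (1 / 2 * \<bar>x\<bar>))"
    using in_L2_mult[OF h basis_weight_in_L2(2)]
    by (simp add: integrable_domain g_def mult_ac)
  then have "AE x in lborel. g x = 0"
    by (intro AE_zero_of_moments_zero[of g "1 / 2"] moments) auto
  then have "AE x in lborel. x \<in> domain_of s \<longrightarrow> h x = 0"
  proof eventually_elim
    case (elim x)
    have "basis_weight s x \<noteq> 0" by (cases s) auto
    then show ?case using elim by (auto simp: g_def)
  qed
  then show ?thesis by (simp add: AE_restrict_space_iff)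
qed

lemma basis_parseval:
  assumes "in_L2 (dom_measure s) f"
  shows "(\<lambda>j. (\<integral>x. f x * basis_fun s j x \<partial>dom_measure s)\<^sup>2) sums (\<integral>x. (f x)\<^sup>2 \<partial>dom_measure s)"
proof (rule parseval_of_total[OF basis_orthonormal _ _ basis_total assms])
  show "in_L2 (dom_measure s) (basis_weight s)"
    using basis_weight_in_L2(1)[of s 0] by simp
  show "0 < basis_weight s x" for x by (cases s) auto
qed

section \<open>Sums of independent bounded vectors\<close>

lemma exp_le_quadratic:
  fixes u :: real
  assumes "\<bar>u\<bar> \<le> 1"
  shows "exp u \<le> 1 + u + u\<^sup>2"
proof (cases "0 \<le> u")
  case True
  then show ?thesis using assms by (intro exp_bound) auto
next
  case False
  \<comment> \<open>For negative \<open>u\<close> the bound follows from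
    \<open>exp y \<ge> 1 + y + y\<^sup>2 / 2\<close>, because the product of the right-hand side
    with \<open>1 - y + y\<^sup>2\<close> is at least 1.\<close>
  define y where "y = - u"
  have y: "0 \<le> y" "y \<le> 1" using False assms by (auto simp: y_def)
  have pos: "0 < 1 + y + y\<^sup>2 / 2" using y by (simp add: add_pos_nonneg)
  have "1 + 0 \<le> 1 + (y\<^sup>2 / 2 + y ^ 3 / 2 + y ^ 4 / 2)" using y by (intro add_left_mono) simp
  also have "\<dots> = (1 - y + y\<^sup>2) * (1 + y + y\<^sup>2 / 2)"
    by (simp add: field_simps power2_eq_square power3_eq_cube power4_eq_xxxx)
  finally have "1 / (1 + y + y\<^sup>2 / 2) \<le> 1 - y + y\<^sup>2" using pos by (simp add: field_simps)
  moreover have "exp (- y) \<le> 1 / (1 + y + y\<^sup>2 / 2)"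
    using exp_lower_Taylor_quadratic[OF y(1)] pos by (simp add: exp_minus inverse_eq_divide frac_le)
  ultimately show ?thesis by (simp add: y_def)
qed

text \<open>Integrating out the last observation with the earlier ones fixed takes the place of
  conditional expectation in the inductions over the sample size.\<close>

lemma nn_integral_PiM_Suc:
  assumes "prob_space M" "F \<in> borel_measurable (Pi\<^sub>M {1..Suc n} (\<lambda>_. M))"
  shows "(\<integral>\<^sup>+X. F X \<partial>Pi\<^sub>M {1..Suc n} (\<lambda>_. M)) =
    (\<integral>\<^sup>+X. (\<integral>\<^sup>+x. F (X(Suc n := x)) \<partial>M) \<partial>Pi\<^sub>M {1..n} (\<lambda>_. M))"
proof -
  interpret prob_space M by fact
  interpret product_sigma_finite "\<lambda>_::nat. M"
    by (simp add: product_sigma_finite_def sigma_finite_measure_axioms)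
  have "{1..Suc n} = insert (Suc n) {1..n}" by (simp add: atLeastAtMostSuc_conv)
  then show ?thesis
    using product_nn_integral_insert[of "{1..n}" "Suc n" F] assms(2) by simp
qed

lemma prob_space_PiM_const: "prob_space M \<Longrightarrow> prob_space (Pi\<^sub>M I (\<lambda>_. M))"
  by (rule prob_space_PiM)

lemma sample_sum_measurable [measurable]:
  assumes "g \<in> borel_measurable M"
  shows "(\<lambda>X. \<Sum>i=1..n. g (X i) :: real) \<in> borel_measurable (Pi\<^sub>M {1..n} (\<lambda>_. M))"
  using assms by (intro borel_measurable_sum) (auto intro!: measurable_compose[OF measurable_component_singleton])

lemma sample_sum_upd:
  fixes g :: "'a \<Rightarrow> real"
  shows "(\<Sum>i=1..Suc n. g ((X(Suc n := x)) i)) = (\<Sum>i=1..n. g (X i)) + g x"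
proof -
  have "(\<Sum>i=1..n. g ((X(Suc n := x)) i)) = (\<Sum>i=1..n. g (X i))" by (intro sum.cong) auto
  then show ?thesis by simp
qed

text \<open>Given the earlier observations, the cross term with a centered new observation
  integrates to 0, so each observation adds its own second moment.\<close>

lemma sample_sum_moment2:
  fixes \<xi> :: "nat \<Rightarrow> 'a \<Rightarrow> real"
  assumes M: "prob_space M"
    and meas [measurable]: "\<And>j. j < k \<Longrightarrow> \<xi> j \<in> borel_measurable M"
    and sq: "\<And>j. j < k \<Longrightarrow> integrable M (\<lambda>x. (\<xi> j x)\<^sup>2)"
    and centered: "\<And>j. j < k \<Longrightarrow> (\<integral>x. \<xi> j x \<partial>M) = 0"
  shows "(\<integral>\<^sup>+X. ennreal (\<Sum>j<k. (\<Sum>i=1..n. \<xi> j (X i))\<^sup>2) \<partial>Pi\<^sub>M {1..n} (\<lambda>_. M)) =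
    ennreal (real n * (\<Sum>j<k. \<integral>x. (\<xi> j x)\<^sup>2 \<partial>M))"
proof (induction n)
  case 0
  interpret P: prob_space "Pi\<^sub>M {1..0} (\<lambda>_::nat. M)" by (rule prob_space_PiM_const[OF M])
  show ?case by simp
next
  case (Suc n)
  interpret prob_space M by fact
  interpret P: prob_space "Pi\<^sub>M {1..n} (\<lambda>_::nat. M)" by (rule prob_space_PiM_const[OF M])
  define h where "h = (\<Sum>j<k. \<integral>x. (\<xi> j x)\<^sup>2 \<partial>M)"
  have h0: "0 \<le> h" unfolding h_def by (intro sum_nonneg) simp
  have int: "integrable M (\<xi> j)" if "j < k" for j
    using meas[OF that] sq[OF that] by (rule square_integrable_imp_integrable)
  have msum: "(\<lambda>X. ennreal (\<Sum>j<k. (\<Sum>i=1..m. \<xi> j (X i))\<^sup>2)) \<in> borel_measurable (Pi\<^sub>M {1..m} (\<lambda>_. M))" for m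
    by (intro measurable_compose[OF _ measurable_ennreal] borel_measurable_sum[of "{..<k}"]
        borel_measurable_power sample_sum_measurable meas) simp
  have inner: "(\<integral>\<^sup>+x. ennreal (\<Sum>j<k. (s j + \<xi> j x)\<^sup>2) \<partial>M) = ennreal (\<Sum>j<k. (s j)\<^sup>2) + ennreal h" for s
  proof -
    have sq': "integrable M (\<lambda>x. (s j + \<xi> j x)\<^sup>2)" if "j < k" for j
      using int[OF that] sq[OF that] by (simp add: power2_sum mult.assoc)
    have "(\<integral>\<^sup>+x. ennreal (\<Sum>j<k. (s j + \<xi> j x)\<^sup>2) \<partial>M) = ennreal (\<integral>x. (\<Sum>j<k. (s j + \<xi> j x)\<^sup>2) \<partial>M)"
      using sq' by (intro nn_integral_eq_integral Bochner_Integration.integrable_sum) (auto intro!: sum_nonneg)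
    also have "(\<integral>x. (\<Sum>j<k. (s j + \<xi> j x)\<^sup>2) \<partial>M) = (\<Sum>j<k. \<integral>x. (s j + \<xi> j x)\<^sup>2 \<partial>M)"
      using sq' by (intro Bochner_Integration.integral_sum) auto
    also have "\<dots> = (\<Sum>j<k. (s j)\<^sup>2 + (\<integral>x. (\<xi> j x)\<^sup>2 \<partial>M))"
    proof (rule sum.cong[OF refl])
      fix j assume "j \<in> {..<k}"
      then have j: "j < k" by simp
      show "(\<integral>x. (s j + \<xi> j x)\<^sup>2 \<partial>M) = (s j)\<^sup>2 + (\<integral>x. (\<xi> j x)\<^sup>2 \<partial>M)"
        using int[OF j] sq[OF j] centered[OF j] by (simp add: power2_sum mult.assoc prob_space)
    qed
    finally show ?thesis using h0 by (simp add: sum.distrib h_def ennreal_plus sum_nonneg)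
  qed
  have "(\<integral>\<^sup>+X. ennreal (\<Sum>j<k. (\<Sum>i=1..Suc n. \<xi> j (X i))\<^sup>2) \<partial>Pi\<^sub>M {1..Suc n} (\<lambda>_. M)) =
      (\<integral>\<^sup>+X. (\<integral>\<^sup>+x. ennreal (\<Sum>j<k. ((\<Sum>i=1..n. \<xi> j (X i)) + \<xi> j x)\<^sup>2) \<partial>M) \<partial>Pi\<^sub>M {1..n} (\<lambda>_. M))"
    by (subst nn_integral_PiM_Suc[OF M msum]) (simp only: sample_sum_upd)
  also have "\<dots> = (\<integral>\<^sup>+X. ennreal (\<Sum>j<k. (\<Sum>i=1..n. \<xi> j (X i))\<^sup>2) + ennreal h \<partial>Pi\<^sub>M {1..n} (\<lambda>_. M))"
    by (simp only: inner)
  also have "\<dots> = (\<integral>\<^sup>+X. ennreal (\<Sum>j<k. (\<Sum>i=1..n. \<xi> j (X i))\<^sup>2) \<partial>Pi\<^sub>M {1..n} (\<lambda>_. M)) + ennreal h"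
    using P.emeasure_space_1 by (subst nn_integral_add[OF msum]) simp_all
  also have "\<dots> = ennreal (real (Suc n) * h)"
    unfolding Suc h_def[symmetric] using h0 by (subst ennreal_plus[symmetric]) (auto simp: algebra_simps)
  finally show ?case by (simp only: h_def)
qed

text \<open>The three quantities of Talagrand's inequality for the norm of a random vector:
  \<open>b\<close> bounds the norm, \<open>H\<close> the trace of the covariance, and
  \<open>F\<close> its operator norm.\<close>

locale bounded_centered_system = prob_space M for M :: "'a measure" +
  fixes \<xi> :: "nat \<Rightarrow> 'a \<Rightarrow> real" and k :: nat and b H F :: real
  assumes \<xi>_measurable [measurable]: "\<And>j. \<xi> j \<in> borel_measurable M"
    and b_pos: "0 < b" and bounded: "\<And>x. x \<in> space M \<Longrightarrow> (\<Sum>j<k. (\<xi> j x)\<^sup>2) \<le> b\<^sup>2"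
    and centered: "\<And>j. j < k \<Longrightarrow> expectation (\<xi> j) = 0"
    and H_pos: "0 < H" and strong_variance: "expectation (\<lambda>x. \<Sum>j<k. (\<xi> j x)\<^sup>2) \<le> H"
    and F_pos: "0 < F"
    and weak_variance: "\<And>u. expectation (\<lambda>x. (\<Sum>j<k. u j * \<xi> j x)\<^sup>2) \<le> F * (\<Sum>j<k. (u j)\<^sup>2)"
begin

lemma inner_bound:
  assumes "(\<Sum>j<k. (v j)\<^sup>2) \<le> T" "x \<in> space M"
  shows "\<bar>\<Sum>j<k. v j * \<xi> j x\<bar> \<le> b * sqrt T"
proof -
  have "(\<Sum>j<k. v j * \<xi> j x)\<^sup>2 \<le> (\<Sum>j<k. (v j)\<^sup>2) * (\<Sum>j<k. (\<xi> j x)\<^sup>2)"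
    by (rule Cauchy_Schwarz_ineq_sum)
  also have "\<dots> \<le> T * b\<^sup>2"
    using assms bounded[OF assms(2)] order_trans[OF sum_nonneg assms(1)]
    by (intro mult_mono sum_nonneg) auto
  finally have "sqrt ((\<Sum>j<k. v j * \<xi> j x)\<^sup>2) \<le> sqrt (T * b\<^sup>2)" by (rule real_sqrt_le_mono)
  then show ?thesis using b_pos by (simp add: real_sqrt_mult mult.commute)
qed

lemma integrable_bounded_le:
  fixes g :: "'a \<Rightarrow> real"
  assumes "g \<in> borel_measurable M" "\<And>x. x \<in> space M \<Longrightarrow> \<bar>g x\<bar> \<le> B"
  shows "integrable M g"
  using assms by (intro integrable_const_bound[where B = B]) auto

text \<open>The squared norm grows by twice the inner product \<open>A\<close> plus the squared norm
  \<open>N\<close> of the increment. \<open>A\<close> is centered, with second moment at most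
  \<open>F * T\<close>, while \<open>N\<close> has mean at most \<open>H\<close> and is at most
  \<open>b\<^sup>2\<close>. The restriction on \<open>t\<close> keeps the exponent in the range of
  \<open>exp_le_quadratic\<close>.\<close>

lemma exp_moment_step:
  assumes v: "(\<Sum>j<k. (v j)\<^sup>2) \<le> T" and t0: "0 \<le> t" and t: "t * (2 * (b * sqrt T) + b\<^sup>2) \<le> 1"
  shows "(\<integral>\<^sup>+x. ennreal (exp (t * (\<Sum>j<k. (v j + \<xi> j x)\<^sup>2))) \<partial>M) \<le>
    ennreal (exp (t * (\<Sum>j<k. (v j)\<^sup>2))) * ennreal (exp (t * H + t\<^sup>2 * (8 * F * T + 2 * b\<^sup>2 * H)))"
proof -
  define A where "A x = (\<Sum>j<k. v j * \<xi> j x)" for x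
  define N where "N x = (\<Sum>j<k. (\<xi> j x)\<^sup>2)" for x
  define u where "u x = t * (2 * A x + N x)" for x
  have [measurable]: "A \<in> borel_measurable M" "N \<in> borel_measurable M" "u \<in> borel_measurable M"
    unfolding A_def N_def u_def by measurable
  have A: "\<bar>A x\<bar> \<le> b * sqrt T" if "x \<in> space M" for x
    unfolding A_def by (rule inner_bound[OF v that])
  have N: "0 \<le> N x" "N x \<le> b\<^sup>2" if "x \<in> space M" for x
    using bounded[OF that] by (auto simp: N_def intro!: sum_nonneg)
  have "0 \<le> (\<Sum>j<k. (v j)\<^sup>2)" by (simp add: sum_nonneg)
  then have T0: "0 \<le> T" using v by linarith
  have u: "\<bar>u x\<bar> \<le> 1" if "x \<in> space M" for x
  proof -
    have "\<bar>2 * A x + N x\<bar> \<le> 2 * (b * sqrt T) + b\<^sup>2" using A[OF that] N[OF that] by linarith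
    then have "t * \<bar>2 * A x + N x\<bar> \<le> t * (2 * (b * sqrt T) + b\<^sup>2)" using t0 by (rule mult_left_mono)
    then show ?thesis using t t0 by (simp add: u_def abs_mult)
  qed
  have intA: "integrable M A" using A by (intro integrable_bounded_le) auto
  have intA2: "integrable M (\<lambda>x. (A x)\<^sup>2)"
    using A power_mono[OF A, of _ 2] by (intro integrable_bounded_le[where B = "(b * sqrt T)\<^sup>2"]) auto
  have intN: "integrable M N" using N by (intro integrable_bounded_le[where B = "b\<^sup>2"]) auto
  have split: "exp (t * (\<Sum>j<k. (v j + \<xi> j x)\<^sup>2)) = exp (t * (\<Sum>j<k. (v j)\<^sup>2)) * exp (u x)" for x
  proof -
    have "(\<Sum>j<k. (v j + \<xi> j x)\<^sup>2) = (\<Sum>j<k. (v j)\<^sup>2) + 2 * A x + N x"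
      by (simp add: power2_sum sum.distrib A_def N_def sum_distrib_left mult.assoc)
    then show ?thesis by (simp add: mult_exp_exp u_def algebra_simps)
  qed
  let ?g = "\<lambda>x. 1 + t * (2 * A x + N x) + t\<^sup>2 * (8 * (A x)\<^sup>2 + 2 * b\<^sup>2 * N x)"
  have intg: "integrable M ?g" using intA intA2 intN by simp
  have le: "exp (u x) \<le> ?g x" if "x \<in> space M" for x
  proof -
    \<comment> \<open>The square is split so that the weak variance \<open>F\<close> handles
      \<open>A\<close> and the sup bound handles \<open>N\<close>; no mixed moment is
      needed.\<close>
    have "(2 * A x + N x)\<^sup>2 \<le> 8 * (A x)\<^sup>2 + 2 * (N x)\<^sup>2"
      using sum_squares_bound[of "2 * A x" "N x"] by (simp add: power2_sum power_mult_distrib)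
    moreover have "(N x)\<^sup>2 \<le> b\<^sup>2 * N x"
      unfolding power2_eq_square[of "N x"] using N[OF that] by (rule mult_right_mono[rotated])
    ultimately have "(2 * A x + N x)\<^sup>2 \<le> 8 * (A x)\<^sup>2 + 2 * b\<^sup>2 * N x" by simp
    then have "(u x)\<^sup>2 \<le> t\<^sup>2 * (8 * (A x)\<^sup>2 + 2 * b\<^sup>2 * N x)"
      by (simp add: u_def power_mult_distrib mult_left_mono)
    then show ?thesis using exp_le_quadratic[OF u[OF that]] by (simp add: u_def)
  qed
  have EA: "(\<integral>x. A x \<partial>M) = 0"
  proof -
    have "integrable M (\<lambda>x. v j * \<xi> j x)" if "j < k" for j
    proof (intro integrable_mult_right integrable_bounded_le)
      fix x assume x: "x \<in> space M"
      have "(\<xi> j x)\<^sup>2 \<le> (\<Sum>j<k. (\<xi> j x)\<^sup>2)" using that by (intro member_le_sum) auto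
      also have "\<dots> \<le> b\<^sup>2" by (rule bounded[OF x])
      finally show "\<bar>\<xi> j x\<bar> \<le> b" using b_pos by (simp add: abs_le_square_iff[symmetric])
    qed simp
    then have "(\<integral>x. A x \<partial>M) = (\<Sum>j<k. v j * (\<integral>x. \<xi> j x \<partial>M))"
      unfolding A_def by (subst Bochner_Integration.integral_sum) auto
    then show ?thesis using centered by simp
  qed
  have "(\<integral>\<^sup>+x. ennreal (exp (u x)) \<partial>M) \<le> (\<integral>\<^sup>+x. ennreal (?g x) \<partial>M)"
    by (intro nn_integral_mono ennreal_leI le)
  also have "\<dots> = ennreal (\<integral>x. ?g x \<partial>M)"
    using le by (intro nn_integral_eq_integral intg AE_I2) (meson exp_ge_zero order_trans)
  also have "(\<integral>x. ?g x \<partial>M) = 1 + t * (\<integral>x. N x \<partial>M) + t\<^sup>2 * (8 * (\<integral>x. (A x)\<^sup>2 \<partial>M) + 2 * b\<^sup>2 * (\<integral>x. N x \<partial>M))"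
    using intA intA2 intN EA by (simp add: prob_space)
  also have "\<dots> \<le> 1 + t * H + t\<^sup>2 * (8 * (F * T) + 2 * b\<^sup>2 * H)"
  proof -
    have "(\<integral>x. N x \<partial>M) \<le> H" using strong_variance by (simp add: N_def[abs_def])
    moreover have "(\<integral>x. (A x)\<^sup>2 \<partial>M) \<le> F * T"
      unfolding A_def by (rule order_trans[OF weak_variance mult_left_mono[OF v less_imp_le[OF F_pos]]])
    ultimately show ?thesis using t0 by (intro add_mono mult_left_mono) auto
  qed
  also have "\<dots> \<le> exp (t * H + t\<^sup>2 * (8 * F * T + 2 * b\<^sup>2 * H))"
    using exp_ge_add_one_self[of "t * H + t\<^sup>2 * (8 * F * T + 2 * b\<^sup>2 * H)"] by (simp add: mult.assoc add.assoc)
  finally have "(\<integral>\<^sup>+x. ennreal (exp (u x)) \<partial>M) \<le> ennreal (exp (t * H + t\<^sup>2 * (8 * F * T + 2 * b\<^sup>2 * H)))"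
    by (simp add: ennreal_leI)
  then show ?thesis
    unfolding split by (simp add: ennreal_mult nn_integral_cmult mult_left_mono)
qed

text \<open>The partial sums of the sample are frozen once their squared norm exceeds \<open>T\<close>: this keeps
  the increments of the squared norm bounded, so that it has exponential moments.\<close>

primrec stopped_sum :: "real \<Rightarrow> nat \<Rightarrow> (nat \<Rightarrow> 'a) \<Rightarrow> nat \<Rightarrow> real" where
  "stopped_sum T 0 X = (\<lambda>j. 0)"
| "stopped_sum T (Suc m) X = (\<lambda>j. stopped_sum T m X j +
     (if (\<Sum>j<k. (stopped_sum T m X j)\<^sup>2) \<le> T then \<xi> j (X (Suc m)) else 0))"

lemma stopped_sum_measurable:
  "m \<le> n \<Longrightarrow> (\<lambda>X. stopped_sum T m X j) \<in> borel_measurable (Pi\<^sub>M {1..n} (\<lambda>_. M))"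
proof (induction m arbitrary: j)
  case (Suc m)
  have [measurable]: "(\<lambda>X. stopped_sum T m X j) \<in> borel_measurable (Pi\<^sub>M {1..n} (\<lambda>_. M))" for j
    using Suc by simp
  have [measurable]: "(\<lambda>X. \<xi> j (X (Suc m))) \<in> borel_measurable (Pi\<^sub>M {1..n} (\<lambda>_. M))"
    using Suc.prems
    by (intro measurable_compose[where f = "\<lambda>X. X (Suc m)" and N = M and g = "\<xi> j"]
        measurable_component_singleton \<xi>_measurable) simp
  show ?case unfolding stopped_sum.simps by measurable
qed simp

lemma stopped_sum_upd: "m \<le> n \<Longrightarrow> stopped_sum T m (X(Suc n := x)) = stopped_sum T m X"
  by (induction m) auto

text \<open>A frozen sum stays outside the ball, so a sum that ends inside was never frozen.\<close>

lemma stopped_sum_eq: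
  "(\<Sum>j<k. (stopped_sum T m X j)\<^sup>2) \<le> T \<Longrightarrow> stopped_sum T m X = (\<lambda>j. \<Sum>i=1..m. \<xi> j (X i))"
proof (induction m)
  case (Suc m)
  have "(\<Sum>j<k. (stopped_sum T m X j)\<^sup>2) \<le> T"
    using Suc.prems by (cases "(\<Sum>j<k. (stopped_sum T m X j)\<^sup>2) \<le> T") auto
  then show ?case using Suc.IH by simp
qed simp

text \<open>Each observation costs at most a factor \<open>exp G\<close>: by
  \<open>exp_moment_step\<close> while the sum is in the ball, and trivially once it is frozen, as
  \<open>G\<close> is nonnegative.\<close>

lemma stopped_sum_exp_moment:
  assumes T0: "0 \<le> T" and t0: "0 \<le> t" and t: "t * (2 * (b * sqrt T) + b\<^sup>2) \<le> 1"
  defines "G \<equiv> t * H + t\<^sup>2 * (8 * F * T + 2 * b\<^sup>2 * H)"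
  shows "(\<integral>\<^sup>+X. ennreal (exp (t * (\<Sum>j<k. (stopped_sum T n X j)\<^sup>2))) \<partial>Pi\<^sub>M {1..n} (\<lambda>_. M))
    \<le> ennreal (exp (real n * G))"
proof (induction n)
  case 0
  interpret P: prob_space "Pi\<^sub>M {1..0} (\<lambda>_::nat. M)" by (rule prob_space_PiM_const) unfold_locales
  show ?case using P.emeasure_space_1 by simp
next
  case (Suc n)
  have G0: "0 \<le> G" using T0 t0 F_pos H_pos by (simp add: G_def)
  note [measurable] = stopped_sum_measurable
  let ?E = "\<lambda>n X. ennreal (exp (t * (\<Sum>j<k. (stopped_sum T n X j)\<^sup>2)))"
  have inner: "(\<integral>\<^sup>+x. ?E (Suc n) (X(Suc n := x)) \<partial>M) \<le> ?E n X * ennreal (exp G)" for X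
  proof (cases "(\<Sum>j<k. (stopped_sum T n X j)\<^sup>2) \<le> T")
    case True
    then have "?E (Suc n) (X(Suc n := x)) = ennreal (exp (t * (\<Sum>j<k. (stopped_sum T n X j + \<xi> j x)\<^sup>2)))" for x
      by (simp add: stopped_sum_upd)
    then show ?thesis using exp_moment_step[OF True t0 t] by (simp only: G_def)
  next
    case False
    then have "(\<integral>\<^sup>+x. ?E (Suc n) (X(Suc n := x)) \<partial>M) = ?E n X * 1"
      by (simp add: stopped_sum_upd emeasure_space_1)
    also have "\<dots> \<le> ?E n X * ennreal (exp G)" using G0 by (intro mult_left_mono) auto
    finally show ?thesis .
  qed
  have "(\<integral>\<^sup>+X. ?E (Suc n) X \<partial>Pi\<^sub>M {1..Suc n} (\<lambda>_. M)) =
      (\<integral>\<^sup>+X. (\<integral>\<^sup>+x. ?E (Suc n) (X(Suc n := x)) \<partial>M) \<partial>Pi\<^sub>M {1..n} (\<lambda>_. M))"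
    by (rule nn_integral_PiM_Suc) (unfold_locales, measurable)
  also have "\<dots> \<le> (\<integral>\<^sup>+X. ?E n X * ennreal (exp G) \<partial>Pi\<^sub>M {1..n} (\<lambda>_. M))"
    by (intro nn_integral_mono inner)
  also have "\<dots> = (\<integral>\<^sup>+X. ?E n X \<partial>Pi\<^sub>M {1..n} (\<lambda>_. M)) * ennreal (exp G)"
    by (rule nn_integral_multc) measurable
  also have "\<dots> \<le> ennreal (exp (real n * G)) * ennreal (exp G)"
    by (intro mult_right_mono Suc) simp
  also have "\<dots> = ennreal (exp (real (Suc n) * G))"
    by (simp add: ennreal_mult[symmetric] mult_exp_exp algebra_simps)
  finally show ?case .
qed

text \<open>Markov's inequality for the stopped sum. If the plain sum ends outside the ball then so
  does the stopped one, since otherwise the two would coincide.\<close>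

lemma sum_tail_exponential:
  assumes T0: "0 \<le> T" and t0: "0 \<le> t" and t: "t * (2 * (b * sqrt T) + b\<^sup>2) \<le> 1"
  shows "(\<integral>\<^sup>+X. indicator {X. T < (\<Sum>j<k. (\<Sum>i=1..n. \<xi> j (X i))\<^sup>2)} X \<partial>Pi\<^sub>M {1..n} (\<lambda>_. M))
    \<le> ennreal (exp (real n * (t * H + t\<^sup>2 * (8 * F * T + 2 * b\<^sup>2 * H)) - t * T))"
proof -
  note [measurable] = stopped_sum_measurable
  let ?E = "\<lambda>X. ennreal (exp (t * (\<Sum>j<k. (stopped_sum T n X j)\<^sup>2)))"
  have "(\<integral>\<^sup>+X. indicator {X. T < (\<Sum>j<k. (\<Sum>i=1..n. \<xi> j (X i))\<^sup>2)} X \<partial>Pi\<^sub>M {1..n} (\<lambda>_. M))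
      \<le> (\<integral>\<^sup>+X. ?E X * ennreal (exp (- (t * T))) \<partial>Pi\<^sub>M {1..n} (\<lambda>_. M))"
  proof (rule nn_integral_mono)
    fix X
    show "indicator {X. T < (\<Sum>j<k. (\<Sum>i=1..n. \<xi> j (X i))\<^sup>2)} X \<le> ?E X * ennreal (exp (- (t * T)))"
    proof (cases "T < (\<Sum>j<k. (\<Sum>i=1..n. \<xi> j (X i))\<^sup>2)")
      case True
      have "T < (\<Sum>j<k. (stopped_sum T n X j)\<^sup>2)"
      proof (rule ccontr)
        assume "\<not> ?thesis"
        then have le: "(\<Sum>j<k. (stopped_sum T n X j)\<^sup>2) \<le> T" by simp
        from le True show False unfolding stopped_sum_eq[OF le] by simp
      qed
      then have "t * T \<le> t * (\<Sum>j<k. (stopped_sum T n X j)\<^sup>2)" using t0 by (intro mult_left_mono) auto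
      then have "1 \<le> exp (t * (\<Sum>j<k. (stopped_sum T n X j)\<^sup>2)) * exp (- (t * T))"
        by (simp add: mult_exp_exp)
      then have "ennreal 1 \<le> ennreal (exp (t * (\<Sum>j<k. (stopped_sum T n X j)\<^sup>2)) * exp (- (t * T)))"
        by (rule ennreal_leI)
      then show ?thesis using True by (simp add: ennreal_mult)
    qed simp
  qed
  also have "\<dots> = (\<integral>\<^sup>+X. ?E X \<partial>Pi\<^sub>M {1..n} (\<lambda>_. M)) * ennreal (exp (- (t * T)))"
    by (rule nn_integral_multc) measurable
  also have "\<dots> \<le> ennreal (exp (real n * (t * H + t\<^sup>2 * (8 * F * T + 2 * b\<^sup>2 * H)))) * ennreal (exp (- (t * T)))"
    by (intro mult_right_mono stopped_sum_exp_moment[OF assms]) simp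
  also have "\<dots> = ennreal (exp (real n * (t * H + t\<^sup>2 * (8 * F * T + 2 * b\<^sup>2 * H)) - t * T))"
    by (simp add: ennreal_mult[symmetric] mult_exp_exp)
  finally show ?thesis .
qed

text \<open>The two exponentials are the two regimes of the bound: in the first the weak variance
  \<open>F\<close> limits \<open>t\<close>, in the second the size \<open>b\<close> of a single
  vector.\<close>

lemma sum_tail:
  assumes n: "1 \<le> n"
  shows "(\<integral>\<^sup>+X. indicator {X. 16 * real n * H < (\<Sum>j<k. (\<Sum>i=1..n. \<xi> j (X i))\<^sup>2)} X \<partial>Pi\<^sub>M {1..n} (\<lambda>_. M))
    \<le> ennreal (exp (- (9 * H / (32 * F))) + exp (- (9 * real n * H / (8 * b * sqrt (real n * H) + b\<^sup>2))))"
proof -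
  let ?N = "real n"
  define T where "T = 16 * ?N * H"
  have N: "0 < ?N" using n by simp
  have sqrtT: "sqrt T = 4 * sqrt (?N * H)"
    unfolding T_def mult.assoc by (simp add: real_sqrt_mult)
  define D where "D = 8 * b * sqrt (?N * H) + b\<^sup>2"
  have D: "0 < D" "b\<^sup>2 \<le> D" using b_pos H_pos by (simp_all add: D_def add_nonneg_pos)
  \<comment> \<open>The first entry caps the weak variance term of the exponent; the second, as
    \<open>D\<close> equals \<open>2 * (b * sqrt T) + b\<^sup>2\<close>, is the restriction on
    \<open>t\<close> in \<open>sum_tail_exponential\<close>.\<close>
  define t where "t = min (1 / (32 * ?N * F)) (1 / D)"
  have t0: "0 < t" using D N F_pos by (simp add: t_def)
  have tD: "t * D \<le> 1" and tF: "t * (32 * ?N * F) \<le> 1"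
    using D N F_pos by (simp_all add: t_def min_def field_simps split: if_splits)
  have tD': "t * (2 * (b * sqrt T) + b\<^sup>2) \<le> 1" using tD by (simp add: D_def sqrtT mult.assoc)
  have "t * b\<^sup>2 \<le> t * D" using D(2) t0 by (intro mult_left_mono) auto
  then have tb: "t * b\<^sup>2 \<le> 1" using tD by simp
  have X0: "0 \<le> t * (?N * H)" using t0 N H_pos by simp
  \<comment> \<open>With \<open>T = 16 * n * H\<close> all terms share the factor
    \<open>t * n * H\<close>; the bracket is at most 1 + 4 + 2 - 16.\<close>
  have "?N * (t * H + t\<^sup>2 * (8 * F * T + 2 * b\<^sup>2 * H)) - t * T =
      (t * (?N * H)) * (1 + 4 * (t * (32 * ?N * F)) + 2 * (t * b\<^sup>2) - 16)"
    by (simp add: T_def power2_eq_square algebra_simps)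
  also have "\<dots> \<le> (t * (?N * H)) * (- 9)"
    using X0 tF tb by (intro mult_left_mono) auto
  finally have expo: "?N * (t * H + t\<^sup>2 * (8 * F * T + 2 * b\<^sup>2 * H)) - t * T \<le> - (9 * ?N * H * t)"
    by (simp add: mult_ac)
  have "exp (- (9 * ?N * H * t)) \<le> exp (- (9 * H / (32 * F))) + exp (- (9 * ?N * H / D))"
  proof (cases "1 / (32 * ?N * F) \<le> 1 / D")
    case True
    then have "9 * ?N * H * t = 9 * H / (32 * F)" using N by (simp add: t_def min_def)
    then show ?thesis by simp
  next
    case False
    then have "9 * ?N * H * t = 9 * ?N * H / D" by (simp add: t_def min_def)
    then show ?thesis by simp
  qed
  then have "exp (?N * (t * H + t\<^sup>2 * (8 * F * T + 2 * b\<^sup>2 * H)) - t * T) \<le>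
      exp (- (9 * H / (32 * F))) + exp (- (9 * ?N * H / D))"
    using expo by (meson exp_le_cancel_iff order_trans)
  moreover have "0 \<le> T" using N H_pos by (simp add: T_def)
  ultimately show ?thesis
    using sum_tail_exponential[OF _ less_imp_le[OF t0] tD', of n]
    unfolding T_def D_def by (meson ennreal_leI order_trans)
qed

end

section \<open>Weighted losses\<close>

lemma sum_lessThan_split: "k \<le> l \<Longrightarrow> (\<Sum>j<l. g j :: real) = (\<Sum>j<k. g j) + (\<Sum>j\<in>{k..<l}. g j)" for k l :: nat
proof -
  assume "k \<le> l"
  then have "{..<l} = {..<k} \<union> {k..<l}" by auto
  then show ?thesis by (simp add: sum.union_disjoint ivl_disj_int)
qed

text \<open>Passing from \<open>k0\<close> to \<open>k\<close> gains at most the squared empirical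
  coefficients in between, each at most twice the squared noise plus twice the squared true
  coefficient.\<close>

lemma contrast_diff_above:
  fixes a e :: "nat \<Rightarrow> real"
  assumes "k0 \<le> k"
  shows "(q * sqrt k - q * sqrt k0) - 2 * (\<Sum>j<k. (e j - a j)\<^sup>2) - 2 * (\<Sum>j\<in>{k0..<k}. (a j)\<^sup>2)
    \<le> (- (\<Sum>j<k. (e j)\<^sup>2) + q * sqrt k) - (- (\<Sum>j<k0. (e j)\<^sup>2) + q * sqrt k0)"
proof -
  have "(e j)\<^sup>2 \<le> 2 * (e j - a j)\<^sup>2 + 2 * (a j)\<^sup>2" for j
    using sum_squares_bound[of "e j - a j" "a j"] power2_sum[of "e j - a j" "a j"] by simp
  then have "(\<Sum>j\<in>{k0..<k}. (e j)\<^sup>2) \<le> (\<Sum>j\<in>{k0..<k}. 2 * (e j - a j)\<^sup>2 + 2 * (a j)\<^sup>2)"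
    by (intro sum_mono)
  also have "\<dots> = 2 * (\<Sum>j\<in>{k0..<k}. (e j - a j)\<^sup>2) + 2 * (\<Sum>j\<in>{k0..<k}. (a j)\<^sup>2)"
    by (simp add: sum.distrib sum_distrib_left)
  also have "(\<Sum>j\<in>{k0..<k}. (e j - a j)\<^sup>2) \<le> (\<Sum>j<k. (e j - a j)\<^sup>2)"
    by (intro sum_mono2) auto
  finally show ?thesis
    using sum_lessThan_split[OF assms, of "\<lambda>j. (e j)\<^sup>2"] by simp
qed

text \<open>Dropping the coefficients from \<open>k\<close> to \<open>k0\<close> loses their
  empirical energy, which is at least half the true energy minus the noise. Only the noise up to
  \<open>k0\<close> enters, so its expectation will suffice.\<close>

lemma contrast_diff_below:
  fixes a e :: "nat \<Rightarrow> real"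
  assumes "k \<le> k0" "0 \<le> q"
  shows "(\<Sum>j\<in>{k..<k0}. (a j)\<^sup>2) / 2 - (\<Sum>j<k0. (e j - a j)\<^sup>2) - q * sqrt k0
    \<le> (- (\<Sum>j<k. (e j)\<^sup>2) + q * sqrt k) - (- (\<Sum>j<k0. (e j)\<^sup>2) + q * sqrt k0)"
proof -
  have "(a j)\<^sup>2 / 2 \<le> (e j)\<^sup>2 + (e j - a j)\<^sup>2" for j
    using sum_squares_bound[of "e j" "a j - e j"] power2_sum[of "e j" "a j - e j"]
    by (simp add: power2_commute)
  then have "(\<Sum>j\<in>{k..<k0}. (a j)\<^sup>2 / 2) \<le> (\<Sum>j\<in>{k..<k0}. (e j)\<^sup>2 + (e j - a j)\<^sup>2)"
    by (intro sum_mono)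
  also have "\<dots> = (\<Sum>j\<in>{k..<k0}. (e j)\<^sup>2) + (\<Sum>j\<in>{k..<k0}. (e j - a j)\<^sup>2)"
    by (simp add: sum.distrib)
  also have "(\<Sum>j\<in>{k..<k0}. (e j - a j)\<^sup>2) \<le> (\<Sum>j<k0. (e j - a j)\<^sup>2)"
    by (intro sum_mono2) auto
  moreover have "0 \<le> q * sqrt k" using assms by simp
  ultimately show ?thesis
    using sum_lessThan_split[OF assms(1), of "\<lambda>j. (e j)\<^sup>2"] by (simp add: sum_divide_distrib[symmetric])
qed

text \<open>Both weightings satisfy \<open>w k \<le> exp (- n (c k - c k0))\<close>. Above \<open>k0\<close> the penalty dominates the
  stochastic error \<open>V k \<le> 16 h \<surd>k\<close> as soon as \<open>q \<ge> 42 h\<close>; below \<open>k0\<close> the bias does the work and no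
  concentration is needed.\<close>

lemma weighted_loss_bound:
  fixes w V B c :: "nat \<Rightarrow> real" and n q h :: real
  assumes w0: "\<And>k. k \<in> {1..M} \<Longrightarrow> 0 \<le> w k" and w1: "(\<Sum>k=1..M. w k) = 1"
    and wexp: "\<And>k. k \<in> {1..M} \<Longrightarrow> w k \<le> exp (- (n * (c k - c k0)))"
    and k0: "k0 \<in> {1..M}"
    and V0: "\<And>k. 0 \<le> V k" and V_mono: "\<And>k l. k \<le> l \<Longrightarrow> V k \<le> V l"
    and B0: "\<And>k. 0 \<le> B k" and B_anti: "\<And>k l. k \<le> l \<Longrightarrow> B l \<le> B k"
    and above: "\<And>k. k0 \<le> k \<Longrightarrow> (q * sqrt k - q * sqrt k0) - 2 * V k - 2 * B k0 \<le> c k - c k0"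
    and below: "\<And>k. k \<le> k0 \<Longrightarrow> (B k - B k0) / 2 - V k0 - q * sqrt k0 \<le> c k - c k0"
    and n: "0 < n" and q: "0 \<le> q" and h: "0 < h" and nh: "1 \<le> n * h"
  shows "(\<Sum>k=1..M. w k * (V k + B k)) \<le> 10 * (V k0 + B k0 + q * sqrt k0)
    + 16 * h * (\<Sum>k\<in>{1..M}. sqrt (real k) * exp (- sqrt (real k))) + (\<Sum>k\<in>{1..<k0}. B k * exp (- (n * B k / 4)))
    + 2 * (\<Sum>k\<in>{k0<..M}. V k * of_bool (16 * h * sqrt k < V k)) + 16 * h * sqrt M * of_bool (q < 42 * h)"
proof -
  let ?E = "10 * (V k0 + B k0 + q * sqrt k0)"
  \<comment> \<open>Bound for a single term. The parts carrying \<open>w k\<close> are summed with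
    total weight 1 and thus count once, not \<open>M\<close> times.\<close>
  define u where "u k = ?E * w k + 16 * h * (sqrt k * exp (- sqrt k))
    + (if k < k0 then B k * exp (- (n * B k / 4)) else 0)
    + (if k0 < k then 2 * (V k * of_bool (16 * h * sqrt k < V k)) else 0)
    + 16 * h * sqrt M * of_bool (q < 42 * h) * w k" for k
  have qk: "0 \<le> q * sqrt (real k)" for k :: nat using q by simp
  have E0: "0 \<le> ?E" using V0 B0 qk by simp
  have w_le1: "w k \<le> 1" if "k \<in> {1..M}" for k
    using member_le_sum[of k "{1..M}" w] w0 that w1 by simp
  have small: "16 * h * sqrt M * of_bool (q < 42 * h) * w k \<ge> 0" if "k \<in> {1..M}" for k
    using w0[OF that] h by simp
  have tail0: "0 \<le> 16 * h * (sqrt (real k) * exp (- sqrt (real k)))" for k :: nat using h by simp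
  have term_le: "w k * (V k + B k) \<le> u k" if k: "k \<in> {1..M}" for k
  proof (cases "k \<le> k0")
    case True
    \<comment> \<open>The excess of the contrast is at least \<open>B k / 2 - e\<close>. If
      \<open>B k \<ge> 4 * e\<close> this is at least \<open>B k / 4\<close> and the weight is
      exponentially small; otherwise \<open>B k\<close> is of oracle size already.\<close>
    define e where "e = B k0 / 2 + V k0 + q * sqrt k0"
    have e0: "0 \<le> e" using B0 V0 qk by (simp add: e_def)
    have V: "w k * V k \<le> w k * V k0" using w0[OF k] V_mono[OF True] by (rule mult_left_mono[rotated])
    have Bx: "w k * B k \<le> 4 * e * w k + (if k < k0 then B k * exp (- (n * B k / 4)) else 0)"
    proof (cases "k < k0 \<and> e \<le> B k / 4")
      case c: True
      have "B k / 4 \<le> c k - c k0" using below[OF True] c by (simp add: e_def field_simps)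
      then have "n * (B k / 4) \<le> n * (c k - c k0)" using n by (intro mult_left_mono) auto
      then have "w k \<le> exp (- (n * B k / 4))"
        using order_trans[OF wexp[OF k], of "exp (- (n * B k / 4))"] by simp
      then have "w k * B k \<le> exp (- (n * B k / 4)) * B k" using B0 by (rule mult_right_mono)
      also have "\<dots> = B k * exp (- (n * B k / 4))" by (rule mult.commute)
      finally have "w k * B k \<le> B k * exp (- (n * B k / 4))" .
      moreover have "0 \<le> 4 * e * w k" using e0 w0[OF k] by simp
      ultimately show ?thesis using c by simp
    next
      case c: False
      have "B k \<le> 4 * e"
      proof (cases "k < k0")
        case True then show ?thesis using c by simp
      next
        case False
        then have "k = k0" using \<open>k \<le> k0\<close> by simp
        then show ?thesis using B0[of k0] V0[of k0] qk[of k0] by (simp add: e_def)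
      qed
      then have "w k * B k \<le> w k * (4 * e)" using w0[OF k] by (rule mult_left_mono)
      moreover have "0 \<le> B k * exp (- (n * B k / 4))" using B0 by simp
      ultimately show ?thesis by (simp add: mult_ac)
    qed
    have "w k * V k0 + 4 * e * w k = (V k0 + 4 * e) * w k" by (simp add: algebra_simps)
    also have "\<dots> \<le> ?E * w k"
      using w0[OF k] V0[of k0] B0[of k0] qk[of k0] by (intro mult_right_mono) (auto simp: e_def)
    finally have "w k * V k0 + 4 * e * w k \<le> ?E * w k" .
    moreover have "(if k0 < k then 2 * (V k * of_bool (16 * h * sqrt k < V k)) else 0) = 0"
      using True by simp
    ultimately show ?thesis
      unfolding u_def distrib_left[of "w k" "V k"] using V Bx small[OF k] tail0[of k] by linarith
  next
    case False
    then have gt: "k0 < k" by simp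
    define e where "e = q * sqrt k0 + 2 * B k0"
    have e0: "0 \<le> e" using B0 qk by (simp add: e_def)
    have B: "w k * B k \<le> w k * B k0" using w0[OF k] B_anti gt by (intro mult_left_mono) auto
    have ewk: "0 \<le> e * w k" using e0 w0[OF k] by simp
    have main: "w k * V k \<le> 16 / 5 * e * w k + 16 * h * (sqrt k * exp (- sqrt k))
      + 2 * (V k * of_bool (16 * h * sqrt k < V k)) + 16 * h * sqrt M * of_bool (q < 42 * h) * w k"
    proof (cases "16 * h * sqrt k < V k")
      case True
      have "w k * V k \<le> 1 * V k" using w_le1[OF k] V0 by (rule mult_right_mono)
      moreover have "V k * of_bool (16 * h * sqrt k < V k) = V k" using True by simp
      moreover have "0 \<le> 16 / 5 * e * w k" using ewk by simp
      ultimately show ?thesis using small[OF k] tail0[of k] V0[of k] by linarith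
    next
      case Vle: False
      then have Vw: "w k * V k \<le> 16 * h * (w k * sqrt k)"
        using mult_left_mono[of "V k" "16 * h * sqrt k" "w k"] w0[OF k] by (simp add: mult_ac)
      show ?thesis
      \<comment> \<open>The penalty may be too small here, so \<open>sqrt k\<close> is only bounded
        by \<open>sqrt M\<close>; the event will have probability of order 1 / n.\<close>
      proof (cases "q < 42 * h")
        case True
        have "w k * sqrt k \<le> w k * sqrt M" using k w0[OF k] by (intro mult_left_mono) auto
        then have "16 * h * (w k * sqrt k) \<le> 16 * h * (w k * sqrt M)"
          by (rule mult_left_mono) (use h in simp)
        also have "\<dots> = 16 * h * sqrt M * of_bool (q < 42 * h) * w k" using True by simp
        finally have "16 * h * (w k * sqrt k) \<le> 16 * h * sqrt M * of_bool (q < 42 * h) * w k" .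
        moreover have "0 \<le> 16 / 5 * e * w k" using ewk by simp
        moreover have "0 \<le> V k * of_bool (16 * h * sqrt k < V k)" using V0[of k] by simp
        ultimately show ?thesis using Vw tail0[of k] by linarith
      next
        case q42: False
        \<comment> \<open>If \<open>e \<le> 5 * h * sqrt k\<close>, the excess is at least (42 - 32
          - 5) units of \<open>h * sqrt k\<close>, and \<open>n * h \<ge> 1\<close> makes the weight
          at most \<open>exp (- sqrt k)\<close>. Otherwise \<open>h * sqrt k\<close> is below
          \<open>e / 5\<close>, which is of oracle size.\<close>
        have "h * (w k * sqrt k) \<le> e * w k / 5 + h * (sqrt k * exp (- sqrt k))"
        proof (cases "e \<le> 5 * h * sqrt k")
          case True
          have "42 * h * sqrt k \<le> q * sqrt k" using q42 by (intro mult_right_mono) auto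
          then have "5 * h * sqrt k \<le> c k - c k0"
            using above[OF less_imp_le[OF gt]] Vle True unfolding e_def by linarith
          then have "n * (5 * h * sqrt k) \<le> n * (c k - c k0)" using n by (intro mult_left_mono) auto
          moreover have "sqrt k \<le> n * h * (5 * sqrt k)"
          proof -
            have "1 * (5 * sqrt k) \<le> n * h * (5 * sqrt k)" using nh by (rule mult_right_mono) simp
            moreover have "0 \<le> sqrt k" by simp
            ultimately show ?thesis by linarith
          qed
          ultimately have "sqrt k \<le> n * (c k - c k0)" by (simp add: mult_ac)
          then have "w k \<le> exp (- sqrt k)" using order_trans[OF wexp[OF k], of "exp (- sqrt k)"] by simp
          then have "h * (w k * sqrt k) \<le> h * (exp (- sqrt k) * sqrt k)"
            using h by (intro mult_left_mono mult_right_mono) auto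
          then show ?thesis using ewk by (simp add: mult_ac)
        next
          case False
          then have "h * sqrt k * w k \<le> e / 5 * w k" using w0[OF k] by (intro mult_right_mono) auto
          moreover have "0 \<le> h * (sqrt k * exp (- sqrt k))" using h by simp
          ultimately show ?thesis by (simp add: mult_ac)
        qed
        then show ?thesis using Vw Vle q42 by simp
      qed
    qed
    have "w k * B k0 + 16 / 5 * e * w k = (B k0 + 16 / 5 * e) * w k" by (simp add: algebra_simps)
    also have "\<dots> \<le> ?E * w k"
      using w0[OF k] V0[of k0] B0[of k0] qk[of k0] by (intro mult_right_mono) (auto simp: e_def)
    finally have "w k * B k0 + 16 / 5 * e * w k \<le> ?E * w k" .
    moreover have "(if k0 < k then 2 * (V k * of_bool (16 * h * sqrt k < V k)) else 0) =
        2 * (V k * of_bool (16 * h * sqrt k < V k))"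
      using gt by simp
    moreover have "(if k < k0 then B k * exp (- (n * B k / 4)) else 0) = 0" using gt by simp
    ultimately show ?thesis
      unfolding u_def distrib_left[of "w k" "V k"] using B main by linarith
  qed
  have "(\<Sum>k=1..M. w k * (V k + B k)) \<le> (\<Sum>k=1..M. u k)" by (rule sum_mono[OF term_le])
  also have "\<dots> = ?E * (\<Sum>k=1..M. w k) + 16 * h * (\<Sum>k\<in>{1..M}. sqrt (real k) * exp (- sqrt (real k)))
      + (\<Sum>k=1..M. if k < k0 then B k * exp (- (n * B k / 4)) else 0)
      + (\<Sum>k=1..M. if k0 < k then 2 * (V k * of_bool (16 * h * sqrt k < V k)) else 0)
      + 16 * h * sqrt M * of_bool (q < 42 * h) * (\<Sum>k=1..M. w k)"
    by (simp only: u_def sum.distrib sum_distrib_left)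
  also have "(\<Sum>k=1..M. if k < k0 then B k * exp (- (n * B k / 4)) else 0) =
      (\<Sum>k\<in>{1..<k0}. B k * exp (- (n * B k / 4)))"
    using k0 by (intro sum.mono_neutral_cong_right) auto
  also have "(\<Sum>k=1..M. if k0 < k then 2 * (V k * of_bool (16 * h * sqrt k < V k)) else 0) =
      2 * (\<Sum>k\<in>{k0<..M}. V k * of_bool (16 * h * sqrt k < V k))"
    unfolding sum_distrib_left using k0 by (intro sum.mono_neutral_cong_right) auto
  finally show ?thesis unfolding w1 mult_1_right .
qed

section \<open>The statistical model\<close>

lemma power2_mean_le_mean_power2:
  fixes g :: "nat \<Rightarrow> real"
  shows "(\<Sum>i=1..n. g i)\<^sup>2 \<le> real n * (\<Sum>i=1..n. (g i)\<^sup>2)"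
  using Cauchy_Schwarz_ineq_sum[of "\<lambda>_. 1" g "{1..n}"] by simp

locale density_model =
  fixes s :: setting and C :: real and f :: "real \<Rightarrow> real"
  assumes basis_constant: "basis_constant s C"
    and L2_density: "L2_density (domain_of s) f"
    and sup_norm_finite: "sup_norm f < \<infinity>"
    and moment: "integrable (law f) (\<lambda>x. \<bar>x\<bar> powr (2 * alpha_of s))"
begin

abbreviation a :: "nat \<Rightarrow> real" where "a \<equiv> coeff_of s f"
abbreviation \<phi> :: "nat \<Rightarrow> real \<Rightarrow> real" where "\<phi> \<equiv> basis_fun s"
abbreviation v :: real where "v \<equiv> v_of s f"
abbreviation d :: real where "d \<equiv> d_of s"
definition F :: real where "F = real_of_ereal (sup_norm f)"
definition energy :: real where "energy = (norm_on (domain_of s) f)\<^sup>2"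
definition moment2 :: real where "moment2 = (\<integral>x. \<bar>x\<bar> powr (2 * alpha_of s) \<partial>law f)"

lemma C_ge_1: "1 \<le> C" using basis_constant by (simp add: basis_constant_def)

lemma f_measurable [measurable]: "f \<in> borel_measurable borel"
  and f_nonneg: "0 \<le> f x"
  and f_outside: "x \<notin> domain_of s \<Longrightarrow> f x = 0"
  and f_total: "(\<integral>\<^sup>+ x. ennreal (f x) \<partial>lborel) = 1"
  using L2_density by (auto simp: L2_density_def)

lemma f_outside_indicator: "indicator (domain_of s) x * f x = f x"
  using f_outside[of x] by (auto split: split_indicator)

lemma space_law [simp]: "space (law f) = UNIV" and sets_law [simp, measurable_cong]: "sets (law f) = sets borel"
  by (simp_all add: law_def)

sublocale law: prob_space "law f"
  by (rule prob_spaceI) (simp add: law_def emeasure_density f_total)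

lemma measure_law_UNIV [simp]: "measure (law f) UNIV = 1"
  using law.prob_space by simp

lemma f_le_F: "f x \<le> F"
proof -
  have "ereal \<bar>f x\<bar> \<le> sup_norm f" unfolding sup_norm_def by (rule SUP_upper) simp
  moreover have "sup_norm f = ereal F"
    using sup_norm_finite \<open>ereal \<bar>f x\<bar> \<le> sup_norm f\<close>
    by (cases "sup_norm f") (auto simp: F_def)
  ultimately show ?thesis by simp
qed

lemma F_pos: "0 < F"
proof (rule ccontr)
  assume "\<not> 0 < F"
  then have "f x = 0" for x using f_le_F[of x] f_nonneg[of x] by linarith
  then show False using f_total by simp
qed

lemma f_in_L2: "in_L2 (dom_measure s) f"
proof -
  have "integrable lborel (\<lambda>x. indicator (domain_of s) x * (f x)\<^sup>2)"
    using L2_density by (simp add: L2_density_def set_integrable_def)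
  then show ?thesis
    by (simp add: in_L2_def integrable_domain borel_measurable_domain)
qed

lemma inner_on_eq: "inner_on (domain_of s) g h = (\<integral>x. g x * h x \<partial>dom_measure s)"
  by (simp add: inner_on_def set_lebesgue_integral_def integral_domain)

lemma a_eq: "a j = (\<integral>x. f x * \<phi> j x \<partial>dom_measure s)"
  by (simp add: coeff_of_def inner_on_eq)

lemma norm_on_square: "(norm_on (domain_of s) g)\<^sup>2 = (\<integral>x. (g x)\<^sup>2 \<partial>dom_measure s)"
proof -
  have "0 \<le> (\<integral>x. g x * g x \<partial>dom_measure s)" by (rule integral_nonneg_AE) simp
  then show ?thesis by (simp add: norm_on_def inner_on_eq power2_eq_square)
qed

lemma expectation_law:
  fixes g :: "real \<Rightarrow> real"
  assumes "g \<in> borel_measurable borel"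
  shows "(\<integral>x. g x \<partial>law f) = (\<integral>x. g x * f x \<partial>dom_measure s)"
proof -
  have "(\<integral>x. g x \<partial>law f) = (\<integral>x. f x *\<^sub>R g x \<partial>lborel)"
    unfolding law_def using assms f_nonneg by (intro integral_density) auto
  also have "\<dots> = (\<integral>x. indicator (domain_of s) x * (g x * f x) \<partial>lborel)"
    by (intro Bochner_Integration.integral_cong refl) (metis f_outside_indicator mult.assoc mult.commute real_scaleR_def)
  finally show ?thesis by (simp add: integral_domain)
qed

lemma energy_sums: "(\<lambda>j. (a j)\<^sup>2) sums energy"
  using basis_parseval[OF f_in_L2] by (simp add: a_eq energy_def norm_on_square)

lemma energy_pos: "0 < energy"
proof -
  have "energy \<noteq> 0"
  proof
    assume "energy = 0"
    then have "(\<integral>x. (f x)\<^sup>2 \<partial>dom_measure s) = 0" by (simp add: energy_def norm_on_square)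
    then have "AE x in dom_measure s. (f x)\<^sup>2 = 0"
      using integral_nonneg_eq_0_iff_AE[OF in_L2_square[OF f_in_L2]] by simp
    then have "AE x in lborel. x \<in> domain_of s \<longrightarrow> (f x)\<^sup>2 = 0" by (simp add: AE_restrict_space_iff)
    then have "AE x in lborel. ennreal (f x) = 0"
      by eventually_elim (use f_outside in auto)
    then have "(\<integral>\<^sup>+ x. ennreal (f x) \<partial>lborel) = 0"
      by (subst nn_integral_0_iff_AE) auto
    then show False using f_total by simp
  qed
  then show ?thesis by (simp add: energy_def)
qed

section \<open>Squared bias as energy of the tail coefficients\<close>

definition tail_energy :: "nat \<Rightarrow> real" where "tail_energy k = (\<Sum>j. (a (j + k))\<^sup>2)"

lemma tail_energy_eq: "tail_energy k = energy - (\<Sum>j<k. (a j)\<^sup>2)"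
  using suminf_minus_initial_segment[OF sums_summable[OF energy_sums], of k] energy_sums
  by (simp add: tail_energy_def sums_iff)

lemma tail_energy_nonneg: "0 \<le> tail_energy k"
  unfolding tail_energy_def
  using summable_ignore_initial_segment[OF sums_summable[OF energy_sums], of k]
  by (intro suminf_nonneg) auto

lemma tail_energy_diff: "k \<le> l \<Longrightarrow> (\<Sum>j\<in>{k..<l}. (a j)\<^sup>2) = tail_energy k - tail_energy l"
  using sum_lessThan_split[of k l "\<lambda>j. (a j)\<^sup>2"] by (simp add: tail_energy_eq)

lemma tail_energy_antimono: "k \<le> l \<Longrightarrow> tail_energy l \<le> tail_energy k"
  using tail_energy_diff[of k l] sum_nonneg[of "{k..<l}" "\<lambda>j. (a j)\<^sup>2"] by simp

lemma tail_energy_le: "tail_energy k \<le> energy"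
  by (simp add: tail_energy_eq sum_nonneg)

lemma bias_square: "(bias s f k)\<^sup>2 = tail_energy k / energy"
  using tail_energy_nonneg[of k] energy_pos by (simp add: bias_def tail_energy_def energy_def)

lemma basis_square_sum_le:
  assumes "1 \<le> k"
  shows "(\<Sum>j<k. (\<phi> j x)\<^sup>2) \<le> C * real k powr d"
proof -
  have "ereal \<bar>\<Sum>j<k. (\<phi> j x)\<^sup>2\<bar> \<le> sup_norm (\<lambda>x. \<Sum>j<k. (\<phi> j x)\<^sup>2)"
    unfolding sup_norm_def by (rule SUP_upper) simp
  also have "\<dots> \<le> ereal (C * real k powr d)"
    using basis_constant assms by (simp add: basis_constant_def)
  finally show ?thesis by simp
qed

text \<open>Boundedness of the single basis functions supplies all integrability under
  \<open>law f\<close>.\<close>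

lemma basis_square_bound: "(\<phi> j x)\<^sup>2 \<le> C * real (Suc j) powr d"
proof -
  have "(\<phi> j x)\<^sup>2 \<le> (\<Sum>i<Suc j. (\<phi> i x)\<^sup>2)" by (intro member_le_sum) auto
  also have "\<dots> \<le> C * real (Suc j) powr d" by (rule basis_square_sum_le) simp
  finally show ?thesis .
qed

lemma basis_in_L2_law: "integrable (law f) (\<lambda>x. (\<phi> j x)\<^sup>2)"
  using basis_square_bound[of j]
  by (intro law.integrable_const_bound[where B = "C * real (Suc j) powr d"]) auto

lemma basis_integrable_law: "integrable (law f) (\<phi> j)"
  by (rule law.square_integrable_imp_integrable[OF _ basis_in_L2_law]) simp

lemma expectation_basis: "(\<integral>x. \<phi> j x \<partial>law f) = a j"
  by (simp add: expectation_law a_eq mult.commute)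

lemma powr_alpha_square: "(\<bar>x\<bar> powr alpha_of s)\<^sup>2 = \<bar>x\<bar> powr (2 * alpha_of s)" for x :: real
  by (simp add: power2_eq_square powr_add[symmetric])

lemma alpha_moment: "integrable (law f) (\<lambda>x. \<bar>x\<bar> powr alpha_of s)"
  by (rule law.square_integrable_imp_integrable) (simp_all add: powr_alpha_square moment)

lemma v_ge_1: "1 \<le> v" by (simp add: v_of_def)

lemma moment2_nonneg: "0 \<le> moment2" by (simp add: moment2_def)

lemma basis_energy_le:
  assumes "1 \<le> k"
  shows "(\<Sum>j<k. \<integral>x. (\<phi> j x)\<^sup>2 \<partial>law f) \<le> C * v * sqrt (real k)"
  using basis_constant L2_density alpha_moment assms by (simp add: basis_constant_def)

section \<open>Centered basis functions: strong variance, sup bound and weak variance\<close>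

definition \<xi> :: "nat \<Rightarrow> real \<Rightarrow> real" where "\<xi> j x = \<phi> j x - a j"

lemma \<xi>_measurable [measurable]: "\<xi> j \<in> borel_measurable borel"
  unfolding \<xi>_def by measurable

lemma variance_\<xi>: "(\<integral>x. (\<xi> j x)\<^sup>2 \<partial>law f) = (\<integral>x. (\<phi> j x)\<^sup>2 \<partial>law f) - (a j)\<^sup>2"
  and \<xi>_in_L2: "integrable (law f) (\<lambda>x. (\<xi> j x)\<^sup>2)"
  and expectation_\<xi>: "(\<integral>x. \<xi> j x \<partial>law f) = 0"
proof -
  have eq: "(\<xi> j x)\<^sup>2 = (\<phi> j x)\<^sup>2 - 2 * a j * \<phi> j x + (a j)\<^sup>2" for x
    by (simp add: \<xi>_def power2_diff)
  show "(\<integral>x. (\<xi> j x)\<^sup>2 \<partial>law f) = (\<integral>x. (\<phi> j x)\<^sup>2 \<partial>law f) - (a j)\<^sup>2"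
    unfolding eq using basis_in_L2_law[of j] basis_integrable_law[of j]
    by (simp add: expectation_basis law.prob_space power2_eq_square)
  show "integrable (law f) (\<lambda>x. (\<xi> j x)\<^sup>2)"
    unfolding eq using basis_in_L2_law[of j] basis_integrable_law[of j] by simp
  show "(\<integral>x. \<xi> j x \<partial>law f) = 0"
    unfolding \<xi>_def using basis_integrable_law[of j] by (simp add: expectation_basis law.prob_space)
qed

lemma \<xi>_variance_sum_le:
  assumes "1 \<le> k"
  shows "(\<Sum>j<k. \<integral>x. (\<xi> j x)\<^sup>2 \<partial>law f) \<le> C * v * sqrt (real k)"
proof -
  have "(\<Sum>j<k. \<integral>x. (\<xi> j x)\<^sup>2 \<partial>law f) \<le> (\<Sum>j<k. \<integral>x. (\<phi> j x)\<^sup>2 \<partial>law f)"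
    by (intro sum_mono) (simp add: variance_\<xi>)
  then show ?thesis using basis_energy_le[OF assms] by simp
qed

text \<open>The squared mean is at most the second moment, and the pointwise bound for the sum of
  squares passes to its expectation.\<close>

lemma a_square_sum_le:
  assumes "1 \<le> k"
  shows "(\<Sum>j<k. (a j)\<^sup>2) \<le> C * real k powr d"
proof -
  have "(a j)\<^sup>2 \<le> (\<integral>x. (\<phi> j x)\<^sup>2 \<partial>law f)" for j
  proof -
    have "0 \<le> (\<integral>x. (\<xi> j x)\<^sup>2 \<partial>law f)" by simp
    then show ?thesis using variance_\<xi>[of j] by simp
  qed
  then have "(\<Sum>j<k. (a j)\<^sup>2) \<le> (\<Sum>j<k. \<integral>x. (\<phi> j x)\<^sup>2 \<partial>law f)" by (rule sum_mono)
  also have "\<dots> = (\<integral>x. (\<Sum>j<k. (\<phi> j x)\<^sup>2) \<partial>law f)"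
    using basis_in_L2_law by (simp add: Bochner_Integration.integral_sum)
  also have "\<dots> \<le> (\<integral>x. C * real k powr d \<partial>law f)"
    using basis_in_L2_law basis_square_sum_le[OF assms]
    by (intro integral_mono Bochner_Integration.integrable_sum) auto
  finally show ?thesis by (simp add: law.prob_space)
qed

definition envelope :: "nat \<Rightarrow> real" where "envelope k = 4 * C * real k powr d"

lemma envelope_pos: "1 \<le> k \<Longrightarrow> 0 < envelope k"
  using C_ge_1 by (simp add: envelope_def)

lemma \<xi>_square_sum_le:
  assumes "1 \<le> k"
  shows "(\<Sum>j<k. (\<xi> j x)\<^sup>2) \<le> envelope k"
proof -
  have "(\<xi> j x)\<^sup>2 \<le> 2 * (\<phi> j x)\<^sup>2 + 2 * (a j)\<^sup>2" for j
    using sum_squares_bound[of "\<phi> j x" "- a j"] by (simp add: \<xi>_def power2_diff)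
  then have "(\<Sum>j<k. (\<xi> j x)\<^sup>2) \<le> (\<Sum>j<k. 2 * (\<phi> j x)\<^sup>2 + 2 * (a j)\<^sup>2)" by (intro sum_mono)
  also have "\<dots> = 2 * (\<Sum>j<k. (\<phi> j x)\<^sup>2) + 2 * (\<Sum>j<k. (a j)\<^sup>2)"
    by (simp add: sum.distrib sum_distrib_left)
  finally show ?thesis
    using basis_square_sum_le[OF assms, of x] a_square_sum_le[OF assms] by (simp add: envelope_def)
qed

text \<open>Here the sup norm of \<open>f\<close> enters: the second moment of a combination
  \<open>g\<close> of basis functions is the integral of its square against \<open>f\<close>, at
  most \<open>F\<close> times the squared L2 norm, which orthonormality evaluates. Centering only
  lowers it.\<close>

lemma weak_variance_le:
  "(\<integral>x. (\<Sum>j<k. u j * \<xi> j x)\<^sup>2 \<partial>law f) \<le> F * (\<Sum>j<k. (u j)\<^sup>2)"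
proof -
  define g where "g x = (\<Sum>j<k. u j * \<phi> j x)" for x
  define m where "m = (\<Sum>j<k. u j * a j)"
  have [measurable]: "g \<in> borel_measurable borel" unfolding g_def by measurable
  have gD: "in_L2 (dom_measure s) g"
    unfolding g_def by (rule orthonormal_in_L2_sum[OF basis_orthonormal])
  have gint: "integrable (law f) g"
    unfolding g_def using basis_integrable_law by simp
  have Eg: "(\<integral>x. g x \<partial>law f) = m"
    unfolding g_def m_def using basis_integrable_law
    by (subst Bochner_Integration.integral_sum) (auto simp: expectation_basis)
  have g2int: "integrable (law f) (\<lambda>x. (g x)\<^sup>2)"
  proof -
    have "\<bar>(g x)\<^sup>2\<bar> \<le> (\<Sum>j<k. (u j)\<^sup>2) * (\<Sum>j<k. C * real (Suc j) powr d)" for x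
    proof -
      have "(g x)\<^sup>2 \<le> (\<Sum>j<k. (u j)\<^sup>2) * (\<Sum>j<k. (\<phi> j x)\<^sup>2)"
        unfolding g_def by (rule Cauchy_Schwarz_ineq_sum)
      also have "\<dots> \<le> (\<Sum>j<k. (u j)\<^sup>2) * (\<Sum>j<k. C * real (Suc j) powr d)"
        by (intro mult_left_mono sum_mono basis_square_bound sum_nonneg) simp
      finally show ?thesis by simp
    qed
    then show ?thesis
      by (intro law.integrable_const_bound[where B = "(\<Sum>j<k. (u j)\<^sup>2) * (\<Sum>j<k. C * real (Suc j) powr d)"]) auto
  qed
  have "(\<Sum>j<k. u j * \<xi> j x) = g x - m" for x
    by (simp add: g_def m_def \<xi>_def right_diff_distrib sum_subtractf)
  moreover have "(g x - m)\<^sup>2 = (g x)\<^sup>2 - 2 * m * g x + m\<^sup>2" for x by (simp add: power2_diff)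
  ultimately have "(\<integral>x. (\<Sum>j<k. u j * \<xi> j x)\<^sup>2 \<partial>law f) = (\<integral>x. (g x)\<^sup>2 - 2 * m * g x + m\<^sup>2 \<partial>law f)"
    by (simp only:)
  also have "\<dots> = (\<integral>x. (g x)\<^sup>2 \<partial>law f) - m\<^sup>2"
    using gint g2int by (simp add: Eg law.prob_space power2_eq_square)
  also have "\<dots> \<le> (\<integral>x. (g x)\<^sup>2 \<partial>law f)" by simp
  also have "\<dots> = (\<integral>x. (g x)\<^sup>2 * f x \<partial>dom_measure s)" by (rule expectation_law) simp
  also have "\<dots> \<le> (\<integral>x. F * (g x)\<^sup>2 \<partial>dom_measure s)"
  proof (rule integral_mono_AE')
    show "integrable (dom_measure s) (\<lambda>x. F * (g x)\<^sup>2)"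
      using in_L2_square[OF gD] by simp
    show "AE x in dom_measure s. (g x)\<^sup>2 * f x \<le> F * (g x)\<^sup>2"
      using f_le_F by (auto simp: mult.commute[of F] intro!: mult_left_mono)
    show "AE x in dom_measure s. 0 \<le> F * (g x)\<^sup>2" using F_pos by simp
  qed
  also have "\<dots> = F * (\<Sum>j<k. (u j)\<^sup>2)"
    using orthonormal_norm_sum[OF basis_orthonormal[of s], of "{..<k}" u] by (simp add: g_def)
  finally show ?thesis .
qed

lemma bounded_centered:
  assumes "1 \<le> k"
  shows "bounded_centered_system (law f) \<xi> k (sqrt (envelope k)) (C * v * sqrt (real k)) F"
proof (unfold_locales)
  show "0 < C * v * sqrt (real k)" using C_ge_1 v_ge_1 assms by simp
  show "law.expectation (\<lambda>x. \<Sum>j<k. (\<xi> j x)\<^sup>2) \<le> C * v * sqrt (real k)"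
    using \<xi>_variance_sum_le[OF assms] \<xi>_in_L2 by simp
qed (use \<xi>_square_sum_le[OF assms] envelope_pos[OF assms] expectation_\<xi> F_pos weak_variance_le in \<open>auto simp: less_imp_le\<close>)

section \<open>Stochastic error of the empirical coefficients\<close>

definition noise :: "nat \<Rightarrow> nat \<Rightarrow> (nat \<Rightarrow> real) \<Rightarrow> real" where
  "noise n k X = (\<Sum>j<k. (coeff_hat s n X j - a j)\<^sup>2)"

lemma noise_eq:
  assumes "1 \<le> n"
  shows "noise n k X = (\<Sum>j<k. (\<Sum>i=1..n. \<xi> j (X i))\<^sup>2) / (real n)\<^sup>2"
proof -
  have "coeff_hat s n X j - a j = (\<Sum>i=1..n. \<xi> j (X i)) / real n" for j
    using assms by (simp add: coeff_hat_def \<xi>_def sum_subtractf diff_divide_distrib)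
  then show ?thesis by (simp only: noise_def power_divide sum_divide_distrib[where A = "{..<k}"])
qed

lemma noise_nonneg: "0 \<le> noise n k X" by (simp add: noise_def sum_nonneg)

lemma noise_mono: "k \<le> l \<Longrightarrow> noise n k X \<le> noise n l X"
  unfolding noise_def by (intro sum_mono2) auto

text \<open>A bound for every sample point, to be multiplied with the probability that the
  concentration fails.\<close>

lemma noise_le:
  assumes "1 \<le> n" "1 \<le> k"
  shows "noise n k X \<le> envelope k"
proof -
  have "(\<Sum>j<k. (\<Sum>i=1..n. \<xi> j (X i))\<^sup>2) \<le> (\<Sum>j<k. real n * (\<Sum>i=1..n. (\<xi> j (X i))\<^sup>2))"
    by (intro sum_mono power2_mean_le_mean_power2)
  also have "\<dots> = real n * (\<Sum>i=1..n. \<Sum>j<k. (\<xi> j (X i))\<^sup>2)"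
    by (subst sum.swap) (simp add: sum_distrib_left)
  also have "\<dots> \<le> real n * (\<Sum>i=1..n. envelope k)"
    by (intro mult_left_mono sum_mono \<xi>_square_sum_le assms) simp
  also have "\<dots> = envelope k * (real n)\<^sup>2" by (simp add: power2_eq_square)
  finally show ?thesis using assms unfolding noise_eq[OF assms(1)] by (simp add: divide_le_eq)
qed

lemma noise_expectation:
  assumes "1 \<le> n" "1 \<le> k"
  shows "(\<integral>\<^sup>+X. ennreal (noise n k X) \<partial>sample_law f n) \<le> ennreal (C * v * sqrt (real k) / real n)"
proof -
  have m: "(\<lambda>X. ennreal (\<Sum>j<k. (\<Sum>i=1..n. \<xi> j (X i))\<^sup>2)) \<in> borel_measurable (Pi\<^sub>M {1..n} (\<lambda>_. law f))"
    by (intro measurable_compose[OF _ measurable_ennreal] borel_measurable_sum[of "{..<k}"]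
        borel_measurable_power sample_sum_measurable) simp
  have "(\<integral>\<^sup>+X. ennreal (noise n k X) \<partial>sample_law f n) =
      (\<integral>\<^sup>+X. ennreal (1 / (real n)\<^sup>2) * ennreal (\<Sum>j<k. (\<Sum>i=1..n. \<xi> j (X i))\<^sup>2) \<partial>Pi\<^sub>M {1..n} (\<lambda>_. law f))"
    unfolding sample_law_def noise_eq[OF assms(1)]
    by (intro nn_integral_cong) (simp add: ennreal_mult[symmetric] sum_nonneg)
  also have "\<dots> = ennreal (1 / (real n)\<^sup>2) * ennreal (real n * (\<Sum>j<k. \<integral>x. (\<xi> j x)\<^sup>2 \<partial>law f))"
    unfolding nn_integral_cmult[OF m]
    by (subst sample_sum_moment2[OF law.prob_space_axioms])
       (auto simp: \<xi>_in_L2 expectation_\<xi>)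
  also have "\<dots> \<le> ennreal (1 / (real n)\<^sup>2) * ennreal (real n * (C * v * sqrt (real k)))"
    by (intro mult_left_mono ennreal_leI \<xi>_variance_sum_le assms) auto
  also have "\<dots> = ennreal (C * v * sqrt (real k) / real n)"
    using C_ge_1 v_ge_1 assms by (simp add: ennreal_mult[symmetric] power2_eq_square)
  finally show ?thesis .
qed

lemma noise_tail:
  assumes "1 \<le> n" "1 \<le> k"
  defines "H \<equiv> C * v * sqrt (real k)"
  shows "(\<integral>\<^sup>+X. indicator {X. 16 * H / real n < noise n k X} X \<partial>sample_law f n)
    \<le> ennreal (exp (- (9 * H / (32 * F)))
      + exp (- (9 * real n * H / (8 * sqrt (envelope k) * sqrt (real n * H) + envelope k))))"
proof -
  have "16 * H / real n < noise n k X \<longleftrightarrow> 16 * real n * H < (\<Sum>j<k. (\<Sum>i=1..n. \<xi> j (X i))\<^sup>2)" for X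
    using assms(1) unfolding noise_eq[OF assms(1)] by (simp add: field_simps power2_eq_square)
  then have "(\<integral>\<^sup>+X. indicator {X. 16 * H / real n < noise n k X} X \<partial>sample_law f n) =
      (\<integral>\<^sup>+X. indicator {X. 16 * real n * H < (\<Sum>j<k. (\<Sum>i=1..n. \<xi> j (X i))\<^sup>2)} X \<partial>Pi\<^sub>M {1..n} (\<lambda>_. law f))"
    by (simp add: sample_law_def)
  also have "\<dots> \<le> ennreal (exp (- (9 * H / (32 * F)))
      + exp (- (9 * real n * H / (8 * sqrt (envelope k) * sqrt (real n * H) + (sqrt (envelope k))\<^sup>2))))"
    unfolding H_def by (rule bounded_centered_system.sum_tail[OF bounded_centered[OF assms(2)] assms(1)])
  finally show ?thesis using envelope_pos[OF assms(2)] by simp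
qed

section \<open>The estimate of \<open>v\<close>\<close>

lemma v_hat_deviation:
  assumes "1 \<le> n"
  shows "(\<integral>\<^sup>+X. ennreal ((v_hat s n X - v)\<^sup>2) \<partial>sample_law f n) \<le> ennreal (moment2 / real n)"
proof -
  define \<eta> where "\<eta> x = \<bar>x\<bar> powr alpha_of s - (v - 1)" for x :: real
  have [measurable]: "\<eta> \<in> borel_measurable borel" unfolding \<eta>_def by measurable
  have mean: "(\<integral>x. \<bar>x\<bar> powr alpha_of s \<partial>law f) = v - 1" by (simp add: v_of_def)
  have eq: "(\<eta> x)\<^sup>2 = \<bar>x\<bar> powr (2 * alpha_of s) - 2 * (v - 1) * \<bar>x\<bar> powr alpha_of s + (v - 1)\<^sup>2" for x
    unfolding \<eta>_def power2_diff powr_alpha_square by simp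
  have int: "integrable (law f) (\<lambda>x. (\<eta> x)\<^sup>2)"
    unfolding eq using moment alpha_moment by simp
  have zero: "(\<integral>x. \<eta> x \<partial>law f) = 0"
    unfolding \<eta>_def using alpha_moment by (simp add: mean law.prob_space)
  have var: "(\<integral>x. (\<eta> x)\<^sup>2 \<partial>law f) \<le> moment2"
  proof -
    have "(\<integral>x. (\<eta> x)\<^sup>2 \<partial>law f) = moment2 - 2 * (v - 1) * (v - 1) + (v - 1)\<^sup>2"
      unfolding eq using moment alpha_moment by (simp add: mean moment2_def)
    also have "\<dots> = moment2 - (v - 1)\<^sup>2" by (simp add: power2_eq_square algebra_simps)
    also have "\<dots> \<le> moment2" by simp
    finally show ?thesis .
  qed
  have m: "(\<lambda>X. ennreal ((\<Sum>i=1..n. \<eta> (X i))\<^sup>2)) \<in> borel_measurable (Pi\<^sub>M {1..n} (\<lambda>_. law f))"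
    by (intro measurable_compose[OF _ measurable_ennreal] borel_measurable_power sample_sum_measurable) simp
  have "v_hat s n X - v = (\<Sum>i=1..n. \<eta> (X i)) / real n" for X
    using assms by (simp add: v_hat_def \<eta>_def sum_subtractf diff_divide_distrib)
  then have "(\<integral>\<^sup>+X. ennreal ((v_hat s n X - v)\<^sup>2) \<partial>sample_law f n) =
      (\<integral>\<^sup>+X. ennreal (1 / (real n)\<^sup>2) * ennreal ((\<Sum>i=1..n. \<eta> (X i))\<^sup>2) \<partial>Pi\<^sub>M {1..n} (\<lambda>_. law f))"
    unfolding sample_law_def
    by (intro nn_integral_cong) (simp add: ennreal_mult[symmetric] power_divide)
  also have "\<dots> = ennreal (1 / (real n)\<^sup>2) * ennreal (real n * (\<integral>x. (\<eta> x)\<^sup>2 \<partial>law f))"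
    unfolding nn_integral_cmult[OF m]
    using sample_sum_moment2[OF law.prob_space_axioms, of 1 "\<lambda>_. \<eta>" n] int zero by simp
  also have "\<dots> \<le> ennreal (1 / (real n)\<^sup>2) * ennreal (real n * moment2)"
    by (intro mult_left_mono ennreal_leI var) auto
  also have "\<dots> = ennreal (moment2 / real n)"
    using moment2_nonneg assms by (simp add: ennreal_mult[symmetric] power2_eq_square)
  finally show ?thesis .
qed

lemma v_hat_measurable: "v_hat s n \<in> borel_measurable (sample_law f n)"
  unfolding v_hat_def[abs_def] sample_law_def
  by (intro borel_measurable_add borel_measurable_divide borel_measurable_const sample_sum_measurable) simp

lemma v_hat_ge_1: "1 \<le> v_hat s n X"
  by (simp add: v_hat_def sum_nonneg)

lemma prob_space_sample: "prob_space (sample_law f n)"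
  unfolding sample_law_def by (rule prob_space_PiM_const[OF law.prob_space_axioms])

lemma v_hat_expectation:
  assumes "1 \<le> n"
  shows "(\<integral>\<^sup>+X. ennreal (v_hat s n X) \<partial>sample_law f n) \<le> ennreal (v + 1 + moment2)"
proof -
  have "y \<le> 1 + y\<^sup>2" for y :: real
    using sum_squares_bound[of 1 y] zero_le_power2[of y] unfolding one_power2 by linarith
  from add_left_mono[OF this, of v]
  have "v_hat s n X \<le> (v + 1) + (v_hat s n X - v)\<^sup>2" for X
    by (metis add.assoc add.commute diff_add_cancel)
  then have "(\<integral>\<^sup>+X. ennreal (v_hat s n X) \<partial>sample_law f n) \<le>
      (\<integral>\<^sup>+X. ennreal (v + 1) + ennreal ((v_hat s n X - v)\<^sup>2) \<partial>sample_law f n)"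
  proof (intro nn_integral_mono)
    fix X
    have "ennreal (v_hat s n X) \<le> ennreal ((v + 1) + (v_hat s n X - v)\<^sup>2)" by (rule ennreal_leI) fact
    also have "\<dots> = ennreal (v + 1) + ennreal ((v_hat s n X - v)\<^sup>2)"
      using v_ge_1 by (intro ennreal_plus) simp_all
    finally show "ennreal (v_hat s n X) \<le> ennreal (v + 1) + ennreal ((v_hat s n X - v)\<^sup>2)" .
  qed
  also have "\<dots> = ennreal (v + 1) + (\<integral>\<^sup>+X. ennreal ((v_hat s n X - v)\<^sup>2) \<partial>sample_law f n)"
    using v_hat_measurable[of n] prob_space.emeasure_space_1[OF prob_space_sample[of n]]
    by (subst nn_integral_add) auto
  also have "\<dots> \<le> ennreal (v + 1) + ennreal (moment2 / real n)"
    by (intro add_left_mono v_hat_deviation assms)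
  also have "\<dots> \<le> ennreal (v + 1) + ennreal moment2"
    using assms moment2_nonneg
    by (intro add_left_mono ennreal_leI) (simp add: divide_le_eq mult_le_cancel_left1)
  also have "\<dots> = ennreal (v + 1 + moment2)"
    using v_ge_1 moment2_nonneg by (simp add: ennreal_plus)
  finally show ?thesis .
qed

text \<open>Chebyshev's inequality; since \<open>v \<ge> 1\<close>, falling below
  \<open>v / 2\<close> is a deviation by more than 1 / 2.\<close>

lemma v_hat_small:
  assumes "1 \<le> n"
  shows "(\<integral>\<^sup>+X. indicator {X. v_hat s n X < v / 2} X \<partial>sample_law f n) \<le> ennreal (4 * moment2 / real n)"
proof -
  have le: "indicator {X. v_hat s n X < v / 2} X \<le> ennreal 4 * ennreal ((v_hat s n X - v)\<^sup>2)" for X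
  proof (cases "v_hat s n X < v / 2")
    case True
    have "1 \<le> 2 * (v - v_hat s n X)" using True v_ge_1 by simp
    then have "1\<^sup>2 \<le> (2 * (v - v_hat s n X))\<^sup>2" by (rule power_mono) simp
    also have "(2 * (v - v_hat s n X))\<^sup>2 = 4 * (v_hat s n X - v)\<^sup>2"
      by (simp add: power2_eq_square algebra_simps)
    finally have "1 \<le> 4 * (v_hat s n X - v)\<^sup>2" by simp
    then have "ennreal 1 \<le> ennreal (4 * (v_hat s n X - v)\<^sup>2)" by (rule ennreal_leI)
    then show ?thesis using True by (simp add: ennreal_mult)
  qed simp
  have "(\<integral>\<^sup>+X. indicator {X. v_hat s n X < v / 2} X \<partial>sample_law f n) \<le>
      (\<integral>\<^sup>+X. ennreal 4 * ennreal ((v_hat s n X - v)\<^sup>2) \<partial>sample_law f n)"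
    by (rule nn_integral_mono[OF le])
  also have "\<dots> = ennreal 4 * (\<integral>\<^sup>+X. ennreal ((v_hat s n X - v)\<^sup>2) \<partial>sample_law f n)"
    using v_hat_measurable[of n] by (intro nn_integral_cmult) auto
  also have "\<dots> \<le> ennreal 4 * ennreal (moment2 / real n)"
    by (intro mult_left_mono v_hat_deviation assms) simp
  also have "\<dots> = ennreal (4 * moment2 / real n)"
    using moment2_nonneg by (subst ennreal_mult[symmetric]) auto
  finally show ?thesis .
qed

end

section \<open>Oracle rates and weights\<close>

lemma summable_mult_exp_sqrt:
  fixes c :: real
  assumes "0 < c"
  shows "summable (\<lambda>k. real k * exp (- (c * sqrt (real k))))"
proof (rule summable_comparison_test')
  show "summable (\<lambda>k. fact 6 / c ^ 6 * inverse (real k ^ 2))"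
    by (intro summable_mult inverse_power_summable) simp
  fix k :: nat assume "1 \<le> k"
  then have k: "0 < real k" by simp
  \<comment> \<open>The sixth power of \<open>sqrt k\<close> is the cube of \<open>k\<close>; after
    the factor \<open>k\<close> an inverse square remains.\<close>
  have "(c * sqrt (real k)) ^ 6 \<le> fact 6 * exp (c * sqrt (real k))"
    using assms by (intro power_le_exp) simp
  also have "(c * sqrt (real k)) ^ 6 = c ^ 6 * real k ^ 3"
  proof -
    have "sqrt (real k) ^ 6 = (sqrt (real k) ^ 2) ^ 3" by (simp only: power_mult[symmetric]) simp
    then show ?thesis by (simp add: power_mult_distrib)
  qed
  finally have "c ^ 6 * real k ^ 3 * exp (- (c * sqrt (real k))) \<le> fact 6"
    by (simp add: exp_minus field_simps)
  then have "real k * exp (- (c * sqrt (real k))) * (c ^ 6 * real k ^ 2) \<le> fact 6"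
    by (simp add: power2_eq_square power3_eq_cube mult_ac)
  then have "real k * exp (- (c * sqrt (real k))) \<le> fact 6 / (c ^ 6 * real k ^ 2)"
    using k assms by (subst pos_le_divide_eq) auto
  then show "norm (real k * exp (- (c * sqrt (real k)))) \<le> fact 6 / c ^ 6 * inverse (real k ^ 2)"
    using k by (simp add: field_simps)
qed

definition exp_sqrt_series :: "real \<Rightarrow> real" where
  "exp_sqrt_series c = (\<Sum>k. real k * exp (- (c * sqrt (real k))))"

lemma sum_le_exp_sqrt_series:
  "0 < c \<Longrightarrow> finite K \<Longrightarrow> (\<Sum>k\<in>K. real k * exp (- (c * sqrt (real k)))) \<le> exp_sqrt_series c"
  unfolding exp_sqrt_series_def by (intro sum_le_suminf summable_mult_exp_sqrt) auto

lemma exp_sqrt_series_nonneg: "0 < c \<Longrightarrow> 0 \<le> exp_sqrt_series c"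
  using sum_le_exp_sqrt_series[of c "{}"] by simp

text \<open>The difference of the two sides is the variance of \<open>g\<close> under the weights,
  hence nonnegative.\<close>

lemma convex_combination_square:
  fixes w g :: "nat \<Rightarrow> real"
  assumes "\<And>k. k \<in> K \<Longrightarrow> 0 \<le> w k" "(\<Sum>k\<in>K. w k) = 1"
  shows "((\<Sum>k\<in>K. w k * g k) - y)\<^sup>2 \<le> (\<Sum>k\<in>K. w k * (g k - y)\<^sup>2)"
proof -
  define m where "m = (\<Sum>k\<in>K. w k * g k)"
  have "0 \<le> (\<Sum>k\<in>K. w k * (g k - m)\<^sup>2)" using assms(1) by (intro sum_nonneg) simp
  also have "\<dots> = (\<Sum>k\<in>K. w k * (g k - y)\<^sup>2 + 2 * (y - m) * (w k * g k) + (m\<^sup>2 - y\<^sup>2) * w k)"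
    by (intro sum.cong refl) (simp add: power2_eq_square algebra_simps)
  also have "\<dots> = (\<Sum>k\<in>K. w k * (g k - y)\<^sup>2) + 2 * (y - m) * m + (m\<^sup>2 - y\<^sup>2)"
    by (simp only: sum.distrib sum_distrib_left[symmetric] assms(2) m_def[symmetric] mult_1_right)
  also have "\<dots> = (\<Sum>k\<in>K. w k * (g k - y)\<^sup>2) - (m - y)\<^sup>2"
    by (simp add: power2_eq_square algebra_simps)
  finally show ?thesis by (simp add: m_def)
qed

lemma max_dim_Laguerre_le:
  assumes "2 \<le> n" "k \<le> max_dim Laguerre n"
  shows "sqrt (real k) * (600 * ln (real n))\<^sup>2 \<le> real n"
proof -
  let ?L = "600 * ln (real n)"
  have L: "0 < ?L" using assms(1) by simp
  have "real k \<le> (real n)\<^sup>2 / ?L ^ 4"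
  proof -
    have "real k \<le> real (nat \<lfloor>(real n)\<^sup>2 / ?L ^ 4\<rfloor>)"
      using assms(2) by (simp only: max_dim.simps of_nat_le_iff)
    also have "\<dots> \<le> (real n)\<^sup>2 / ?L ^ 4" by (rule of_nat_floor) simp
    finally show ?thesis .
  qed
  then have "sqrt (real k) \<le> sqrt ((real n / ?L\<^sup>2)\<^sup>2)"
    by (intro real_sqrt_le_mono) (simp add: power_divide flip: power_mult)
  also have "\<dots> = real n / ?L\<^sup>2" by simp
  finally show ?thesis using L by (simp add: pos_le_divide_eq)
qed

lemma ln_ge_half: "2 \<le> n \<Longrightarrow> 1 / 2 \<le> ln (real n)"
proof -
  assume "2 \<le> n"
  then have "ln 2 \<le> ln (real n)" by simp
  then show ?thesis using ln2_ge_two_thirds by simp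
qed

lemma sqrt_max_dim_le:
  assumes "1 \<le> n" "1 \<le> max_dim s n"
  shows "sqrt (real (max_dim s n)) \<le> real n"
proof (cases s)
  case Laguerre
  \<comment> \<open>For \<open>n = 1\<close> the logarithm is 0 and the division by 0 makes
    \<open>max_dim\<close> equal to 0.\<close>
  have "n \<noteq> 1" using assms(2) by (auto simp: Laguerre)
  then have n: "2 \<le> n" using assms(1) by simp
  have "1\<^sup>2 \<le> (600 * ln (real n))\<^sup>2" using ln_ge_half[OF n] by (intro power_mono) auto
  then have "sqrt (real (max_dim s n)) * 1 \<le> sqrt (real (max_dim s n)) * (600 * ln (real n))\<^sup>2"
    by (intro mult_left_mono) auto
  then show ?thesis using max_dim_Laguerre_le[OF n, of "max_dim s n"] by (simp add: Laguerre)
next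
  case Hermite
  then show ?thesis by simp
qed

lemma d_of_le_1: "d_of s \<le> 1" by (cases s) auto

text \<open>Up to the factors \<open>C\<close> and \<open>v\<close>, both conditions compare the
  envelope with \<open>n * H\<close>. They bring the second exponential of the noise tail below
  \<open>1 / n ^ 5\<close> and are the reason for the size of \<open>max_dim\<close>.\<close>

lemma eventually_envelope_small:
  "\<forall>\<^sub>F n in sequentially. \<forall>k\<in>{1..max_dim s n}.
    4 * real k powr d_of s \<le> real n * sqrt (real k) \<and>
    4 * real k powr d_of s * (5 * ln (real n))\<^sup>2 \<le> real n * sqrt (real k)"
proof (cases s)
  case Laguerre
  show ?thesis
    using eventually_ge_at_top[of 2]
  proof eventually_elim
    case (elim n)
    show ?case
    proof
      fix k assume k: "k \<in> {1..max_dim s n}"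
      define r where "r = sqrt (real k)"
      let ?r = r and ?l = "ln (real n)"
      have r: "0 \<le> ?r" "real k powr d_of s = ?r * ?r" using k by (auto simp: Laguerre r_def)
      have le: "?r * (600 * ?l)\<^sup>2 \<le> real n"
        unfolding r_def using k elim by (intro max_dim_Laguerre_le) (auto simp: Laguerre)
      have "(1 / 2)\<^sup>2 \<le> ?l\<^sup>2" using ln_ge_half[OF elim] by (intro power_mono) auto
      then have l: "1 / 4 \<le> ?l\<^sup>2" by (simp add: power2_eq_square)
      have "4 * ?r \<le> ?r * (600 * ?l)\<^sup>2"
        using l mult_left_mono[of 4 "(600 * ?l)\<^sup>2" ?r] r(1) by (simp add: power_mult_distrib)
      then have "4 * ?r \<le> real n" using le by simp
      then have "4 * ?r * ?r \<le> real n * ?r" using r(1) by (rule mult_right_mono)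
      moreover have "4 * ?r * (5 * ?l)\<^sup>2 \<le> ?r * (600 * ?l)\<^sup>2"
        using r(1) by (simp add: power_mult_distrib)
      then have "4 * ?r * (5 * ?l)\<^sup>2 * ?r \<le> real n * ?r"
        using r(1) le by (intro mult_right_mono) auto
      ultimately show "4 * real k powr d_of s \<le> real n * sqrt (real k) \<and>
          4 * real k powr d_of s * (5 * ?l)\<^sup>2 \<le> real n * sqrt (real k)"
        unfolding r(2) r_def[symmetric] by (simp only: mult_ac)
    qed
  qed
next
  case Hermite
  have "\<forall>\<^sub>F n :: nat in sequentially. 4 * real n powr (2 / 3) \<le> real n" by real_asymp
  moreover have "\<forall>\<^sub>F n :: nat in sequentially. 4 * real n powr (2 / 3) * (5 * ln (real n))\<^sup>2 \<le> real n" by real_asymp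
  ultimately show ?thesis
  proof eventually_elim
    case (elim n)
    show ?case
    proof
      fix k assume k: "k \<in> {1..max_dim s n}"
      let ?r = "sqrt (real k)" and ?l = "ln (real n)"
      \<comment> \<open>The exponent 10 / 12 is split so that \<open>sqrt k\<close> cancels against
        the right-hand side; what is left is at most \<open>n powr (2 / 3)\<close>.\<close>
      have "real k powr d_of s = real k powr (1 / 3 + 1 / 2)" by (simp add: Hermite)
      also have "\<dots> = real k powr (1 / 3) * ?r" using k by (simp only: powr_add) (simp add: powr_half_sqrt)
      finally have r: "real k powr d_of s = real k powr (1 / 3) * ?r" .
      have "real k \<le> (real n)\<^sup>2" using k by (simp add: Hermite flip: of_nat_power)
      then have "real k powr (1 / 3) \<le> ((real n)\<^sup>2) powr (1 / 3)" by (intro powr_mono2) auto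
      also have "\<dots> = real n powr (2 / 3)"
      proof (cases "n = 0")
        case False
        then have "(real n)\<^sup>2 = real n powr 2" by simp
        then show ?thesis by (simp only: powr_powr) simp
      qed simp
      finally have p: "real k powr (1 / 3) \<le> real n powr (2 / 3)" .
      have "4 * real k powr (1 / 3) \<le> real n" using p elim(1) by simp
      then have "4 * real k powr (1 / 3) * ?r \<le> real n * ?r" by (rule mult_right_mono) simp
      moreover have "4 * real k powr (1 / 3) * (5 * ?l)\<^sup>2 \<le> 4 * real n powr (2 / 3) * (5 * ?l)\<^sup>2"
        using p by (intro mult_right_mono) auto
      then have "4 * real k powr (1 / 3) * (5 * ?l)\<^sup>2 * ?r \<le> real n * ?r"
        using elim(2) by (intro mult_right_mono) auto
      ultimately show "4 * real k powr d_of s \<le> real n * ?r \<and>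
          4 * real k powr d_of s * (5 * ?l)\<^sup>2 \<le> real n * ?r"
        unfolding r by (simp only: mult_ac)
    qed
  qed
qed

context density_model
begin

section \<open>Oracle rate and oracle dimension\<close>

lemma rate_eq: "rate s f n k = max (tail_energy k / energy) (sqrt (real k) / real n)"
  by (simp add: rate_def bias_square)

lemma rate_nonneg: "0 \<le> rate s f n k"
  by (simp add: rate_def le_max_iff_disj)

lemma oracle_rate_le: "1 \<le> k \<Longrightarrow> oracle_rate s f n \<le> rate s f n k"
  unfolding oracle_rate_def by (rule cINF_lower) (auto intro!: bdd_belowI2[of _ 0] rate_nonneg)

lemma oracle_dim_attains:
  assumes "1 \<le> n"
  shows "1 \<le> oracle_dim s f n" and "rate s f n (oracle_dim s f n) = oracle_rate s f n"
proof -
  \<comment> \<open>Beyond \<open>K\<close> the term \<open>sqrt k / n\<close> alone exceeds the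
    rate at dimension 1, so the minimum over \<open>{1..K}\<close> is global.\<close>
  define K where "K = Suc (nat \<lceil>(real n * rate s f n 1)\<^sup>2\<rceil>)"
  obtain l where l: "l \<in> {1..K}" and min: "\<And>k. k \<in> {1..K} \<Longrightarrow> rate s f n l \<le> rate s f n k"
    using ex_is_arg_min_if_finite[of "{1..K}" "rate s f n"] by (auto simp: is_arg_min_linorder K_def)
  have all: "rate s f n l \<le> rate s f n k" if "1 \<le> k" for k
  proof (cases "k \<le> K")
    case True
    then show ?thesis using that by (intro min) simp
  next
    case False
    have "(real n * rate s f n 1)\<^sup>2 \<le> real (nat \<lceil>(real n * rate s f n 1)\<^sup>2\<rceil>)"
      by (rule real_nat_ceiling_ge)
    also have "\<dots> \<le> real k" using False by (simp add: K_def)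
    finally have "real n * rate s f n 1 \<le> sqrt (real k)" by (rule real_le_rsqrt)
    then have "rate s f n 1 \<le> sqrt (real k) / real n" using assms by (simp add: field_simps)
    also have "\<dots> \<le> rate s f n k" by (simp add: rate_def)
    finally show ?thesis using min[of 1] by (simp add: K_def)
  qed
  have "oracle_rate s f n = rate s f n l"
  proof (rule antisym)
    show "oracle_rate s f n \<le> rate s f n l" using l by (intro oracle_rate_le) simp
    show "rate s f n l \<le> oracle_rate s f n"
      unfolding oracle_rate_def by (rule cINF_greatest) (auto intro: all)
  qed
  then have "1 \<le> l \<and> rate s f n l = oracle_rate s f n" using l by simp
  then have "1 \<le> oracle_dim s f n \<and> rate s f n (oracle_dim s f n) = oracle_rate s f n"
    unfolding oracle_dim_def by (rule LeastI)
  then show "1 \<le> oracle_dim s f n" "rate s f n (oracle_dim s f n) = oracle_rate s f n" by blast+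
qed

lemma oracle_bias_le: "1 \<le> n \<Longrightarrow> tail_energy (oracle_dim s f n) \<le> energy * oracle_rate s f n"
  and oracle_dim_le_rate: "1 \<le> n \<Longrightarrow> sqrt (real (oracle_dim s f n)) / real n \<le> oracle_rate s f n"
proof -
  assume n: "1 \<le> n"
  have "tail_energy (oracle_dim s f n) / energy \<le> oracle_rate s f n"
    using oracle_dim_attains(2)[OF n] by (simp add: rate_eq max_def split: if_splits)
  then show "tail_energy (oracle_dim s f n) \<le> energy * oracle_rate s f n"
    using energy_pos by (simp add: pos_divide_le_eq mult.commute)
next
  assume n: "1 \<le> n"
  show "sqrt (real (oracle_dim s f n)) / real n \<le> oracle_rate s f n"
    using oracle_dim_attains(2)[OF n] by (simp add: rate_eq max_def split: if_splits)
qed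

text \<open>Every remainder of order 1 / n is absorbed into the oracle rate in this way.\<close>

lemma oracle_rate_ge: "1 \<le> n \<Longrightarrow> 1 / real n \<le> oracle_rate s f n"
proof -
  assume n: "1 \<le> n"
  have "1 / real n \<le> sqrt (real (oracle_dim s f n)) / real n"
    using oracle_dim_attains(1)[OF n] by (intro divide_right_mono) auto
  then show ?thesis using oracle_dim_le_rate[OF n] by simp
qed

text \<open>Below the least minimiser the rate exceeds its minimum, and this must be due to the bias
  because the other term is smaller than at the oracle. The resulting lower bound is uniform in
  \<open>k\<close>, which makes the exponentials in the bias summable.\<close>

lemma below_oracle_tail_energy:
  assumes n: "1 \<le> n" and k: "1 \<le> k" "k < oracle_dim s f n"
  shows "energy * sqrt (real (oracle_dim s f n)) / real n \<le> tail_energy k"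
proof -
  let ?k = "oracle_dim s f n"
  have "rate s f n k \<noteq> oracle_rate s f n"
    using not_less_Least[OF k(2)[unfolded oracle_dim_def]] k(1) by simp
  then have gt: "oracle_rate s f n < rate s f n k" using oracle_rate_le[OF k(1)] by (simp add: order_less_le)
  have "sqrt (real k) / real n \<le> sqrt (real ?k) / real n"
    using k by (intro divide_right_mono) auto
  also have "\<dots> \<le> oracle_rate s f n" by (rule oracle_dim_le_rate[OF n])
  finally have "oracle_rate s f n < tail_energy k / energy" using gt by (simp add: rate_eq max_def split: if_splits)
  then have "sqrt (real ?k) / real n \<le> tail_energy k / energy" using oracle_dim_le_rate[OF n] by simp
  then show ?thesis using energy_pos by (simp add: field_simps)
qed

lemma contrast_eq:
  "contrast s \<Delta> n X k = - (\<Sum>j<k. (coeff_hat s n X j)\<^sup>2) + \<Delta> * v_hat s n X / real n * sqrt (real k)"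
  using orthonormal_norm_sum[OF basis_orthonormal[of s], of "{..<k}" "coeff_hat s n X"]
  by (simp add: contrast_def norm_on_square pen_hat_def f_hat_def)

text \<open>The only property of the two weightings that the risk bound uses; the comparison
  dimension \<open>l\<close> will be the oracle dimension.\<close>

definition concentrated_weight :: "real \<Rightarrow> nat \<Rightarrow> ((nat \<Rightarrow> real) \<Rightarrow> nat \<Rightarrow> real) \<Rightarrow> bool" where
  "concentrated_weight \<Delta> n w \<longleftrightarrow> (\<forall>X. (\<forall>k\<in>{1..max_dim s n}. 0 \<le> w X k) \<and> (\<Sum>k=1..max_dim s n. w X k) = 1 \<and>
     (\<forall>k\<in>{1..max_dim s n}. \<forall>l\<in>{1..max_dim s n}.
        w X k \<le> exp (- (real n * (contrast s \<Delta> n X k - contrast s \<Delta> n X l)))))"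

lemma concentrated_bayes_weight:
  assumes "1 \<le> max_dim s n" "1 \<le> \<kappa>"
  shows "concentrated_weight \<Delta> n (bayes_weight s \<Delta> \<kappa> n)"
  unfolding concentrated_weight_def
proof (intro allI conjI ballI)
  fix X
  let ?M = "max_dim s n" and ?c = "contrast s \<Delta> n X"
  let ?e = "\<lambda>k. exp (- \<kappa> * real n * ?c k)"
  have pos: "0 < (\<Sum>l=1..?M. ?e l)" using assms(1) by (intro sum_pos) auto
  show nonneg: "0 \<le> bayes_weight s \<Delta> \<kappa> n X k" for k
    using pos by (simp add: bayes_weight_def)
  show one: "(\<Sum>k=1..?M. bayes_weight s \<Delta> \<kappa> n X k) = 1"
    using pos by (simp add: bayes_weight_def sum_divide_distrib[symmetric])
  fix k l assume k: "k \<in> {1..?M}" and l: "l \<in> {1..?M}"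
  show "bayes_weight s \<Delta> \<kappa> n X k \<le> exp (- (real n * (?c k - ?c l)))"
  proof (cases "?c l \<le> ?c k")
    case True
    \<comment> \<open>Of the normalising sum only the term at \<open>l\<close> is kept.\<close>
    have "?e l \<le> (\<Sum>l=1..?M. ?e l)" using l by (intro member_le_sum) auto
    then have "bayes_weight s \<Delta> \<kappa> n X k \<le> ?e k / ?e l"
      unfolding bayes_weight_def using pos by (intro divide_left_mono mult_pos_pos) simp_all
    also have "\<dots> = exp (- (\<kappa> * (real n * (?c k - ?c l))))"
      by (simp add: exp_diff[symmetric] algebra_simps)
    \<comment> \<open>As the excess is nonnegative in this case, \<open>\<kappa> \<ge> 1\<close> can
      only help.\<close>
    also have "\<dots> \<le> exp (- (real n * (?c k - ?c l)))"
      using mult_right_mono[OF assms(2), of "real n * (?c k - ?c l)"] True by simp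
    finally show ?thesis .
  next
    case False
    have "bayes_weight s \<Delta> \<kappa> n X k \<le> 1"
      using member_le_sum[OF k, of "bayes_weight s \<Delta> \<kappa> n X"] nonneg one by simp
    also have "1 \<le> exp (- (real n * (?c k - ?c l)))" using False by (simp add: mult_nonneg_nonpos)
    finally show ?thesis .
  qed
qed

lemma concentrated_selection_weight:
  assumes "1 \<le> max_dim s n"
  shows "concentrated_weight \<Delta> n (selection_weight s \<Delta> n)"
  unfolding concentrated_weight_def
proof (intro allI conjI ballI)
  fix X
  let ?M = "max_dim s n" and ?c = "contrast s \<Delta> n X"
  obtain m where "is_arg_min ?c (\<lambda>k. k \<in> {1..?M}) m"
    using ex_is_arg_min_if_finite[of "{1..?M}" ?c] assms by auto
  then have "m \<in> {1..?M} \<and> (\<forall>l\<in>{1..?M}. ?c m \<le> ?c l)"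
    by (auto simp: is_arg_min_linorder)
  then have kh: "k_hat s \<Delta> n X \<in> {1..?M} \<and> (\<forall>l\<in>{1..?M}. ?c (k_hat s \<Delta> n X) \<le> ?c l)"
    unfolding k_hat_def by (rule LeastI)
  show "0 \<le> selection_weight s \<Delta> n X k" for k by (simp add: selection_weight_def)
  show "(\<Sum>k=1..?M. selection_weight s \<Delta> n X k) = 1"
    using kh by (simp add: selection_weight_def)
  fix k l assume "k \<in> {1..?M}" and l: "l \<in> {1..?M}"
  \<comment> \<open>Only the minimiser has positive weight, and there the exponent is
    nonnegative.\<close>
  show "selection_weight s \<Delta> n X k \<le> exp (- (real n * (?c k - ?c l)))"
    using kh l by (auto simp: selection_weight_def mult_nonneg_nonpos)
qed

lemma loss_le:
  assumes w: "concentrated_weight \<Delta> n w"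
  shows "(norm_on (domain_of s) (\<lambda>x. aggregate s n w X x - f x))\<^sup>2
    \<le> (\<Sum>k=1..max_dim s n. w X k * (noise n k X + tail_energy k))"
proof -
  let ?M = "max_dim s n" and ?D = "dom_measure s"
  have w0: "\<And>k. k \<in> {1..?M} \<Longrightarrow> 0 \<le> w X k" and w1: "(\<Sum>k=1..?M. w X k) = 1"
    using w by (auto simp: concentrated_weight_def)
  have sq: "in_L2 ?D (\<lambda>x. f_hat s n X k x - f x)" for k
    unfolding f_hat_def
    by (intro in_L2_diff orthonormal_in_L2_sum[OF basis_orthonormal] f_in_L2)
  have "(norm_on (domain_of s) (\<lambda>x. aggregate s n w X x - f x))\<^sup>2 = (\<integral>x. (aggregate s n w X x - f x)\<^sup>2 \<partial>?D)"
    by (rule norm_on_square)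
  also have "\<dots> \<le> (\<integral>x. (\<Sum>k=1..?M. w X k * (f_hat s n X k x - f x)\<^sup>2) \<partial>?D)"
  proof (rule integral_mono_AE')
    show "integrable ?D (\<lambda>x. \<Sum>k=1..?M. w X k * (f_hat s n X k x - f x)\<^sup>2)"
      using in_L2_square[OF sq] by (intro Bochner_Integration.integrable_sum integrable_mult_right)
    show "AE x in ?D. (aggregate s n w X x - f x)\<^sup>2 \<le> (\<Sum>k=1..?M. w X k * (f_hat s n X k x - f x)\<^sup>2)"
      unfolding aggregate_def by (intro AE_I2 convex_combination_square w0 w1)
    show "AE x in ?D. 0 \<le> (\<Sum>k=1..?M. w X k * (f_hat s n X k x - f x)\<^sup>2)"
      using w0 by (intro AE_I2 sum_nonneg) simp
  qed
  also have "\<dots> = (\<Sum>k=1..?M. w X k * (\<integral>x. (f_hat s n X k x - f x)\<^sup>2 \<partial>?D))"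
    using in_L2_square[OF sq] by (subst Bochner_Integration.integral_sum) auto
  also have "\<dots> = (\<Sum>k=1..?M. w X k * (noise n k X + tail_energy k))"
  proof (intro sum.cong refl arg_cong2[where f = "(*)"])
    fix k
    show "(\<integral>x. (f_hat s n X k x - f x)\<^sup>2 \<partial>?D) = noise n k X + tail_energy k"
      using orthonormal_norm_diff[OF basis_orthonormal f_in_L2, of "{..<k}" "coeff_hat s n X"]
      by (simp add: f_hat_def noise_def a_eq[symmetric] tail_energy_eq energy_def norm_on_square)
  qed
  finally show ?thesis .
qed

text \<open>For the finitely many \<open>n\<close> to which the asymptotic assumptions do not
  apply.\<close>

lemma crude_risk_le:
  assumes w: "concentrated_weight \<Delta> n w" and n: "1 \<le> n" and M: "1 \<le> max_dim s n"
  shows "risk s f n w \<le> ennreal (envelope (max_dim s n) + energy)"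
proof -
  let ?M = "max_dim s n"
  have "risk s f n w \<le> (\<integral>\<^sup>+X. ennreal (envelope ?M + energy) \<partial>sample_law f n)"
    unfolding risk_def
  proof (intro nn_integral_mono ennreal_leI)
    fix X
    have "(\<Sum>k=1..?M. w X k * (noise n k X + tail_energy k)) \<le> (\<Sum>k=1..?M. w X k * (envelope ?M + energy))"
    proof (intro sum_mono mult_left_mono add_mono tail_energy_le)
      fix k assume "k \<in> {1..?M}"
      then show "noise n k X \<le> envelope ?M"
        using noise_mono[of k ?M n X] noise_le[OF n M, of X] by simp
      show "0 \<le> w X k" using w \<open>k \<in> {1..?M}\<close> by (simp add: concentrated_weight_def)
    qed
    also have "\<dots> = envelope ?M + energy"
      using w by (simp add: concentrated_weight_def sum_distrib_right[symmetric])
    finally show "(norm_on (domain_of s) (\<lambda>x. aggregate s n w X x - f x))\<^sup>2 \<le> envelope ?M + energy"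
      using loss_le[OF w, of X] by simp
  qed
  also have "\<dots> = ennreal (envelope ?M + energy)"
    using prob_space.emeasure_space_1[OF prob_space_sample[of n]] by simp
  finally show ?thesis .
qed

end

text \<open>The sets are not intersected with the space of \<open>M\<close>, so measurability is
  claimed for the indicator as a function.\<close>

lemma indicator_less_measurable:
  fixes t :: real
  assumes [measurable]: "g \<in> borel_measurable M"
  shows "(\<lambda>x. indicator {x. t < g x} x :: ennreal) \<in> borel_measurable M"
    and "(\<lambda>x. indicator {x. g x < t} x :: ennreal) \<in> borel_measurable M"
proof -
  have "(\<lambda>x. if t < g x then 1 else 0 :: ennreal) \<in> borel_measurable M"
    "(\<lambda>x. if g x < t then 1 else 0 :: ennreal) \<in> borel_measurable M"
    by measurable
  then show "(\<lambda>x. indicator {x. t < g x} x :: ennreal) \<in> borel_measurable M"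
    "(\<lambda>x. indicator {x. g x < t} x :: ennreal) \<in> borel_measurable M"
    by (simp_all add: indicator_def of_bool_def)
qed

lemma nn_integral_affine_combination:
  fixes g h J' :: "'a \<Rightarrow> ennreal"
  assumes M: "prob_space M"
    and [measurable]: "g \<in> borel_measurable M" "h \<in> borel_measurable M"
      "\<And>k. J k \<in> borel_measurable M" "J' \<in> borel_measurable M"
  shows "(\<integral>\<^sup>+x. c0 + c1 * g x + c2 * h x + (\<Sum>k\<in>K. e k * J k x) + c3 * J' x \<partial>M) =
    c0 + c1 * (\<integral>\<^sup>+x. g x \<partial>M) + c2 * (\<integral>\<^sup>+x. h x \<partial>M) + (\<Sum>k\<in>K. e k * (\<integral>\<^sup>+x. J k x \<partial>M))
      + c3 * (\<integral>\<^sup>+x. J' x \<partial>M)"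
  using prob_space.emeasure_space_1[OF M]
  by (simp add: nn_integral_add nn_integral_cmult nn_integral_sum)

context density_model
begin

lemma noise_measurable: "noise n k \<in> borel_measurable (sample_law f n)"
proof -
  have "coeff_hat s n = (\<lambda>X j. (\<Sum>i=1..n. \<phi> j (X i)) / real n)"
    by (intro ext) (rule coeff_hat_def)
  then show ?thesis
    unfolding noise_def[abs_def] sample_law_def
    by (simp only:) (intro borel_measurable_sum borel_measurable_power borel_measurable_diff
        borel_measurable_divide borel_measurable_const sample_sum_measurable, simp)
qed

text \<open>Half of the exponent \<open>9 * H / (32 * F)\<close> per unit of
  \<open>sqrt k\<close>.\<close>

definition decay :: real where "decay = 9 * C * v / (64 * F)"

lemma decay_pos: "0 < decay"
  using C_ge_1 v_ge_1 F_pos by (simp add: decay_def)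

text \<open>In the first exponential one half of the exponent yields the factor
  \<open>oracle_rate\<close> and the other stays for the summation over \<open>k\<close>. The second
  exponential is bounded through the envelope conditions.\<close>

lemma noise_tail_le:
  assumes n: "1 \<le> n" and k: "1 \<le> k" "oracle_dim s f n \<le> k"
    and low: "400 * F / (C * v) * \<bar>ln (oracle_rate s f n)\<bar> \<le> sqrt (real (oracle_dim s f n))"
    and env: "4 * real k powr d \<le> real n * sqrt (real k)"
      "4 * real k powr d * (5 * ln (real n))\<^sup>2 \<le> real n * sqrt (real k)"
  shows "(\<integral>\<^sup>+X. indicator {X. 16 * (C * v * sqrt (real k)) / real n < noise n k X} X \<partial>sample_law f n)
    \<le> ennreal (oracle_rate s f n * exp (- (decay * sqrt (real k))) + 1 / real n ^ 5)"
proof -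
  let ?R = "oracle_rate s f n" and ?k0 = "oracle_dim s f n" and ?r = "sqrt (real k)"
  define H where "H = C * v * ?r"
  have R: "0 < ?R" using oracle_rate_ge[OF n] n by (simp add: order_less_le_trans[of 0 "1 / real n"])
  have Cv: "0 < C * v" using C_ge_1 v_ge_1 by simp
  \<comment> \<open>The factor 225 / 4 is 400 * 9 / 64, from the oracle assumption and
    \<open>decay\<close>.\<close>
  have "\<bar>ln ?R\<bar> \<le> 225 / 4 * \<bar>ln ?R\<bar>" by simp
  also have "225 / 4 * \<bar>ln ?R\<bar> = decay * (400 * F / (C * v) * \<bar>ln ?R\<bar>)"
    using C_ge_1 v_ge_1 F_pos by (auto simp: decay_def field_simps)
  also have "\<dots> \<le> decay * sqrt (real ?k0)" using low decay_pos by (intro mult_left_mono) auto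
  also have "\<dots> \<le> decay * ?r" using k decay_pos by (intro mult_left_mono) auto
  finally have "- (decay * ?r) \<le> ln ?R" by simp
  then have "exp (- (decay * ?r)) \<le> ?R" using R by (subst ln_ge_iff[symmetric]) auto
  then have "exp (- (decay * ?r)) * exp (- (decay * ?r)) \<le> ?R * exp (- (decay * ?r))"
    by (rule mult_right_mono) simp
  moreover have "9 * H / (32 * F) = decay * ?r + decay * ?r"
    using F_pos by (simp add: decay_def H_def field_simps)
  ultimately have first: "exp (- (9 * H / (32 * F))) \<le> ?R * exp (- (decay * ?r))"
    by (simp add: exp_add[symmetric])
  \<comment> \<open>In these variables the exponent is
    \<open>9 * y\<^sup>2 / (8 * b * y + b\<^sup>2)\<close>. With \<open>b \<le> y\<close> it is at
    least \<open>y / b\<close>, and this is at least \<open>5 * ln n\<close>.\<close>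
  define b y where "b = sqrt (envelope k)" and "y = sqrt (real n * H)"
  have b: "0 < b" "b\<^sup>2 = envelope k" using envelope_pos[OF k(1)] by (simp_all add: b_def)
  have H0: "0 < H" using Cv k by (simp add: H_def)
  then have y: "0 < y" "y\<^sup>2 = real n * H" using n by (simp_all add: y_def)
  have envH: "envelope k * t \<le> real n * H" if "4 * real k powr d * t \<le> real n * ?r" for t
  proof -
    have "envelope k * t = C * (4 * real k powr d * t)" by (simp add: envelope_def)
    also have "\<dots> \<le> C * (real n * ?r)" using that C_ge_1 by (intro mult_left_mono) auto
    also have "\<dots> \<le> C * (real n * ?r) * v"
    proof -
      have "0 \<le> C * (real n * ?r)" using C_ge_1 by simp
      from mult_left_mono[OF v_ge_1 this] show ?thesis by simp
    qed
    finally show ?thesis by (simp add: H_def mult_ac)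
  qed
  have "b\<^sup>2 \<le> y\<^sup>2" using envH[of 1] env(1) by (simp add: b y)
  then have by1: "b \<le> y" using y(1) by (rule power2_le_imp_le[OF _ less_imp_le])
  have "(b * (5 * ln (real n)))\<^sup>2 \<le> y\<^sup>2" using envH[OF env(2)] by (simp add: power_mult_distrib b y)
  then have byln: "b * (5 * ln (real n)) \<le> y" using y(1) by (rule power2_le_imp_le[OF _ less_imp_le])
  have "5 * ln (real n) \<le> y / b" using byln b(1) by (simp add: pos_le_divide_eq mult.commute)
  also have "y / b = 9 * y\<^sup>2 / (9 * b * y)" using y(1) b(1) by (simp add: field_simps power2_eq_square)
  also have "\<dots> \<le> 9 * y\<^sup>2 / (8 * b * y + b\<^sup>2)"
  proof (intro divide_left_mono mult_pos_pos)
    have "b * b \<le> b * y" using by1 b(1) by (intro mult_left_mono) auto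
    then show "8 * b * y + b\<^sup>2 \<le> 9 * b * y" by (simp add: power2_eq_square)
    show "0 < 8 * b * y + b\<^sup>2" using b(1) y(1) by (simp add: add_pos_pos)
  qed (use b(1) y(1) in auto)
  finally have "5 * ln (real n) \<le> 9 * real n * H / (8 * sqrt (envelope k) * sqrt (real n * H) + envelope k)"
    by (simp only: b y b_def[symmetric] y_def[symmetric] mult.assoc)
  then have "exp (- (9 * real n * H / (8 * sqrt (envelope k) * sqrt (real n * H) + envelope k))) \<le> exp (- (5 * ln (real n)))"
    by simp
  also have "\<dots> = 1 / real n ^ 5"
  proof -
    have "exp (5 * ln (real n)) = exp (ln (real n)) ^ 5" by (subst exp_of_nat_mult[symmetric]) simp
    then show ?thesis using n by (simp add: exp_minus inverse_eq_divide)
  qed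
  finally have second: "exp (- (9 * real n * H / (8 * sqrt (envelope k) * sqrt (real n * H) + envelope k))) \<le> 1 / real n ^ 5" .
  have "(\<integral>\<^sup>+X. indicator {X. 16 * H / real n < noise n k X} X \<partial>sample_law f n)
      \<le> ennreal (exp (- (9 * H / (32 * F)))
      + exp (- (9 * real n * H / (8 * sqrt (envelope k) * sqrt (real n * H) + envelope k))))"
    unfolding H_def by (rule noise_tail[OF n k(1)])
  also have "\<dots> \<le> ennreal (?R * exp (- (decay * ?r)) + 1 / real n ^ 5)"
    using first second by (intro ennreal_leI add_mono)
  finally show ?thesis by (simp only: H_def)
qed

text \<open>Each summand is at most 8 / n times an exponential in \<open>sqrt k0\<close>, by the
  uniform lower bound on the bias below the oracle; that exponential outweighs the number of
  summands.\<close>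

lemma low_dimension_bias_sum_le:
  assumes n: "1 \<le> n"
  shows "(\<Sum>k\<in>{1..<oracle_dim s f n}. tail_energy k * exp (- (real n * tail_energy k / 4)))
    \<le> 8 * exp_sqrt_series (energy / 8) / real n"
proof -
  let ?k0 = "oracle_dim s f n"
  let ?e = "exp (- (energy / 8 * sqrt (real ?k0)))"
  have n0: "0 < real n" using n by simp
  have "tail_energy k * exp (- (real n * tail_energy k / 4)) \<le> 8 / real n * ?e" if k: "k \<in> {1..<?k0}" for k
  proof -
    \<comment> \<open>With the exponent \<open>2 * x\<close>, one factor \<open>exp (- x)\<close>
      absorbs the bias itself and the other keeps the decay in \<open>sqrt k0\<close>.\<close>
    define x where "x = real n * tail_energy k / 8"
    have "energy * sqrt (real ?k0) / real n \<le> tail_energy k"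
      using k by (intro below_oracle_tail_energy n) auto
    then have ge: "energy / 8 * sqrt (real ?k0) \<le> x" using n0 by (simp add: x_def field_simps)
    have "x \<le> exp x" using exp_ge_add_one_self[of x] by linarith
    then have x: "x * exp (- x) \<le> 1" by (simp add: exp_minus field_simps)
    have "tail_energy k * exp (- (real n * tail_energy k / 4)) = 8 / real n * (x * exp (- x)) * exp (- x)"
      using n0 by (simp add: x_def mult_exp_exp)
    also have "\<dots> \<le> 8 / real n * 1 * ?e"
      using x ge n0 tail_energy_nonneg[of k] by (intro mult_mono) (auto simp: x_def)
    finally show ?thesis by simp
  qed
  then have "(\<Sum>k\<in>{1..<?k0}. tail_energy k * exp (- (real n * tail_energy k / 4)))
      \<le> (\<Sum>k\<in>{1..<?k0}. 8 / real n * ?e)" by (rule sum_mono)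
  also have "\<dots> = real (?k0 - 1) * (8 / real n * ?e)" by simp
  also have "\<dots> \<le> real ?k0 * (8 / real n * ?e)" using n0 by (intro mult_right_mono) auto
  also have "\<dots> = 8 / real n * (real ?k0 * ?e)" by simp
  \<comment> \<open>A single term of the series, at \<open>k0\<close>, is bounded by the whole
    series; this is uniform in \<open>n\<close>.\<close>
  also have "\<dots> \<le> 8 / real n * exp_sqrt_series (energy / 8)"
    using sum_le_exp_sqrt_series[of "energy / 8" "{?k0}"] energy_pos n0
    by (intro mult_left_mono) auto
  finally show ?thesis by simp
qed

text \<open>Summands in order: oracle bias, weights above the oracle, weights below it, oracle
  noise, oracle penalty, failure of the concentration of the noise, failure of the estimate of
  \<open>v\<close>.\<close>

definition risk_constant :: "real \<Rightarrow> real" where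
  "risk_constant \<Delta> = 10 * energy + 16 * C * v * exp_sqrt_series 1 + 8 * exp_sqrt_series (energy / 8)
    + 10 * C * v + 10 * \<Delta> * (v + 1 + moment2) + 8 * C * (exp_sqrt_series decay + 1)
    + 64 * C * v * moment2"

lemma pointwise_loss_le:
  assumes w: "concentrated_weight \<Delta> n w" and n: "1 \<le> n" and \<Delta>: "84 * C \<le> \<Delta>"
    and k0: "oracle_dim s f n \<le> max_dim s n"
  defines "h \<equiv> C * v / real n" and "k0 \<equiv> oracle_dim s f n" and "M \<equiv> max_dim s n"
  shows "(\<Sum>k=1..M. w X k * (noise n k X + tail_energy k)) \<le>
    (10 * energy * oracle_rate s f n + 16 * h * exp_sqrt_series 1 + 8 * exp_sqrt_series (energy / 8) / real n)
    + 10 * noise n k0 X + 10 * \<Delta> * oracle_rate s f n * v_hat s n X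
    + (\<Sum>k\<in>{k0<..M}. 2 * envelope k * indicator {X. 16 * (C * v * sqrt (real k)) / real n < noise n k X} X)
    + 16 * C * v * indicator {X. v_hat s n X < v / 2} X"
proof -
  define q where "q = \<Delta> * v_hat s n X / real n"
  have n0: "0 < real n" using n by simp
  have C0: "0 < C" and v0: "0 < v" using C_ge_1 v_ge_1 by auto
  have \<Delta>0: "0 < \<Delta>" using \<Delta> C0 by linarith
  have k01: "1 \<le> k0" using oracle_dim_attains(1)[OF n] by (simp add: k0_def)
  have k0M: "k0 \<in> {1..M}" using k0 k01 by (simp add: k0_def M_def)
  have h0: "0 < h" using C0 v0 n0 by (simp add: h_def)
  \<comment> \<open>This is \<open>C * v \<ge> 1\<close>; it turns an excess of order
    \<open>h * sqrt k\<close> into a weight \<open>exp (- sqrt k)\<close>.\<close>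
  have nh: "1 \<le> real n * h"
    using n0 mult_mono[OF C_ge_1 v_ge_1] C0 by (simp add: h_def)
  have q0: "0 \<le> q" using \<Delta>0 v_hat_ge_1[of n X] n0 by (simp add: q_def)
  have R: "1 / real n \<le> oracle_rate s f n" by (rule oracle_rate_ge[OF n])
  have "(\<Sum>k=1..M. w X k * (noise n k X + tail_energy k)) \<le> 10 * (noise n k0 X + tail_energy k0 + q * sqrt (real k0))
    + 16 * h * (\<Sum>k\<in>{1..M}. sqrt (real k) * exp (- sqrt (real k)))
    + (\<Sum>k\<in>{1..<k0}. tail_energy k * exp (- (real n * tail_energy k / 4)))
    + 2 * (\<Sum>k\<in>{k0<..M}. noise n k X * of_bool (16 * h * sqrt (real k) < noise n k X))
    + 16 * h * sqrt (real M) * of_bool (q < 42 * h)"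
  proof (rule weighted_loss_bound[where c = "contrast s \<Delta> n X"])
    show "\<And>k. k \<in> {1..M} \<Longrightarrow> 0 \<le> w X k" "(\<Sum>k=1..M. w X k) = 1"
      using w by (auto simp: concentrated_weight_def M_def)
    show "w X k \<le> exp (- (real n * (contrast s \<Delta> n X k - contrast s \<Delta> n X k0)))" if "k \<in> {1..M}" for k
      using w that k0M by (simp add: concentrated_weight_def M_def)
    show "q * sqrt (real k) - q * sqrt (real k0) - 2 * noise n k X - 2 * tail_energy k0
        \<le> contrast s \<Delta> n X k - contrast s \<Delta> n X k0" if "k0 \<le> k" for k
      using contrast_diff_above[OF that, of q "coeff_hat s n X" a] tail_energy_diff[OF that] tail_energy_nonneg[of k]
      unfolding contrast_eq q_def[symmetric] noise_def by linarith
    show "(tail_energy k - tail_energy k0) / 2 - noise n k0 X - q * sqrt (real k0)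
        \<le> contrast s \<Delta> n X k - contrast s \<Delta> n X k0" if "k \<le> k0" for k
      using contrast_diff_below[OF that q0, of a "coeff_hat s n X"] tail_energy_diff[OF that]
      unfolding contrast_eq q_def[symmetric] noise_def by simp
  qed (use k0M n0 q0 h0 nh noise_nonneg noise_mono tail_energy_nonneg tail_energy_antimono in auto)
  moreover have "10 * tail_energy k0 \<le> 10 * energy * oracle_rate s f n"
    using oracle_bias_le[OF n] by (simp add: k0_def)
  moreover have "10 * (q * sqrt (real k0)) \<le> 10 * \<Delta> * oracle_rate s f n * v_hat s n X"
  proof -
    have "q * sqrt (real k0) = \<Delta> * v_hat s n X * (sqrt (real k0) / real n)" by (simp add: q_def)
    also have "\<dots> \<le> \<Delta> * v_hat s n X * oracle_rate s f n"
      using oracle_dim_le_rate[OF n] \<Delta>0 v_hat_ge_1[of n X] by (intro mult_left_mono) (auto simp: k0_def)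
    finally show ?thesis by (simp add: mult_ac)
  qed
  moreover have "16 * h * (\<Sum>k\<in>{1..M}. sqrt (real k) * exp (- sqrt (real k))) \<le> 16 * h * exp_sqrt_series 1"
  proof (intro mult_left_mono)
    have "(\<Sum>k\<in>{1..M}. sqrt (real k) * exp (- sqrt (real k))) \<le> (\<Sum>k\<in>{1..M}. real k * exp (- (1 * sqrt (real k))))"
    proof (intro sum_mono)
      fix k assume "k \<in> {1..M}"
      then have "real k \<le> (real k)\<^sup>2" by (simp add: power2_eq_square)
      then have "sqrt (real k) \<le> sqrt ((real k)\<^sup>2)" by (rule real_sqrt_le_mono)
      then show "sqrt (real k) * exp (- sqrt (real k)) \<le> real k * exp (- (1 * sqrt (real k)))" by simp
    qed
    also have "\<dots> \<le> exp_sqrt_series 1" by (rule sum_le_exp_sqrt_series) auto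
    finally show "(\<Sum>k\<in>{1..M}. sqrt (real k) * exp (- sqrt (real k))) \<le> exp_sqrt_series 1" .
  qed (use h0 in auto)
  moreover have "(\<Sum>k\<in>{1..<k0}. tail_energy k * exp (- (real n * tail_energy k / 4)))
      \<le> 8 * exp_sqrt_series (energy / 8) / real n"
    unfolding k0_def by (rule low_dimension_bias_sum_le[OF n])
  moreover have "2 * (\<Sum>k\<in>{k0<..M}. noise n k X * of_bool (16 * h * sqrt (real k) < noise n k X))
      \<le> (\<Sum>k\<in>{k0<..M}. 2 * envelope k * indicator {X. 16 * (C * v * sqrt (real k)) / real n < noise n k X} X)"
    unfolding sum_distrib_left
  proof (intro sum_mono)
    fix k assume "k \<in> {k0<..M}"
    then have "noise n k X \<le> envelope k" by (intro noise_le n) auto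
    moreover have "16 * h * sqrt (real k) = 16 * (C * v * sqrt (real k)) / real n" by (simp add: h_def)
    ultimately show "2 * (noise n k X * of_bool (16 * h * sqrt (real k) < noise n k X)) \<le>
        2 * envelope k * indicator {X. 16 * (C * v * sqrt (real k)) / real n < noise n k X} X"
      by (simp add: indicator_def)
  qed
  moreover have "16 * h * sqrt (real M) * of_bool (q < 42 * h) \<le> 16 * C * v * indicator {X. v_hat s n X < v / 2} X"
  proof (cases "q < 42 * h")
    case True
    \<comment> \<open>As \<open>\<Delta> \<ge> 84 * C\<close>, a penalty factor below
      \<open>42 * h\<close> forces the estimate below half of \<open>v\<close>.\<close>
    then have "\<Delta> * v_hat s n X < 42 * (C * v)" using n0 by (simp add: q_def h_def divide_less_cancel)
    moreover have "84 * C * v_hat s n X \<le> \<Delta> * v_hat s n X"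
      using \<Delta> v_hat_ge_1[of n X] by (intro mult_right_mono) auto
    ultimately have "C * (84 * v_hat s n X) < C * (42 * v)" by simp
    then have "v_hat s n X < v / 2" using C0 by (simp only: mult_less_cancel_left_pos)
    moreover have "16 * h * sqrt (real M) \<le> 16 * C * v"
    proof -
      have "sqrt (real M) \<le> real n" unfolding M_def using n k0M by (intro sqrt_max_dim_le) (auto simp: M_def)
      then have "16 * h * sqrt (real M) \<le> 16 * h * real n" using h0 by (intro mult_left_mono) auto
      then show ?thesis using n0 by (simp add: h_def)
    qed
    ultimately show ?thesis using True by simp
  qed (use C0 v0 in simp)
  \<comment> \<open>The bookkeeping is isolated for abstract reals, to be matched with the facts
    collected above.\<close>
  moreover have "L \<le> (y' + S' + S2') + 10 * x + z' + T' + U'"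
    if "L \<le> 10 * (x + y + z) + S + S2 + T + U" "10 * y \<le> y'" "10 * z \<le> z'" "S \<le> S'" "S2 \<le> S2'"
      "T \<le> T'" "U \<le> U'" for L x y z S S2 T U y' z' S' S2' T' U' :: real
    using that by simp
  ultimately show ?thesis by blast
qed

lemma oracle_risk_le:
  assumes w: "concentrated_weight \<Delta> n w" and n: "1 \<le> n" and \<Delta>: "84 * C \<le> \<Delta>"
    and k0: "oracle_dim s f n \<le> max_dim s n"
    and low: "400 * F / (C * v) * \<bar>ln (oracle_rate s f n)\<bar> \<le> sqrt (real (oracle_dim s f n))"
    and env: "\<forall>k\<in>{1..max_dim s n}. 4 * real k powr d \<le> real n * sqrt (real k) \<and>
      4 * real k powr d * (5 * ln (real n))\<^sup>2 \<le> real n * sqrt (real k)"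
  shows "risk s f n w \<le> ennreal (risk_constant \<Delta> * oracle_rate s f n)"
proof -
  define h where "h = C * v / real n"
  define k0 where "k0 = oracle_dim s f n"
  define M where "M = max_dim s n"
  define R where "R = oracle_rate s f n"
  let ?P = "sample_law f n"
  have n0: "0 < real n" using n by simp
  have C0: "0 < C" and v0: "0 < v" using C_ge_1 v_ge_1 by auto
  have \<Delta>0: "0 < \<Delta>" using \<Delta> C0 by linarith
  have k01: "1 \<le> k0" using oracle_dim_attains(1)[OF n] by (simp add: k0_def)
  have k0M: "k0 \<le> M" using k0 by (simp add: k0_def M_def)
  have R: "1 / real n \<le> R" unfolding R_def by (rule oracle_rate_ge[OF n])
  then have R0: "0 < R" using n0 by (simp add: order_less_le_trans[of 0 "1 / real n"])
  note series = exp_sqrt_series_nonneg[of 1] exp_sqrt_series_nonneg[of "energy / 8"] exp_sqrt_series_nonneg[of decay]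
  note m0 = moment2_nonneg
  define c0 where "c0 = 10 * energy * R + 16 * h * exp_sqrt_series 1 + 8 * exp_sqrt_series (energy / 8) / real n"
  define A where "A k = {X. 16 * (C * v * sqrt (real k)) / real n < noise n k X}" for k
  define A' where "A' = {X. v_hat s n X < v / 2}"
  have c0: "0 \<le> c0" using energy_pos R0 C0 v0 n0 series by (simp add: c0_def h_def)
  have env0: "0 \<le> envelope k" for k using C0 by (simp add: envelope_def)
  let ?g = "\<lambda>X. ennreal c0 + ennreal 10 * ennreal (noise n k0 X) + ennreal (10 * \<Delta> * R) * ennreal (v_hat s n X)
      + (\<Sum>k\<in>{k0<..M}. ennreal (2 * envelope k) * indicator (A k) X) + ennreal (16 * C * v) * indicator A' X"
  have "risk s f n w \<le> (\<integral>\<^sup>+X. ?g X \<partial>?P)"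
    unfolding risk_def
  proof (rule nn_integral_mono)
    fix X
    have v1: "0 \<le> v_hat s n X" using v_hat_ge_1[of n X] by simp
    have S0: "0 \<le> (\<Sum>k\<in>{k0<..M}. 2 * envelope k * indicator (A k) X :: real)"
      using env0 by (intro sum_nonneg) simp
    have "(norm_on (domain_of s) (\<lambda>x. aggregate s n w X x - f x))\<^sup>2 \<le> c0 + 10 * noise n k0 X + 10 * \<Delta> * R * v_hat s n X
        + (\<Sum>k\<in>{k0<..M}. 2 * envelope k * indicator (A k) X) + 16 * C * v * indicator A' X"
      using order_trans[OF loss_le[OF w] pointwise_loss_le[OF w n \<Delta> k0]]
      unfolding A_def A'_def c0_def h_def k0_def M_def R_def .
    then have "ennreal ((norm_on (domain_of s) (\<lambda>x. aggregate s n w X x - f x))\<^sup>2) \<le>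
        ennreal (c0 + 10 * noise n k0 X + 10 * \<Delta> * R * v_hat s n X
        + (\<Sum>k\<in>{k0<..M}. 2 * envelope k * indicator (A k) X) + 16 * C * v * indicator A' X)"
      by (rule ennreal_leI)
    also have "\<dots> = ennreal c0 + ennreal (10 * noise n k0 X) + ennreal (10 * \<Delta> * R * v_hat s n X)
        + ennreal (\<Sum>k\<in>{k0<..M}. 2 * envelope k * indicator (A k) X) + ennreal (16 * C * v * indicator A' X)"
      using c0 noise_nonneg[of n k0 X] \<Delta>0 R0 v1 S0 C0 v0 by (subst ennreal_plus, simp_all)+
    also have "\<dots> = ?g X"
      using noise_nonneg[of n k0 X] \<Delta>0 R0 v1 C0 v0 env0
      by (simp add: ennreal_mult' sum_ennreal[symmetric] ennreal_indicator)
    finally show "ennreal ((norm_on (domain_of s) (\<lambda>x. aggregate s n w X x - f x))\<^sup>2) \<le> ?g X" .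
  qed
  also have "\<dots> = ennreal c0 + ennreal 10 * (\<integral>\<^sup>+X. ennreal (noise n k0 X) \<partial>?P)
      + ennreal (10 * \<Delta> * R) * (\<integral>\<^sup>+X. ennreal (v_hat s n X) \<partial>?P)
      + (\<Sum>k\<in>{k0<..M}. ennreal (2 * envelope k) * (\<integral>\<^sup>+X. indicator (A k) X \<partial>?P))
      + ennreal (16 * C * v) * (\<integral>\<^sup>+X. indicator A' X \<partial>?P)"
  proof -
    have [measurable]: "noise n k \<in> borel_measurable ?P" for k by (rule noise_measurable)
    have [measurable]: "v_hat s n \<in> borel_measurable ?P" by (rule v_hat_measurable)
    have [measurable]: "(\<lambda>X. indicator (A k) X :: ennreal) \<in> borel_measurable ?P" for k
      unfolding A_def by (rule indicator_less_measurable) simp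
    have [measurable]: "(\<lambda>X. indicator A' X :: ennreal) \<in> borel_measurable ?P"
      unfolding A'_def by (rule indicator_less_measurable) simp
    show ?thesis
      by (rule nn_integral_affine_combination[OF prob_space_sample]) measurable
  qed
  also have "\<dots> \<le> ennreal c0 + ennreal (10 * C * v * R) + ennreal (10 * \<Delta> * (v + 1 + moment2) * R)
      + ennreal (8 * C * (exp_sqrt_series decay + 1) * R) + ennreal (64 * C * v * moment2 * R)"
  proof (intro add_mono order_refl)
    have "ennreal 10 * (\<integral>\<^sup>+X. ennreal (noise n k0 X) \<partial>?P) \<le> ennreal 10 * ennreal (C * v * sqrt (real k0) / real n)"
      by (intro mult_left_mono noise_expectation n k01) simp
    also have "\<dots> = ennreal (10 * (C * v * (sqrt (real k0) / real n)))"
      using C0 v0 by (subst ennreal_mult[symmetric]) auto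
    also have "\<dots> \<le> ennreal (10 * (C * v * R))"
      using oracle_dim_le_rate[OF n] C0 v0 by (intro ennreal_leI mult_left_mono) (auto simp: k0_def R_def)
    finally show "ennreal 10 * (\<integral>\<^sup>+X. ennreal (noise n k0 X) \<partial>?P) \<le> ennreal (10 * C * v * R)"
      by (simp add: mult.assoc)
    have "ennreal (10 * \<Delta> * R) * (\<integral>\<^sup>+X. ennreal (v_hat s n X) \<partial>?P) \<le> ennreal (10 * \<Delta> * R) * ennreal (v + 1 + moment2)"
      by (intro mult_left_mono v_hat_expectation n) simp
    also have "\<dots> = ennreal (10 * \<Delta> * (v + 1 + moment2) * R)"
      using \<Delta>0 R0 v0 m0 by (subst ennreal_mult[symmetric]) (auto simp: mult_ac)
    finally show "ennreal (10 * \<Delta> * R) * (\<integral>\<^sup>+X. ennreal (v_hat s n X) \<partial>?P) \<le> ennreal (10 * \<Delta> * (v + 1 + moment2) * R)" .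
    have "ennreal (16 * C * v) * (\<integral>\<^sup>+X. indicator A' X \<partial>?P) \<le> ennreal (16 * C * v) * ennreal (4 * moment2 / real n)"
      unfolding A'_def by (intro mult_left_mono v_hat_small n) simp
    also have "\<dots> = ennreal (64 * C * v * moment2 * (1 / real n))"
      using C0 v0 m0 by (subst ennreal_mult[symmetric]) (auto simp: mult_ac)
    also have "\<dots> \<le> ennreal (64 * C * v * moment2 * R)"
      using R C0 v0 m0 by (intro ennreal_leI mult_left_mono) auto
    finally show "ennreal (16 * C * v) * (\<integral>\<^sup>+X. indicator A' X \<partial>?P) \<le> ennreal (64 * C * v * moment2 * R)" .
    have "(\<Sum>k\<in>{k0<..M}. ennreal (2 * envelope k) * (\<integral>\<^sup>+X. indicator (A k) X \<partial>?P)) \<le>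
        (\<Sum>k\<in>{k0<..M}. ennreal (8 * C * R * (real k * exp (- (decay * sqrt (real k)))) + 8 * C * (real M / real n ^ 5)))"
    proof (intro sum_mono)
      fix k assume k: "k \<in> {k0<..M}"
      \<comment> \<open>Since \<open>d \<le> 1\<close> the envelope is at most linear in
        \<open>k\<close>, the growth that \<open>exp_sqrt_series\<close> allows.\<close>
      have "real k powr d \<le> real k powr 1" using k by (intro powr_mono d_of_le_1) auto
      then have ek: "2 * envelope k \<le> 8 * C * real k" using C0 k by (simp add: envelope_def)
      have "k \<in> {1..max_dim s n}" using k k01 by (simp add: M_def)
      then have "(\<integral>\<^sup>+X. indicator (A k) X \<partial>?P) \<le> ennreal (R * exp (- (decay * sqrt (real k))) + 1 / real n ^ 5)"
        unfolding A_def R_def using k env by (intro noise_tail_le[OF n _ _ low]) (auto simp: k0_def)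
      then have "ennreal (2 * envelope k) * (\<integral>\<^sup>+X. indicator (A k) X \<partial>?P) \<le>
          ennreal (8 * C * real k) * ennreal (R * exp (- (decay * sqrt (real k))) + 1 / real n ^ 5)"
        by (intro mult_mono ennreal_leI[OF ek]) auto
      also have "\<dots> = ennreal (8 * C * R * (real k * exp (- (decay * sqrt (real k)))) + 8 * C * (real k / real n ^ 5))"
        using C0 R0 by (subst ennreal_mult[symmetric]) (auto simp: algebra_simps)
      also have "\<dots> \<le> ennreal (8 * C * R * (real k * exp (- (decay * sqrt (real k)))) + 8 * C * (real M / real n ^ 5))"
        using k C0 by (intro ennreal_leI add_left_mono mult_left_mono divide_right_mono) auto
      finally show "ennreal (2 * envelope k) * (\<integral>\<^sup>+X. indicator (A k) X \<partial>?P) \<le>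
          ennreal (8 * C * R * (real k * exp (- (decay * sqrt (real k)))) + 8 * C * (real M / real n ^ 5))" .
    qed
    also have "\<dots> = ennreal (\<Sum>k\<in>{k0<..M}. 8 * C * R * (real k * exp (- (decay * sqrt (real k)))) + 8 * C * (real M / real n ^ 5))"
      using C0 R0 by (intro sum_ennreal) simp
    also have "\<dots> \<le> ennreal (8 * C * (exp_sqrt_series decay + 1) * R)"
    proof (rule ennreal_leI)
      have "(\<Sum>k\<in>{k0<..M}. 8 * C * R * (real k * exp (- (decay * sqrt (real k)))) + 8 * C * (real M / real n ^ 5)) =
          8 * C * R * (\<Sum>k\<in>{k0<..M}. real k * exp (- (decay * sqrt (real k)))) + 8 * C * (real (M - k0) * real M / real n ^ 5)"
        by (simp add: sum.distrib sum_distrib_left[symmetric])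
      also have "\<dots> \<le> 8 * C * R * exp_sqrt_series decay + 8 * C * R"
      proof (intro add_mono mult_left_mono sum_le_exp_sqrt_series decay_pos)
        have "sqrt (real M) \<le> real n" unfolding M_def using n k01 k0M by (intro sqrt_max_dim_le) (auto simp: M_def)
        then have "real M \<le> (real n)\<^sup>2" by (simp add: real_sqrt_le_iff' sqrt_le_D)
        \<comment> \<open>At most n^2 dimensions, each with an envelope of order at most n^2,
          against the probability 1 / n^5: this leaves 1 / n.\<close>
        then have "real (M - k0) * real M \<le> (real n)\<^sup>2 * (real n)\<^sup>2" by (intro mult_mono) auto
        then have "real (M - k0) * real M / real n ^ 5 \<le> (real n)\<^sup>2 * (real n)\<^sup>2 / real n ^ 5"
          by (rule divide_right_mono) simp
        also have "\<dots> = 1 / real n" using n0 by (simp add: field_simps power2_eq_square power_numeral_reduce)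
        finally show "real (M - k0) * real M / real n ^ 5 \<le> R" using R by simp
      qed (use C0 R0 in auto)
      also have "\<dots> = 8 * C * (exp_sqrt_series decay + 1) * R" by (simp add: algebra_simps)
      finally show "(\<Sum>k\<in>{k0<..M}. 8 * C * R * (real k * exp (- (decay * sqrt (real k)))) + 8 * C * (real M / real n ^ 5))
          \<le> 8 * C * (exp_sqrt_series decay + 1) * R" .
    qed
    finally show "(\<Sum>k\<in>{k0<..M}. ennreal (2 * envelope k) * (\<integral>\<^sup>+X. indicator (A k) X \<partial>?P))
        \<le> ennreal (8 * C * (exp_sqrt_series decay + 1) * R)" .
  qed
  also have "\<dots> = ennreal (c0 + 10 * C * v * R + 10 * \<Delta> * (v + 1 + moment2) * R
      + 8 * C * (exp_sqrt_series decay + 1) * R + 64 * C * v * moment2 * R)"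
    using c0 C0 v0 R0 \<Delta>0 m0 series decay_pos by (subst ennreal_plus, simp_all)+
  also have "\<dots> \<le> ennreal (risk_constant \<Delta> * R)"
  proof (rule ennreal_leI)
    have "16 * h * exp_sqrt_series 1 = 16 * C * v * exp_sqrt_series 1 * (1 / real n)" by (simp add: h_def)
    also have "\<dots> \<le> 16 * C * v * exp_sqrt_series 1 * R"
      using R C0 v0 series by (intro mult_left_mono) auto
    finally have "16 * h * exp_sqrt_series 1 \<le> 16 * C * v * exp_sqrt_series 1 * R" .
    moreover have "8 * exp_sqrt_series (energy / 8) * (1 / real n) \<le> 8 * exp_sqrt_series (energy / 8) * R"
      using R series energy_pos by (intro mult_left_mono) auto
    ultimately have "c0 \<le> (10 * energy + 16 * C * v * exp_sqrt_series 1 + 8 * exp_sqrt_series (energy / 8)) * R"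
      by (simp add: c0_def algebra_simps)
    then show "c0 + 10 * C * v * R + 10 * \<Delta> * (v + 1 + moment2) * R
      + 8 * C * (exp_sqrt_series decay + 1) * R + 64 * C * v * moment2 * R \<le> risk_constant \<Delta> * R"
      by (simp add: risk_constant_def distrib_right)
  qed
  finally show ?thesis by (simp only: R_def)
qed

text \<open>The constant is chosen before \<open>n\<close> and \<open>w\<close>, so one constant
  serves both weightings.\<close>

lemma uniform_risk_bound:
  assumes \<Delta>: "84 * C \<le> \<Delta>"
    and ev: "\<forall>\<^sub>F n in sequentially. oracle_dim s f n \<le> max_dim s n \<and>
      400 * F / (C * v) * \<bar>ln (oracle_rate s f n)\<bar> \<le> sqrt (real (oracle_dim s f n))"
  shows "\<exists>C\<^sub>f. \<forall>n\<ge>1. max_dim s n \<ge> 1 \<longrightarrow> (\<forall>w. concentrated_weight \<Delta> n w \<longrightarrow>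
    risk s f n w \<le> ennreal (C\<^sub>f * oracle_rate s f n))"
proof -
  from eventually_conj[OF ev eventually_envelope_small[of s]]
  obtain N where N: "\<And>n. N \<le> n \<Longrightarrow> oracle_dim s f n \<le> max_dim s n \<and>
      400 * F / (C * v) * \<bar>ln (oracle_rate s f n)\<bar> \<le> sqrt (real (oracle_dim s f n)) \<and>
      (\<forall>k\<in>{1..max_dim s n}. 4 * real k powr d \<le> real n * sqrt (real k) \<and>
        4 * real k powr d * (5 * ln (real n))\<^sup>2 \<le> real n * sqrt (real k))"
    unfolding eventually_sequentially by auto
  \<comment> \<open>The factor \<open>n\<close> compensates \<open>oracle_rate \<ge> 1 / n\<close>,
    so a finite sum of these values covers all early \<open>n\<close>.\<close>
  define E where "E n = (envelope (max_dim s n) + energy) * real n" for n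
  have E0: "0 \<le> E n" for n using C_ge_1 energy_pos by (simp add: E_def envelope_def)
  define C\<^sub>f where "C\<^sub>f = max (risk_constant \<Delta>) (\<Sum>n<N. E n)"
  show ?thesis
  proof (intro exI[of _ C\<^sub>f] allI impI)
    fix n w assume n: "1 \<le> n" and M: "1 \<le> max_dim s n" and w: "concentrated_weight \<Delta> n w"
    have R: "1 / real n \<le> oracle_rate s f n" by (rule oracle_rate_ge[OF n])
    then have R0: "0 \<le> oracle_rate s f n" by (rule order_trans[rotated]) simp
    show "risk s f n w \<le> ennreal (C\<^sub>f * oracle_rate s f n)"
    proof (cases "N \<le> n")
      case True
      have "risk s f n w \<le> ennreal (risk_constant \<Delta> * oracle_rate s f n)"
        using N[OF True] by (intro oracle_risk_le[OF w n \<Delta>]) auto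
      also have "\<dots> \<le> ennreal (C\<^sub>f * oracle_rate s f n)"
        using R0 by (intro ennreal_leI mult_right_mono) (auto simp: C\<^sub>f_def)
      finally show ?thesis .
    next
      case False
      have "envelope (max_dim s n) + energy = E n * (1 / real n)" using n by (simp add: E_def)
      also have "\<dots> \<le> E n * oracle_rate s f n" using R E0 by (rule mult_left_mono)
      also have "\<dots> \<le> C\<^sub>f * oracle_rate s f n"
      proof (rule mult_right_mono[OF _ R0])
        have "E n \<le> (\<Sum>n<N. E n)" using False E0 by (intro member_le_sum) auto
        then show "E n \<le> C\<^sub>f" by (simp add: C\<^sub>f_def)
      qed
      finally show ?thesis
        using order_trans[OF crude_risk_le[OF w n M] ennreal_leI] by blast
    qed
  qed
qed

end

theorem corollary3p4:
  fixes s :: setting and C \<Delta> \<kappa> :: real and f :: "real \<Rightarrow> real"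
  assumes "basis_constant s C"
    and "\<Delta> \<ge> 84 * C"
    and "\<kappa> \<ge> 1"
    and "L2_density (domain_of s) f"
    and "sup_norm f < \<infinity>"
    and "integrable (law f) (\<lambda>x. \<bar>x\<bar> powr (2 * alpha_of s))"
    and "\<forall>k\<ge>1. bias s f k > 0"
    and "\<exists>n\<^sub>f\<ge>1. \<forall>n\<ge>n\<^sub>f.
           sqrt (real (max_dim s n)) \<ge> sqrt (real (oracle_dim s f n)) \<and>
           sqrt (real (oracle_dim s f n)) \<ge>
             max 1 (400 * real_of_ereal (sup_norm f)) / (C * v_of s f) * \<bar>ln (oracle_rate s f n)\<bar>"
  shows "\<exists>C\<^sub>f. \<forall>n\<ge>1. max_dim s n \<ge> 1 \<longrightarrow>
           risk s f n (bayes_weight s \<Delta> \<kappa> n) \<le> ennreal (C\<^sub>f * oracle_rate s f n) \<and>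
           risk s f n (selection_weight s \<Delta> n) \<le> ennreal (C\<^sub>f * oracle_rate s f n)"
proof -
  interpret density_model s C f by unfold_locales fact+
  obtain N where N: "\<And>n. N \<le> n \<Longrightarrow> sqrt (real (oracle_dim s f n)) \<le> sqrt (real (max_dim s n)) \<and>
      max 1 (400 * F) / (C * v_of s f) * \<bar>ln (oracle_rate s f n)\<bar> \<le> sqrt (real (oracle_dim s f n))"
    using assms(8) unfolding F_def by blast
  have le: "400 * F / (C * v_of s f) * t \<le> max 1 (400 * F) / (C * v_of s f) * t" if "0 \<le> t" for t
    using that C_ge_1 v_ge_1 by (intro mult_right_mono divide_right_mono) auto
  have "oracle_dim s f n \<le> max_dim s n \<and>
      400 * F / (C * v_of s f) * \<bar>ln (oracle_rate s f n)\<bar> \<le> sqrt (real (oracle_dim s f n))" if "N \<le> n" for n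
  proof
    show "oracle_dim s f n \<le> max_dim s n" using N[OF that] by simp
    show "400 * F / (C * v_of s f) * \<bar>ln (oracle_rate s f n)\<bar> \<le> sqrt (real (oracle_dim s f n))"
      using order_trans[OF le[OF abs_ge_zero] conjunct2[OF N[OF that]]] .
  qed
  then have "\<forall>\<^sub>F n in sequentially. oracle_dim s f n \<le> max_dim s n \<and>
      400 * F / (C * v_of s f) * \<bar>ln (oracle_rate s f n)\<bar> \<le> sqrt (real (oracle_dim s f n))"
    unfolding eventually_sequentially by blast
  from uniform_risk_bound[OF assms(2) this] obtain C\<^sub>f where
    "\<And>n w. 1 \<le> n \<Longrightarrow> 1 \<le> max_dim s n \<Longrightarrow> concentrated_weight \<Delta> n w \<Longrightarrow>
      risk s f n w \<le> ennreal (C\<^sub>f * oracle_rate s f n)" by blast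
  then show ?thesis
    using concentrated_bayes_weight[OF _ assms(3)] concentrated_selection_weight
    by (intro exI[of _ C\<^sub>f]) blast
qed

end
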